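(* Let $p$ be an odd prime and $x\in\mathbb Z_p$ with $x\not\equiv0\pmod p$. Then $$\sum_{n=0}^{p-1}(-1)^nV_n(x)\equiv\begin{cases}\displaystyle\sum_{k=0}^{(p-1)/2}\binom{2k}k\binom xk\binom{-1-x}k\frac1{4^k}\pmod{p^2}&\text{if }\langle x\rangle_p\text{ is even},\\0\pmod p&\text{if }\langle x\rangle_p\text{ is odd}.\end{cases}$$ Consequently, for $p>3$ (with $u,v$ integers): $\sum_{n=0}^{p-1}\frac{V_n^{(3)}}{(-27)^n}\equiv4u^2-2p\pmod{p^2}$ if $p=u^2+3v^2\equiv1\pmod3$, and $\equiv0\pmod p$ if $p\equiv2\pmod3$; $\sum_{n=0}^{p-1}\frac{V_n^{(4)}}{(-64)^n}\equiv4u^2-2p\pmod{p^2}$ if $p=u^2+2v^2\equiv1,3\pmod8$, and $\equiv0\pmod p$ if $p\equiv5,7\pmod8$; $\sum_{n=0}^{p-1}\frac{V_n^{(6)}}{(-432)^n}\equiv(-1)^{[p/3]}(4u^2-2p)\pmod{p^2}$ if $p=u^2+4v^2\equiv1\pmod4$, and $\equiv0\pmod p$ if $p\equiv3\pmod4$.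
   Context: For real $x$ and integer $k\ge0$, $\binom xk=x(x-1)\cdots(x-k+1)/k!$. $V_n(x)=\sum_{k=0}^n\binom nk\binom{n+k}k(-1)^k\binom xk\binom{-1-x}k$. $\mathbb Z_p$: rationals with denominator prime to $p$; congruences modulo powers of $p$ are in $\mathbb Z_p$; for $x\in\mathbb Z_p$, $\langle x\rangle_p\in\{0,\ldots,p-1\}$ with $x\equiv\langle x\rangle_p\pmod p$. $[y]$ is the floor. $V_n^{(3)}=27^nV_n(-\tfrac13)$, $V_n^{(4)}=64^nV_n(-\tfrac14)$, $V_n^{(6)}=432^nV_n(-\tfrac16)$. *)

theory Defs
  imports Complex_Main "HOL-Number_Theory.Number_Theory"
begin

(* Z_p is the localization of the integers at p inside the rationals, not the p-adic completion. *)
definition Zp :: "nat \<Rightarrow> rat set" where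
  "Zp p = {r. coprime (snd (quotient_of r)) (int p)}"

(* a = b (mod p^m) in Z_p; membership of both sides in Z_p is part of the claim. *)
definition zp_cong :: "nat \<Rightarrow> nat \<Rightarrow> rat \<Rightarrow> rat \<Rightarrow> bool" where
  "zp_cong p m a b \<longleftrightarrow> a \<in> Zp p \<and> b \<in> Zp p \<and> (\<exists>c \<in> Zp p. a - b = of_nat p ^ m * c)"

(* Meaningful for prime p and x in Z_p, where such an r exists and is unique. *)
definition zp_residue :: "nat \<Rightarrow> rat \<Rightarrow> nat" where
  "zp_residue p x = (THE r. r < p \<and> zp_cong p 1 x (of_nat r))"

definition V :: "nat \<Rightarrow> rat \<Rightarrow> rat" where
  "V n x = (\<Sum>k=0..n. of_nat (n choose k) * of_nat ((n + k) choose k) * (-1) ^ k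
                        * (x gchoose k) * ((-1 - x) gchoose k))"

definition V3 :: "nat \<Rightarrow> rat" where
  "V3 n = 27 ^ n * V n (- (1/3))"

definition V4 :: "nat \<Rightarrow> rat" where
  "V4 n = 64 ^ n * V n (- (1/4))"

definition V6 :: "nat \<Rightarrow> rat" where
  "V6 n = 432 ^ n * V n (- (1/6))"

end

theory Submission
  imports Defs "HOL-Algebra.Multiplicative_Group"
begin

text \<open>
Put \<open>Q k x = (\<Prod>i<k. (x - i) (x + 1 + i))\<close>.  Up to unit factors \<open>(x gchoose k) ((-1 - x) gchoose k)\<close>
is \<open>Q k x\<close>, and both sides of the main congruence have the form \<open>Y x = (\<Sum>k<p. y k * Q k x)\<close> with
\<open>y 0 = 1\<close>.  Telescoping in \<open>k\<close> shows that, modulo \<open>p^2\<close> and for every \<open>x\<close> in \<open>Z_p\<close>,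
\<open>(x + 1)^2 Y (x + 1) = x^2 Y (x - 1)\<close>.  Descending in steps of 2 from \<open>x = p t + a\<close> ends at \<open>Y (p t)\<close>, which is
\<open>1 + p t l\<close> with a constant \<open>l\<close> that is forced by the symmetry \<open>Y (-1 - x) = Y x\<close>, or, for odd \<open>a\<close>, passes
through the factor \<open>(p t)^2 = 0\<close>.

For \<open>x = -2/m\<close> with \<open>m = 6, 8, 12\<close> let \<open>d = 3, 2, 1\<close> and consider \<open>E = (\<Sum>k<n. z^k (Tr w^k | p))\<close> with Legendre
symbols, a root of unity \<open>z\<close> of order \<open>m\<close>, and either \<open>w = (g, 1)\<close> in \<open>F_p \<times> F_p\<close> with a primitive root \<open>g\<close> and
\<open>n = p - 1\<close>, or a generator \<open>w\<close> of the multiplicative group of the field with \<open>p^2\<close> elements and \<open>n = p + 1\<close>.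
Over the complex numbers the autocorrelations of the sequence \<open>(Tr w^k | p)\<close> give \<open>E * E' = p\<close> for
the conjugate \<open>E'\<close>, and the substitution \<open>k \<rightarrow> -k\<close> gives \<open>2 E = A + B (z - 1/z)\<close> with integers \<open>A, B\<close> and
\<open>(z - 1/z)^2 = - d\<close>; hence \<open>A^2 + d B^2 = 4 p\<close>.  When \<open>z\<close> and \<open>w\<close> are replaced by Teichmueller representatives
modulo \<open>p^2\<close>, Euler's criterion and the expansion of \<open>(1 + u)^(p (p - 1) / 2)\<close> evaluate \<open>E\<close> to an integer \<open>X\<close>
whose square is the closed form of \<open>Y x\<close>.  Since \<open>X + p / X = A\<close>, this is \<open>A^2 - 2 p\<close> modulo \<open>p^2\<close>.
\<close>

section \<open>The localization of the integers at p\<close>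

text \<open>The values of \<open>m\<close> are tied to \<open>x = -2/m\<close> through a
  decomposition \<open>x = p t + 2 n\<close> with \<open>n <= M\<close>. If \<open>m\<close> divides
  \<open>p - 1\<close>, take \<open>n = (p - 1)/m\<close> and \<open>t = x\<close>; if
  \<open>p + 1\<close> is an odd multiple of \<open>m/2\<close>, take \<open>t = -1 - x\<close>. In
  both cases the first order terms in \<open>p\<close> of \<open>Y x\<close> and of
  \<open>X^2\<close> contain the same combination of harmonic sums, once with the factor
  \<open>t\<close> and once with \<open>2 n\<close> or \<open>-(2 n + 1)\<close>; the match rests on
  \<open>t\<close> being congruent to that number modulo \<open>p\<close>. The norm equation has
  \<open>4 p\<close> where the theorem has \<open>p\<close>, so \<open>A\<close> must be shown to be
  even: for \<open>d = 2\<close> the equation itself gives this, for \<open>d = 3\<close> and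
  \<open>d = 1\<close> the odd terms are counted. For \<open>d = 1\<close> there is a second
  obstacle: \<open>p = u^2 + (2 v)^2\<close> does not tell which square is \<open>(A/2)^2\<close>.
  This is decided by \<open>A\<close> modulo 4: \<open>A/2\<close> is odd for \<open>p = 1\<close>
  modulo 12 and even for \<open>p = 5\<close> modulo 12. In the latter case
  \<open>4 (2 v)^2 - 2 p = - (4 u^2 - 2 p)\<close>, which is the origin of the sign
  \<open>(-1)^[p/3]\<close>.\<close>

lemma Zp_iff:
  assumes "prime p"
  shows "r \<in> Zp p \<longleftrightarrow> (\<exists>a b. \<not> int p dvd b \<and> r = of_int a / of_int b)"
proof
  assume r: "r \<in> Zp p"
  obtain a b where ab: "quotient_of r = (a, b)" by (cases "quotient_of r")
  have "coprime b (int p)" using r ab by (simp add: Zp_def)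
  hence "\<not> int p dvd b"
    using assms coprime_common_divisor[of b "int p" "int p"] by (auto dest: prime_gt_1_nat)
  thus "\<exists>a b. \<not> int p dvd b \<and> r = of_int a / of_int b"
    using quotient_of_div[OF ab] by blast
next
  assume "\<exists>a b. \<not> int p dvd b \<and> r = of_int a / of_int b"
  then obtain a b where b: "\<not> int p dvd b" and r: "r = of_int a / of_int b" by blast
  obtain c d where cd: "quotient_of r = (c, d)" by (cases "quotient_of r")
  have b0: "b \<noteq> 0" using b by auto
  have d: "d > 0" "coprime c d" using quotient_of_denom_pos[OF cd] quotient_of_coprime[OF cd] by auto
  have "(of_int c / of_int d :: rat) = of_int a / of_int b" using quotient_of_div[OF cd] r by simp
  hence "(of_int (c * b) :: rat) = of_int (a * d)" using b0 d by (simp add: field_simps)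
  hence "c * b = a * d" by linarith
  hence "d dvd b" using d(2) by (metis coprime_commute coprime_dvd_mult_right_iff dvd_triv_right)
  hence "\<not> int p dvd d" using b dvd_trans by blast
  hence "coprime d (int p)" using assms
    by (metis coprime_commute prime_imp_coprime prime_nat_int_transfer)
  thus "r \<in> Zp p" using cd by (simp add: Zp_def)
qed

locale odd_prime =
  fixes p M :: nat
  assumes p_prime: "prime p" and p_eq: "p = 2 * M + 1"
begin

lemma M_pos: "M > 0" using p_eq p_prime by (cases M) auto

lemma p_gt: "p > 2" using p_eq M_pos by simp

lemma p_odd: "odd p" using p_eq by simp

lemma pint: "prime (int p)" using p_prime by simp

lemma Zp_int [simp, intro]: "of_int a \<in> Zp p"
  unfolding Zp_iff[OF p_prime] using p_gt by (intro exI[of _ a] exI[of _ 1]) auto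

lemma Zp_nat [simp, intro]: "of_nat a \<in> Zp p" using Zp_int[of "int a"] by simp
lemma Zp_0 [simp, intro]: "0 \<in> Zp p" using Zp_int[of 0] by simp
lemma Zp_1 [simp, intro]: "1 \<in> Zp p" using Zp_int[of 1] by simp
lemma Zp_numeral [simp, intro]: "numeral k \<in> Zp p" using Zp_int[of "numeral k"] by simp

lemma Zp_add [intro]: assumes "a \<in> Zp p" "b \<in> Zp p" shows "a + b \<in> Zp p"
proof -
  from assms obtain a1 a2 b1 b2 where *: "\<not> int p dvd a2" "a = of_int a1 / of_int a2"
    "\<not> int p dvd b2" "b = of_int b1 / of_int b2"
    unfolding Zp_iff[OF p_prime] by blast
  have nz: "a2 \<noteq> 0" "b2 \<noteq> 0" using * by auto
  have "\<not> int p dvd a2 * b2" using * pint by (simp add: prime_dvd_mult_iff)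
  moreover have "a + b = of_int (a1 * b2 + b1 * a2) / of_int (a2 * b2)"
    using nz * by (simp add: field_simps)
  ultimately show ?thesis unfolding Zp_iff[OF p_prime] by blast
qed

lemma Zp_mult [intro]: assumes "a \<in> Zp p" "b \<in> Zp p" shows "a * b \<in> Zp p"
proof -
  from assms obtain a1 a2 b1 b2 where *: "\<not> int p dvd a2" "a = of_int a1 / of_int a2"
    "\<not> int p dvd b2" "b = of_int b1 / of_int b2"
    unfolding Zp_iff[OF p_prime] by blast
  have "\<not> int p dvd a2 * b2" using * pint by (simp add: prime_dvd_mult_iff)
  moreover have "a * b = of_int (a1 * b1) / of_int (a2 * b2)"
    using * by simp
  ultimately show ?thesis unfolding Zp_iff[OF p_prime] by blast
qed

lemma Zp_minus [intro]: "a \<in> Zp p \<Longrightarrow> - a \<in> Zp p" using Zp_mult[of "-1" a] Zp_int[of "-1"] by simp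
lemma Zp_diff [intro]: "a \<in> Zp p \<Longrightarrow> b \<in> Zp p \<Longrightarrow> a - b \<in> Zp p"
  using Zp_add[of a "- b"] by auto
lemma Zp_power [intro]: "a \<in> Zp p \<Longrightarrow> a ^ n \<in> Zp p" by (induction n) auto
lemma Zp_sum [intro]: "(\<And>i. i \<in> A \<Longrightarrow> f i \<in> Zp p) \<Longrightarrow> sum f A \<in> Zp p"
  by (induction A rule: infinite_finite_induct) auto
lemma Zp_prod [intro]: "(\<And>i. i \<in> A \<Longrightarrow> f i \<in> Zp p) \<Longrightarrow> prod f A \<in> Zp p"
  by (induction A rule: infinite_finite_induct) auto

lemma Zp_inv_int [intro]: assumes "\<not> int p dvd a" shows "inverse (of_int a) \<in> Zp p"
  unfolding Zp_iff[OF p_prime] using assms by (intro exI[of _ 1] exI[of _ a]) (auto simp: field_simps)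

lemma Zp_inv_nat [intro]: assumes "\<not> p dvd a" shows "inverse (of_nat a) \<in> Zp p"
  using Zp_inv_int[of "int a"] assms by simp

lemma zp_cong_iff: "zp_cong p m a b \<longleftrightarrow> b \<in> Zp p \<and> (\<exists>c\<in>Zp p. a = b + of_nat p ^ m * c)"
proof
  assume "b \<in> Zp p \<and> (\<exists>c\<in>Zp p. a = b + of_nat p ^ m * c)"
  moreover from this have "a \<in> Zp p" by auto
  ultimately show "zp_cong p m a b" unfolding zp_cong_def by auto
next
  assume "zp_cong p m a b"
  then show "b \<in> Zp p \<and> (\<exists>c\<in>Zp p. a = b + of_nat p ^ m * c)"
    unfolding zp_cong_def by (metis add.commute diff_add_cancel)
qed

lemma zp_cong_refl [intro]: "a \<in> Zp p \<Longrightarrow> zp_cong p m a a"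
  unfolding zp_cong_def by (auto intro!: bexI[of _ 0])

lemma zp_cong_sym: "zp_cong p m a b \<Longrightarrow> zp_cong p m b a"
  unfolding zp_cong_def by (metis Zp_minus minus_diff_eq mult_minus_right)

lemma zp_cong_trans [trans]: "zp_cong p m a b \<Longrightarrow> zp_cong p m b c \<Longrightarrow> zp_cong p m a c"
  unfolding zp_cong_def by (smt (verit) Zp_add distrib_left add_diff_cancel_left' diff_add_cancel diff_diff_eq2 add.commute add_diff_eq)

lemma zp_cong_add: assumes "zp_cong p m a b" "zp_cong p m c d" shows "zp_cong p m (a + c) (b + d)"
proof -
  obtain x y where "x \<in> Zp p" "y \<in> Zp p" "a = b + of_nat p ^ m * x" "c = d + of_nat p ^ m * y"
    "b \<in> Zp p" "d \<in> Zp p" using assms unfolding zp_cong_iff by blast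
  thus ?thesis unfolding zp_cong_iff by (auto intro!: bexI[of _ "x + y"] simp: algebra_simps)
qed

lemma zp_cong_mult: assumes "zp_cong p m a b" "zp_cong p m c d" shows "zp_cong p m (a * c) (b * d)"
proof -
  obtain x y where *: "x \<in> Zp p" "y \<in> Zp p" "a = b + of_nat p ^ m * x" "c = d + of_nat p ^ m * y"
    "b \<in> Zp p" "d \<in> Zp p" using assms unfolding zp_cong_iff by blast
  thus ?thesis unfolding zp_cong_iff
    by (intro conjI bexI[of _ "b * y + d * x + of_nat p ^ m * x * y"])
      (auto simp: algebra_simps intro!: Zp_add Zp_mult)
qed

lemma zp_cong_Zp: "zp_cong p m a b \<Longrightarrow> a \<in> Zp p" "zp_cong p m a b \<Longrightarrow> b \<in> Zp p"
  unfolding zp_cong_def by auto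

lemma zp_cong_minus: "zp_cong p m a b \<Longrightarrow> zp_cong p m (- a) (- b)"
  using zp_cong_mult[OF zp_cong_refl[of "-1"], of m a b] Zp_int[of "-1"] by simp

lemma zp_cong_diff: "zp_cong p m a b \<Longrightarrow> zp_cong p m c d \<Longrightarrow> zp_cong p m (a - c) (b - d)"
  using zp_cong_add[OF _ zp_cong_minus, of m a b c d] by simp

lemma zp_cong_power: "zp_cong p m a b \<Longrightarrow> zp_cong p m (a ^ n) (b ^ n)"
  by (induction n) (auto intro: zp_cong_mult)

lemma zp_cong_sum: "(\<And>i. i \<in> A \<Longrightarrow> zp_cong p m (f i) (g i)) \<Longrightarrow> zp_cong p m (sum f A) (sum g A)"
  by (induction A rule: infinite_finite_induct) (auto intro: zp_cong_add)

lemma zp_cong_prod: "(\<And>i. i \<in> A \<Longrightarrow> zp_cong p m (f i) (g i)) \<Longrightarrow> zp_cong p m (prod f A) (prod g A)"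
  by (induction A rule: infinite_finite_induct) (auto intro: zp_cong_mult)

lemma zp_cong_weaken: assumes "zp_cong p m a b" "k \<le> m" shows "zp_cong p k a b"
proof -
  obtain c where "c \<in> Zp p" "a = b + of_nat p ^ m * c" "b \<in> Zp p" using assms unfolding zp_cong_iff by blast
  thus ?thesis unfolding zp_cong_iff using assms(2)
    by (auto intro!: bexI[of _ "of_nat p ^ (m - k) * c"] simp: power_add[symmetric] mult.assoc[symmetric])
qed

lemma zp_cong_p_mult: assumes "zp_cong p m a b" shows "zp_cong p (Suc m) (of_nat p * a) (of_nat p * b)"
proof -
  obtain c where "c \<in> Zp p" "a = b + of_nat p ^ m * c" "b \<in> Zp p" using assms unfolding zp_cong_iff by blast
  thus ?thesis unfolding zp_cong_iff by (auto intro!: bexI[of _ c] simp: algebra_simps)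
qed

lemma zp_cong_0_p: "c \<in> Zp p \<Longrightarrow> zp_cong p m (of_nat p ^ m * c) 0"
  unfolding zp_cong_iff by auto

lemma zp_cong_0_mult: assumes "zp_cong p k a 0" "zp_cong p l b 0" shows "zp_cong p (k + l) (a * b) 0"
proof -
  obtain x y where "x \<in> Zp p" "y \<in> Zp p" "a = of_nat p ^ k * x" "b = of_nat p ^ l * y"
    using assms unfolding zp_cong_iff by auto
  thus ?thesis unfolding zp_cong_iff by (auto intro!: bexI[of _ "x * y"] simp: power_add)
qed

lemma zp_cong_0_left: "zp_cong p m a 0 \<Longrightarrow> b \<in> Zp p \<Longrightarrow> zp_cong p m (a * b) 0"
  using zp_cong_mult[of m a 0 b b] zp_cong_refl[of b m] by simp

lemma zp_cong_0_right: "zp_cong p m b 0 \<Longrightarrow> a \<in> Zp p \<Longrightarrow> zp_cong p m (a * b) 0"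
  using zp_cong_0_left[of m b a] by (simp add: mult.commute)

lemma zp_cong_cancel: assumes "zp_cong p m (c * a) (c * b)" "inverse c \<in> Zp p" "c \<noteq> 0"
  shows "zp_cong p m a b"
  using zp_cong_mult[OF zp_cong_refl[OF assms(2)] assms(1)] assms(3) by (simp add: field_simps)

text \<open>The witness may have a denominator \<open>v\<close>, but \<open>v\<close> is prime to
  \<open>p\<close> and can be cancelled from the resulting integer equation.\<close>

lemma zp_cong_of_int: "zp_cong p m (of_int a) (of_int b) \<longleftrightarrow> [a = b] (mod int p ^ m)"
proof
  assume "[a = b] (mod int p ^ m)"
  then obtain k where "a = b + int p ^ m * k" by (metis cong_iff_lin cong_sym)
  hence "(of_int a :: rat) = of_int b + of_nat p ^ m * of_int k" by simp
  thus "zp_cong p m (of_int a) (of_int b)" unfolding zp_cong_iff by blast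
next
  assume "zp_cong p m (of_int a) (of_int b)"
  then obtain c where c: "c \<in> Zp p" "(of_int (a - b) :: rat) = of_nat p ^ m * c" 
    unfolding zp_cong_def by auto
  then obtain u v where uv: "\<not> int p dvd v" "c = of_int u / of_int v"
    unfolding Zp_iff[OF p_prime] by blast
  have "v \<noteq> 0" using uv by auto
  hence "(of_int ((a - b) * v) :: rat) = of_int (int p ^ m * u)" using c uv by simp
  hence "(a - b) * v = int p ^ m * u" by linarith
  moreover have "coprime (int p ^ m) v" using uv pint by (simp add: prime_imp_coprime)
  ultimately have "int p ^ m dvd a - b" by (metis coprime_dvd_mult_left_iff dvd_triv_left)
  thus "[a = b] (mod int p ^ m)" by (simp add: cong_iff_dvd_diff)
qed

lemma Zp_inverse: assumes "a \<in> Zp p" "\<not> zp_cong p 1 a 0" shows "inverse a \<in> Zp p" "a \<noteq> 0"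
proof -
  obtain u v where uv: "\<not> int p dvd v" "a = of_int u / of_int v"
    using assms unfolding Zp_iff[OF p_prime] by blast
  have "\<not> int p dvd u"
  proof
    assume "int p dvd u"
    then obtain k where "u = int p * k" by auto
    hence "a = 0 + of_nat p ^ 1 * (of_int k * inverse (of_int v))" using uv by (simp add: field_simps)
    thus False using assms(2) uv(1) unfolding zp_cong_iff by blast
  qed
  thus "inverse a \<in> Zp p" unfolding Zp_iff[OF p_prime] using uv
    by (intro exI[of _ v] exI[of _ u]) auto
  show "a \<noteq> 0" using assms(2) by auto
qed

text \<open>The residue of \<open>u / v\<close> is \<open>u * w mod p\<close>, where
  \<open>w\<close> inverts \<open>v\<close> modulo \<open>p\<close>.\<close>

lemma zp_cong_residue_ex: assumes "x \<in> Zp p" shows "\<exists>!r. r < p \<and> zp_cong p 1 x (of_nat r)"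
proof -
  obtain u v where uv: "\<not> int p dvd v" "x = of_int u / of_int v"
    using assms unfolding Zp_iff[OF p_prime] by blast
  have "coprime v (int p)" using uv pint by (metis coprime_commute prime_imp_coprime)
  then obtain w where w: "[v * w = 1] (mod int p)" using cong_solve_coprime_int by blast
  define r where "r = nat ((u * w) mod int p)"
  have pp: "int p > 0" using p_gt by simp
  have r: "r < p" "int r = (u * w) mod int p" unfolding r_def using pp
    by (auto simp: nat_less_iff)
  have v0: "v \<noteq> 0" using uv by auto
  have "[u = v * (u * w)] (mod int p)" using cong_mult[OF w cong_refl[of u]] 
    by (simp add: cong_sym mult.left_commute mult.commute mult.assoc)
  also have "[v * (u * w) = v * int r] (mod int p)" unfolding r(2) by (simp add: cong_def mod_mult_right_eq)
  finally have "[u = v * int r] (mod int p ^ 1)" by simp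
  hence "zp_cong p 1 (of_int u) (of_int (v * int r))" using zp_cong_of_int[of 1] by blast
  from zp_cong_mult[OF this zp_cong_refl[OF Zp_inv_int[OF uv(1)]]]
  have "zp_cong p 1 (of_int u * inverse (of_int v)) (of_int (v * int r) * inverse (of_int v))" .
  moreover have "of_int (v * int r) * inverse (of_int v) = (of_nat r :: rat)" using v0 by simp
  ultimately have "zp_cong p 1 x (of_nat r)" by (simp only: uv(2) divide_inverse)
  hence xr: "zp_cong p 1 x (of_nat r)" .
  moreover have "r = s" if "s < p" "zp_cong p 1 x (of_nat s)" for s
  proof -
    have "zp_cong p 1 (of_int (int r)) (of_int (int s))"
      using zp_cong_trans[OF zp_cong_sym[OF xr] that(2)] by simp
    hence "[int r = int s] (mod int p)" unfolding zp_cong_of_int by simp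
    thus ?thesis using that(1) r(1) by (simp add: cong_def)
  qed
  ultimately show ?thesis using r by blast
qed

lemma zp_residue: assumes "x \<in> Zp p" shows "zp_residue p x < p" "zp_cong p 1 x (of_nat (zp_residue p x))"
  using theI'[OF zp_cong_residue_ex[OF assms]] unfolding zp_residue_def by auto

end

section \<open>Telescoping modulo the square of p\<close>

text \<open>Each factor equals \<open>x (x + 1) - i (i + 1)\<close>, so \<open>Q k\<close> is a
  polynomial in \<open>x (x + 1)\<close>; this is the source of the symmetry under \<open>x\<close>
  to \<open>-1 - x\<close>.\<close>

definition Q :: "nat \<Rightarrow> rat \<Rightarrow> rat" where
  "Q k x = (\<Prod>i<k. (x - of_nat i) * (x + 1 + of_nat i))"

lemma Q_0 [simp]: "Q 0 x = 1" by (simp add: Q_def)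

lemma Q_Suc: "Q (Suc k) x = Q k x * ((x - of_nat k) * (x + 1 + of_nat k))" by (simp add: Q_def)

lemma Q_reflect: "Q k (- 1 - x) = Q k x"
  by (induction k) (auto simp: Q_Suc algebra_simps)

text \<open>Replacing \<open>x\<close> by \<open>x + 1\<close> moves both products by one index, so
  only end factors differ. The relation is cross-multiplied because \<open>x + 1 - k\<close> may
  vanish.\<close>

lemma Q_shift: "Q k (x + 1) * (x + 1 - of_nat k) = Q k x * (x + 1 + of_nat k)"
proof (induction k)
  case (Suc k)
  have "Q (Suc k) (x + 1) * (x + 1 - of_nat (Suc k))
      = (Q k (x + 1) * (x + 1 - of_nat k)) * ((x + 2 + of_nat k) * (x - of_nat k))"
    by (simp add: Q_Suc algebra_simps)
  also have "\<dots> = Q (Suc k) x * (x + 1 + of_nat (Suc k))"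
    unfolding Suc.IH by (simp add: Q_Suc algebra_simps)
  finally show ?case .
qed simp

lemma Q_plus1: "Q (Suc k) (x + 1) = (x + 2 + of_nat k) * (x + 1 + of_nat k) * Q k x"
proof -
  have "Q (Suc k) (x + 1) = (Q k (x + 1) * (x + 1 - of_nat k)) * (x + 2 + of_nat k)"
    by (simp add: Q_Suc algebra_simps)
  thus ?thesis unfolding Q_shift by (simp add: algebra_simps)
qed

lemma Q_minus1: "Q (Suc k) (x - 1) = (x - of_nat k) * (x - 1 - of_nat k) * Q k x"
proof -
  have "Q (Suc k) (x - 1) = Q (Suc k) ((- 1 - x) + 1)"
    using Q_reflect[of "Suc k" "x - 1"] by (simp add: algebra_simps)
  also have "\<dots> = (x - of_nat k) * (x - 1 - of_nat k) * Q k x"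
    unfolding Q_plus1 Q_reflect by (simp add: algebra_simps)
  finally show ?thesis .
qed

text \<open>For \<open>k = j + 1\<close> all values of \<open>Q\<close> involved are explicit
  multiples of \<open>Q j x\<close>, and a polynomial identity in \<open>x\<close> and
  \<open>j\<close> remains. For \<open>k = 0\<close> the truncated index \<open>k - 1\<close> is
  harmless because of the factor \<open>k ^ 3\<close>.\<close>

lemma Q_telescope:
  "(x + 1)\<^sup>2 * Q k (x + 1) - x\<^sup>2 * Q k (x - 1)
     = (2 * x + 1) * ((2 * of_nat k + 1) * Q k x + 2 * of_nat k ^ 3 * Q (k - 1) x)"
proof (cases k)
  case 0
  then show ?thesis by (simp add: power2_eq_square algebra_simps)
next
  case (Suc j)
  show ?thesis unfolding Suc Q_plus1 Q_minus1
    by (simp add: Q_Suc power2_eq_square power3_eq_cube algebra_simps)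
qed

lemma gbinomial_mult_reflect: "(x gchoose k) * ((- 1 - x) gchoose k) = (-1) ^ k * Q k x / fact k ^ 2"
proof -
  have "(x gchoose k) = (\<Prod>i<k. x - of_nat i) / fact k" for x :: rat
    by (simp add: gbinomial_prod_rev atLeast0LessThan)
  moreover have "(\<Prod>i<k. - 1 - x - of_nat i) = (-1) ^ k * (\<Prod>i<k. x + 1 + of_nat i)"
    by (induction k) (auto simp: algebra_simps)
  ultimately show ?thesis by (simp add: Q_def prod.distrib power2_eq_square)
qed

text \<open>Since \<open>(n + k) choose k\<close> is, up to the sign \<open>(-1)^k\<close>, the
  generalized binomial of \<open>-1 - n\<close>, this is the case \<open>x = n\<close> of
  \<open>gbinomial_mult_reflect\<close>.\<close>

lemma binomial_mult_Q: "of_nat (n choose k) * of_nat ((n + k) choose k) = Q k (of_nat n) / fact k ^ 2"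
proof -
  have "((- 1 - of_nat n) gchoose k) = (-1) ^ k * (of_nat ((n + k) choose k) :: rat)"
    using gbinomial_negated_upper[of "- 1 - of_nat n :: rat" k] binomial_gbinomial[of "n + k" k, where ?'a = rat]
    by (simp add: algebra_simps)
  hence "(-1) ^ k * (of_nat (n choose k) * of_nat ((n + k) choose k)) = (-1) ^ k * Q k (of_nat n) / fact k ^ 2"
    using gbinomial_mult_reflect[of "of_nat n" k] by (simp add: binomial_gbinomial[symmetric] algebra_simps)
  thus ?thesis by (simp add: field_simps)
qed

lemma Q_nat_0: "n < k \<Longrightarrow> Q k (of_nat n) = 0"
  unfolding Q_def by (rule prod_zero) auto

lemma V_eq_Q: "V n x = (\<Sum>k=0..n. Q k (of_nat n) * Q k x / fact k ^ 4)"
  unfolding V_def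
proof (rule sum.cong[OF refl])
  fix k
  have "of_nat (n choose k) * of_nat ((n + k) choose k) * (- 1) ^ k * (x gchoose k) * ((- 1 - x) gchoose k)
     = (of_nat (n choose k) * of_nat ((n + k) choose k)) * (- 1) ^ k * ((x gchoose k) * ((- 1 - x) gchoose k))"
    by simp
  also have "\<dots> = Q k (of_nat n) * Q k x / fact k ^ 4"
  proof -
    have "(-1) ^ k * (-1) ^ k = (1 :: rat)" by (simp flip: power_mult_distrib)
    moreover have "fact k ^ 4 = fact k ^ 2 * (fact k ^ 2 :: rat)" by (simp flip: power_add)
    ultimately show ?thesis unfolding binomial_mult_Q gbinomial_mult_reflect by simp
  qed
  finally show "of_nat (n choose k) * of_nat ((n + k) choose k) * (- 1) ^ k * (x gchoose k) * ((- 1 - x) gchoose k)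
     = Q k (of_nat n) * Q k x / fact k ^ 4" .
qed

context odd_prime
begin

definition Y :: "(nat \<Rightarrow> rat) \<Rightarrow> rat \<Rightarrow> rat" where
  "Y y x = (\<Sum>k<p. y k * Q k x)"

text \<open>The coefficient of \<open>(2 x + 1) * Q k x\<close> once the second part of
  \<open>Q_telescope\<close> has been shifted by one index.\<close>

definition telescoper :: "(nat \<Rightarrow> rat) \<Rightarrow> nat \<Rightarrow> rat" where
  "telescoper y k = (2 * of_nat k + 1) * y k + 2 * (of_nat k + 1) ^ 3 * y (Suc k)"

text \<open>The condition \<open>y p = 0\<close> removes the boundary term of the index shift, and
  \<open>y 0 = 1\<close> normalizes \<open>Y y 0\<close> to 1. The last condition is imposed on
  every single term of the telescoped sum.\<close>

definition admissible :: "(nat \<Rightarrow> rat) \<Rightarrow> bool" where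
  "admissible y \<longleftrightarrow> y 0 = 1 \<and> y p = 0 \<and> (\<forall>k<p. y k \<in> Zp p) \<and>
     (\<forall>x\<in>Zp p. \<forall>k<p. zp_cong p 2 ((2 * x + 1) * Q k x * telescoper y k) 0)"

lemma Zp_Q [intro]: "x \<in> Zp p \<Longrightarrow> Q k x \<in> Zp p"
  unfolding Q_def by (intro Zp_prod Zp_mult Zp_diff Zp_add) auto

lemma Zp_Y: "admissible y \<Longrightarrow> x \<in> Zp p \<Longrightarrow> Y y x \<in> Zp p"
  unfolding Y_def admissible_def by (intro Zp_sum Zp_mult Zp_Q) auto

lemma Y_reflect: "Y y (- 1 - x) = Y y x" by (simp add: Y_def Q_reflect)

lemma Y_telescope: assumes "y p = 0"
  shows "(x + 1)\<^sup>2 * Y y (x + 1) - x\<^sup>2 * Y y (x - 1) = (\<Sum>k<p. (2 * x + 1) * Q k x * telescoper y k)"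
proof -
  have "(x + 1)\<^sup>2 * Y y (x + 1) - x\<^sup>2 * Y y (x - 1)
      = (\<Sum>k<p. y k * ((x + 1)\<^sup>2 * Q k (x + 1) - x\<^sup>2 * Q k (x - 1)))"
    by (simp add: Y_def sum_distrib_left sum_subtractf algebra_simps)
  also have "\<dots> = (\<Sum>k<p. (2 * x + 1) * (2 * of_nat k + 1) * y k * Q k x)
       + (\<Sum>k<p. (2 * x + 1) * (2 * of_nat k ^ 3) * y k * Q (k - 1) x)"
    unfolding Q_telescope by (simp add: sum.distrib[symmetric] algebra_simps)
  also have "(\<Sum>k<p. (2 * x + 1) * (2 * of_nat k ^ 3) * y k * Q (k - 1) x)
      = (\<Sum>k<Suc p. (2 * x + 1) * (2 * of_nat k ^ 3) * y k * Q (k - 1) x)"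
    using assms by simp
  also have "\<dots> = (\<Sum>k<p. (2 * x + 1) * (2 * (of_nat k + 1) ^ 3) * y (Suc k) * Q k x)"
    unfolding sum.lessThan_Suc_shift by (simp add: add.commute)
  also have "(\<Sum>k<p. (2 * x + 1) * (2 * of_nat k + 1) * y k * Q k x) + \<dots>
      = (\<Sum>k<p. (2 * x + 1) * Q k x * telescoper y k)"
    by (simp add: sum.distrib[symmetric] telescoper_def algebra_simps)
  finally show ?thesis .
qed

lemma Y_step: assumes "admissible y" "x \<in> Zp p"
  shows "zp_cong p 2 ((x + 1)\<^sup>2 * Y y (x + 1)) (x\<^sup>2 * Y y (x - 1))"
proof -
  have "zp_cong p 2 (\<Sum>k<p. (2 * x + 1) * Q k x * telescoper y k) (\<Sum>k<p. 0)"
    using assms unfolding admissible_def by (intro zp_cong_sum) auto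
  hence "zp_cong p 2 ((x + 1)\<^sup>2 * Y y (x + 1) - x\<^sup>2 * Y y (x - 1)) 0"
    using assms unfolding admissible_def by (subst Y_telescope) auto
  moreover have "zp_cong p 2 (x\<^sup>2 * Y y (x - 1)) (x\<^sup>2 * Y y (x - 1))"
    using assms by (intro zp_cong_refl Zp_mult Zp_power Zp_Y Zp_diff) auto
  ultimately show ?thesis using zp_cong_add by fastforce
qed

section \<open>The chain in steps of two and its starting values\<close>

definition evens :: "nat \<Rightarrow> rat \<Rightarrow> rat" where "evens i z = (\<Prod>j=1..i. z + 2 * of_nat j)"
definition odds :: "nat \<Rightarrow> rat \<Rightarrow> rat" where "odds i z = (\<Prod>j=1..i. z + 2 * of_nat j - 1)"

lemma Zp_evens [intro]: "z \<in> Zp p \<Longrightarrow> evens i z \<in> Zp p" and Zp_odds [intro]: "z \<in> Zp p \<Longrightarrow> odds i z \<in> Zp p"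
  unfolding evens_def odds_def by (auto intro!: Zp_prod Zp_diff Zp_add Zp_mult)

text \<open>Iterates \<open>Y_step\<close> at \<open>z + 2 i + 1\<close>. The products stay on both
  sides because for general \<open>z\<close> the factors of \<open>evens i z\<close> need not be
  units; division is done only where they are known to be.\<close>

lemma Y_chain: assumes "admissible y" "z \<in> Zp p"
  shows "zp_cong p 2 ((evens i z)\<^sup>2 * Y y (z + 2 * of_nat i)) ((odds i z)\<^sup>2 * Y y z)"
proof (induction i)
  case 0
  show ?case using assms by (auto simp: evens_def odds_def intro!: zp_cong_refl Zp_Y)
next
  case (Suc i)
  have D: "evens (Suc i) z = evens i z * (z + 2 * of_nat i + 2)" and N: "odds (Suc i) z = odds i z * (z + 2 * of_nat i + 1)"
    by (simp_all add: evens_def odds_def algebra_simps)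
  have z: "z + 2 * of_nat i + 1 \<in> Zp p" using assms by (intro Zp_add Zp_mult) auto
  have "zp_cong p 2 ((z + 2 * of_nat i + 2)\<^sup>2 * Y y (z + 2 * of_nat i + 2))
        ((z + 2 * of_nat i + 1)\<^sup>2 * Y y (z + 2 * of_nat i))"
    using Y_step[OF assms(1) z] by (simp add: algebra_simps)
  from zp_cong_mult[OF zp_cong_refl[OF Zp_power[OF Zp_evens[OF assms(2)]]] this, of i 2]
  have "zp_cong p 2 ((evens (Suc i) z)\<^sup>2 * Y y (z + 2 * of_nat (Suc i)))
     ((z + 2 * of_nat i + 1)\<^sup>2 * ((evens i z)\<^sup>2 * Y y (z + 2 * of_nat i)))"
    by (simp add: D power_mult_distrib mult_ac add_ac)
  also have "zp_cong p 2 \<dots> ((z + 2 * of_nat i + 1)\<^sup>2 * ((odds i z)\<^sup>2 * Y y z))"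
    using z by (intro zp_cong_mult[OF _ Suc.IH] zp_cong_refl Zp_power)
  also have "\<dots> = (odds (Suc i) z)\<^sup>2 * Y y z" unfolding N by (simp add: power_mult_distrib mult_ac)
  finally show ?case .
qed

lemma zp_cong_prod_linear:
  assumes "\<And>j. j \<in> A \<Longrightarrow> c j \<in> Zp p" "finite A"
  shows "zp_cong p 2 (\<Prod>j\<in>A. 1 + of_nat p * c j) (1 + of_nat p * (\<Sum>j\<in>A. c j))"
  using assms(2,1)
proof (induction A rule: finite_induct)
  case (insert x F)
  have S: "sum c F \<in> Zp p" using insert by auto
  have "zp_cong p 2 (\<Prod>j\<in>insert x F. 1 + of_nat p * c j)
     ((1 + of_nat p * c x) * (1 + of_nat p * sum c F))"
    using insert by (simp, intro zp_cong_mult zp_cong_refl) auto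
  also have "\<dots> = 1 + of_nat p * (\<Sum>j\<in>insert x F. c j) + of_nat p ^ 2 * (c x * sum c F)"
    using insert by (simp add: algebra_simps power2_eq_square)
  also have "zp_cong p 2 \<dots> (1 + of_nat p * (\<Sum>j\<in>insert x F. c j) + 0)"
    using insert S by (intro zp_cong_add zp_cong_refl zp_cong_0_p) auto
  finally show ?case by simp
qed (auto intro: zp_cong_refl)

lemma nat_unit: "0 < j \<Longrightarrow> j < p \<Longrightarrow> inverse (of_nat j) \<in> Zp p"
  by (intro Zp_inv_nat) (auto dest: dvd_imp_le)

lemma two_unit: "inverse 2 \<in> Zp p" using nat_unit[of 2] p_gt by simp

definition H :: rat where "H = (\<Sum>j=1..M. inverse (of_nat j))"

lemma Zp_H: "H \<in> Zp p" unfolding H_def using p_eq by (intro Zp_sum nat_unit) auto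

lemma zp_cong_unit: assumes "zp_cong p 1 a b" "inverse b \<in> Zp p" "b \<noteq> 0" shows "inverse a \<in> Zp p" "a \<noteq> 0"
proof -
  have "\<not> zp_cong p 1 a 0"
  proof
    assume "zp_cong p 1 a 0"
    from zp_cong_mult[OF zp_cong_trans[OF zp_cong_sym[OF assms(1)] this] zp_cong_refl[OF assms(2)]]
    have "zp_cong p 1 (of_int 1) (of_int 0)" using assms(3) by simp
    thus False unfolding zp_cong_of_int using p_gt by (auto simp: cong_def)
  qed
  thus "inverse a \<in> Zp p" "a \<noteq> 0" using Zp_inverse zp_cong_Zp(1)[OF assms(1)] by auto
qed

lemma zp_cong_p_shift: "t \<in> Zp p \<Longrightarrow> a \<in> Zp p \<Longrightarrow> zp_cong p 1 (of_nat p * t + a) a"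
  using zp_cong_iff[of 1 "of_nat p * t + a" a] by auto

lemma p_plus_nat_unit: assumes "0 < j" "j < p" "t \<in> Zp p"
  shows "inverse (of_nat p * t + of_nat j) \<in> Zp p" "of_nat p * t + of_nat j \<noteq> 0"
  using zp_cong_unit[OF zp_cong_p_shift[OF assms(3), of "of_nat j"]] nat_unit[OF assms(1,2)] assms by auto

lemma evens_unit: assumes "t \<in> Zp p" "2 * i < p" shows "inverse (evens i (of_nat p * t)) \<in> Zp p" "evens i (of_nat p * t) \<noteq> 0"
proof -
  have *: "inverse (of_nat p * t + 2 * of_nat j) \<in> Zp p \<and> of_nat p * t + 2 * of_nat j \<noteq> 0" if "j \<in> {1..i}" for j
    using p_plus_nat_unit[of "2 * j" t] assms that by auto
  show "inverse (evens i (of_nat p * t)) \<in> Zp p" unfolding evens_def prod_inversef[symmetric]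
    by (rule Zp_prod) (use * in \<open>simp only: o_def\<close>)
  show "evens i (of_nat p * t) \<noteq> 0" unfolding evens_def using * by auto
qed

text \<open>Reversing the product turns \<open>2 j - 1\<close> into
  \<open>p - 2 j = (-2 j) (1 - p/(2 j))\<close>, so up to sign \<open>odds M 0\<close> is
  \<open>evens M 0 * (1 - p H / 2)\<close> modulo \<open>p^2\<close>.\<close>

lemma odds_M: "zp_cong p 2 ((odds M 0)\<^sup>2) ((evens M 0)\<^sup>2 * (1 - of_nat p * H))"
proof -
  have "odds M 0 = (\<Prod>j=1..M. 2 * of_nat (M + 1 - j) - 1)"
    unfolding odds_def by (subst prod.atLeastAtMost_rev) simp
  also have "\<dots> = (\<Prod>j=1..M. (- 2 * of_nat j) * (1 + of_nat p * (- inverse (2 * of_nat j))))"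
    by (intro prod.cong refl) (auto simp: p_eq field_simps of_nat_diff)
  also have "\<dots> = (\<Prod>j=1..M. - 2 * of_nat j) * (\<Prod>j=1..M. 1 + of_nat p * (- inverse (2 * of_nat j)))"
    by (simp only: prod.distrib)
  also have "(\<Prod>j=1..M. - 2 * of_nat j) = (-1) ^ M * evens M 0"
    unfolding evens_def by (induction M) (auto simp: algebra_simps)
  finally have N: "odds M 0 = (-1) ^ M * evens M 0 * (\<Prod>j=1..M. 1 + of_nat p * (- inverse (2 * of_nat j)))" .
  have i2: "inverse (2 * of_nat j) \<in> Zp p" if "j \<in> {1..M}" for j
    using nat_unit[of "2 * j"] that p_eq by simp
  have "(\<Sum>j=1..M. - inverse (2 * of_nat j)) = - H / 2"
    unfolding H_def by (simp add: sum_negf sum_divide_distrib field_simps)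
  hence PP: "zp_cong p 2 (\<Prod>j=1..M. 1 + of_nat p * (- inverse (2 * of_nat j))) (1 + of_nat p * (- H / 2))"
    using zp_cong_prod_linear[of "{1..M}" "\<lambda>j. - inverse (2 * of_nat j)"] i2 by fastforce
  have "zp_cong p 2 ((odds M 0)\<^sup>2) (((-1) ^ M * evens M 0 * (1 + of_nat p * (- H / 2)))\<^sup>2)"
  proof -
    have "(-1) ^ M * evens M 0 \<in> Zp p" by (intro Zp_mult Zp_power Zp_minus Zp_evens Zp_0 Zp_1)
    from zp_cong_power[OF zp_cong_mult[OF zp_cong_refl[OF this] PP]] show ?thesis unfolding N .
  qed
  also have "\<dots> = (evens M 0)\<^sup>2 * (1 - of_nat p * H) + of_nat p ^ 2 * ((evens M 0)\<^sup>2 * (H * inverse 2)\<^sup>2)"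
  proof -
    have s: "((-1) ^ M)\<^sup>2 = (1 :: rat)" by (simp flip: power_mult)
    show ?thesis unfolding power_mult_distrib s by (simp add: power2_eq_square field_simps)
  qed
  also have "zp_cong p 2 \<dots> ((evens M 0)\<^sup>2 * (1 - of_nat p * H) + 0)"
    by (rule zp_cong_add[OF zp_cong_refl zp_cong_0_p]) (intro Zp_mult Zp_power Zp_evens Zp_diff Zp_H two_unit Zp_nat Zp_0 Zp_1)+
  finally show ?thesis by simp
qed

text \<open>Every \<open>Q k\<close> with \<open>k > 0\<close> has the factor \<open>z\<close>. At
  \<open>z = p t\<close> it supplies one \<open>p\<close>, so the cofactor \<open>R\<close> matters
  only modulo \<open>p\<close> and can be taken at 0. The constant \<open>L\<close> is the
  derivative of \<open>Y y\<close> at 0.\<close>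

lemma Y_near_0: assumes "admissible y"
  obtains L where "L \<in> Zp p" "\<And>t. t \<in> Zp p \<Longrightarrow> zp_cong p 2 (Y y (of_nat p * t)) (1 + of_nat p * t * L)"
proof -
  define R where "R k z = (z + 1) * (\<Prod>i=1..<k. (z - of_nat i) * (z + 1 + of_nat i))" for k and z :: rat
  have QR: "Q (Suc k) z = z * R (Suc k) z" for k z
    unfolding R_def by (induction k) (simp_all add: Q_Suc algebra_simps)
  have R: "R k z \<in> Zp p" if "z \<in> Zp p" for k z
    unfolding R_def using that by (intro Zp_mult Zp_prod Zp_add Zp_diff) auto
  define L where "L = (\<Sum>k=1..<p. y k * R k 0)"
  have "L \<in> Zp p" unfolding L_def using assms by (intro Zp_sum Zp_mult R) (auto simp: admissible_def)
  moreover have "zp_cong p 2 (Y y (of_nat p * t)) (1 + of_nat p * t * L)" if t: "t \<in> Zp p" for t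
  proof -
    have "{..<p} = insert 0 {1..<p}" using p_gt by auto
    hence "Y y (of_nat p * t) = 1 + (\<Sum>k=1..<p. y k * Q k (of_nat p * t))"
      unfolding Y_def using assms by (simp add: admissible_def)
    also have "\<dots> = 1 + (\<Sum>k=1..<p. t * y k * (of_nat p * R k (of_nat p * t)))"
      by (intro arg_cong2[of _ _ _ _ "(+)"] sum.cong refl) (auto simp: QR dest!: Suc_le_D)
    also have "zp_cong p 2 \<dots> (1 + (\<Sum>k=1..<p. t * y k * (of_nat p * R k 0)))"
    proof (intro zp_cong_add zp_cong_refl Zp_1 zp_cong_sum)
      fix k assume k: "k \<in> {1..<p}"
      have "zp_cong p 1 (R k (of_nat p * t)) (R k 0)"
        unfolding R_def
        using t zp_cong_p_shift[of t 0] by (intro zp_cong_mult zp_cong_prod zp_cong_add zp_cong_diff zp_cong_refl) auto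
      from zp_cong_p_mult[OF this] have "zp_cong p 2 (of_nat p * R k (of_nat p * t)) (of_nat p * R k 0)"
        by (simp add: numeral_2_eq_2)
      thus "zp_cong p 2 (t * y k * (of_nat p * R k (of_nat p * t))) (t * y k * (of_nat p * R k 0))"
        using t k assms by (intro zp_cong_mult[OF zp_cong_refl[OF Zp_mult]]) (auto simp: admissible_def)
    qed
    also have "1 + (\<Sum>k=1..<p. t * y k * (of_nat p * R k 0)) = 1 + of_nat p * t * L"
      by (simp add: L_def sum_distrib_left algebra_simps)
    finally show ?thesis .
  qed
  ultimately show ?thesis using that by blast
qed

text \<open>The chain links the values at 0 and at \<open>p - 1\<close>, and the latter equals the value at \<open>- p\<close>.\<close>

lemma Y_pt: assumes "admissible y" "t \<in> Zp p"
  shows "zp_cong p 2 (Y y (of_nat p * t)) (1 + of_nat p * t * H)"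
proof -
  obtain L where L: "L \<in> Zp p" "\<And>t. t \<in> Zp p \<Longrightarrow> zp_cong p 2 (Y y (of_nat p * t)) (1 + of_nat p * t * L)"
    using Y_near_0[OF assms(1)] by blast
  have m1: "-1 \<in> Zp p" using Zp_int[of "-1"] by simp
  have Y0: "zp_cong p 2 (Y y 0) 1" using L(2)[of 0] by simp
  have "Y y (0 + 2 * of_nat M) = Y y (of_nat p * (-1))"
    using Y_reflect[of y "2 * of_nat M"] by (simp add: p_eq algebra_simps)
  hence YM: "zp_cong p 2 (Y y (0 + 2 * of_nat M)) (1 + of_nat p * (-1) * L)"
    using L(2)[OF m1] by simp
  have "zp_cong p 2 ((evens M 0)\<^sup>2 * (1 + of_nat p * (-1) * L)) ((evens M 0)\<^sup>2 * Y y (0 + 2 * of_nat M))"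
    by (intro zp_cong_mult zp_cong_refl Zp_power Zp_evens zp_cong_sym[OF YM]) auto
  also have "zp_cong p 2 \<dots> ((odds M 0)\<^sup>2 * Y y 0)" using Y_chain[OF assms(1)] by blast
  also have "zp_cong p 2 \<dots> (((evens M 0)\<^sup>2 * (1 - of_nat p * H)) * 1)"
    by (intro zp_cong_mult odds_M Y0)
  finally have *: "zp_cong p 2 ((evens M 0)\<^sup>2 * (1 + of_nat p * (-1) * L)) ((evens M 0)\<^sup>2 * (1 - of_nat p * H))" by simp
  have "zp_cong p 2 (1 + of_nat p * (-1) * L) (1 - of_nat p * H)"
  proof (rule zp_cong_cancel[OF *])
    have "2 * M < p" using p_eq by simp
    note u = evens_unit[OF Zp_0 this, unfolded mult_zero_right]
    show "inverse ((evens M 0)\<^sup>2) \<in> Zp p" "(evens M 0)\<^sup>2 \<noteq> 0"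
      using u Zp_power[OF u(1), of 2] by (simp_all add: power_inverse)
  qed
  from zp_cong_diff[OF zp_cong_refl[OF Zp_1] this] have "zp_cong p 2 (of_nat p * L) (of_nat p * H)" by simp
  from zp_cong_mult[OF zp_cong_refl[OF assms(2)] this] have "zp_cong p 2 (of_nat p * t * L) (of_nat p * t * H)"
    by (simp add: algebra_simps)
  from zp_cong_trans[OF L(2)[OF assms(2)] zp_cong_add[OF zp_cong_refl[OF Zp_1] this]] show ?thesis .
qed

lemma Y_even: assumes "admissible y" "t \<in> Zp p"
  shows "zp_cong p 2 ((evens i (of_nat p * t))\<^sup>2 * Y y (of_nat p * t + 2 * of_nat i))
     ((odds i (of_nat p * t))\<^sup>2 * (1 + of_nat p * t * H))"
  using assms by (intro zp_cong_trans[OF Y_chain] zp_cong_mult Y_pt zp_cong_refl Zp_power Zp_odds) auto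

text \<open>Starting the chain at \<open>p t - 1\<close> makes \<open>p t\<close> the first factor
  on the numerator side, where it occurs squared. The factors \<open>p t + 1, p t + 3, ...\<close>
  of the other side are units as long as \<open>2 i + 1 < p\<close>.\<close>

lemma Y_odd: assumes "admissible y" "t \<in> Zp p" "2 * i + 1 < p"
  shows "zp_cong p 2 (Y y (of_nat p * t + 2 * of_nat i + 1)) 0"
proof -
  let ?z = "of_nat p * t - 1"
  have z: "?z \<in> Zp p" using assms by auto
  have *: "inverse (?z + 2 * of_nat j) \<in> Zp p \<and> ?z + 2 * of_nat j \<noteq> 0" if "j \<in> {1..Suc i}" for j
  proof -
    have "(of_nat (2 * j - 1) :: rat) = 2 * of_nat j - 1" using that by (simp add: of_nat_diff)
    hence e: "?z + 2 * of_nat j = of_nat p * t + of_nat (2 * j - 1)" by simp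
    moreover have "0 < 2 * j - 1" "2 * j - 1 < p" using that assms(3) by auto
    ultimately show ?thesis using p_plus_nat_unit[of "2 * j - 1" t] assms(2) unfolding e by blast
  qed
  have D: "inverse (evens (Suc i) ?z) \<in> Zp p" unfolding evens_def prod_inversef[symmetric]
    by (rule Zp_prod) (use * in \<open>simp only: o_def\<close>)
  have D0: "evens (Suc i) ?z \<noteq> 0" unfolding evens_def using *
    by (subst prod_zero_iff) (auto simp only: finite_atLeastAtMost)
  let ?P = "\<Prod>j=2..Suc i. ?z + 2 * of_nat j - 1"
  have "odds (Suc i) ?z = of_nat p * t * ?P"
    unfolding odds_def by (subst prod.atLeast_Suc_atMost) (auto simp: numeral_2_eq_2)
  hence N': "(odds (Suc i) ?z)\<^sup>2 = of_nat p ^ 2 * (t * ?P)\<^sup>2" by (simp only: power_mult_distrib mult.assoc)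
  have "t * ?P \<in> Zp p" using z by (intro Zp_mult assms Zp_prod Zp_diff Zp_add) auto
  hence N: "zp_cong p 2 ((odds (Suc i) ?z)\<^sup>2) 0"
    unfolding N' by (intro zp_cong_0_p Zp_power)
  have "zp_cong p 2 ((evens (Suc i) ?z)\<^sup>2 * Y y (?z + 2 * of_nat (Suc i))) (0 * Y y ?z)"
    by (rule zp_cong_trans[OF Y_chain[OF assms(1) z] zp_cong_mult[OF N zp_cong_refl[OF Zp_Y[OF assms(1) z]]]])
  moreover have "?z + 2 * of_nat (Suc i) = of_nat p * t + 2 * of_nat i + 1" by simp
  ultimately have "zp_cong p 2 ((evens (Suc i) ?z)\<^sup>2 * Y y (of_nat p * t + 2 * of_nat i + 1)) ((evens (Suc i) ?z)\<^sup>2 * 0)"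
    by (simp only: mult_zero_left mult_zero_right)
  thus ?thesis
  proof (rule zp_cong_cancel)
    show "inverse ((evens (Suc i) ?z)\<^sup>2) \<in> Zp p" using Zp_power[OF D, of 2] by (simp only: power_inverse)
    show "(evens (Suc i) ?z)\<^sup>2 \<noteq> 0" using D0 by simp
  qed
qed

end

section \<open>The two coefficient sequences\<close>

lemma central_binom_Suc:
  "of_nat ((2 * Suc k) choose Suc k) * (of_nat k + 1) = (2 * (2 * of_nat k + 1) * of_nat ((2 * k) choose k) :: rat)"
proof -
  have *: "of_nat ((2 * k) choose k) = (fact (2 * k) / (fact k * fact k) :: rat)" for k
    by (simp add: binomial_fact)
  have K: "of_nat k + 1 \<noteq> (0::rat)" using of_nat_neq_0[of k, where ?'a = rat] by (simp add: algebra_simps)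
  have "fact (2 * Suc k) = 2 * (of_nat k + 1) * (2 * of_nat k + 1) * (fact (2 * k) :: rat)"
    "fact (Suc k) = (of_nat k + 1) * (fact k :: rat)" by (simp_all add: algebra_simps)
  note f = this
  have alg: "2 * K * m * A / ((K * F) * (K * F)) * K = 2 * m * (A / (F * F))" 
    if "K \<noteq> 0" "F \<noteq> 0" for K m A F :: rat using that by (simp add: field_simps)
  show ?thesis unfolding *[of k] *[of "Suc k"] f by (rule alg) (use K in auto)
qed

context odd_prime
begin

lemma Zp_inverse_fact: "k < p \<Longrightarrow> inverse (fact k) \<in> Zp p"
  by (induction k) (auto intro!: Zp_mult nat_unit simp del: of_nat_Suc)

text \<open>Modulo \<open>p\<close> the factor \<open>x - i\<close> vanishes at
  \<open>i = a\<close>, and the factor \<open>x + 1 + i\<close> at \<open>i = p - 1 - a\<close>; one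
  of these indices lies in the range of the product.\<close>

lemma zp_cong_Q_0: assumes x: "zp_cong p 1 x (of_nat a)" and "a < k \<or> (a < p \<and> p - 1 - a < k)"
  shows "zp_cong p 1 (Q k x) 0"
proof -
  have xZ: "x \<in> Zp p" using zp_cong_Zp[OF x] by simp
  have "\<exists>i<k. zp_cong p 1 ((x - of_nat i) * (x + 1 + of_nat i)) 0"
  proof (cases "a < k")
    case True
    have "zp_cong p 1 ((x - of_nat a) * (x + 1 + of_nat a)) ((of_nat a - of_nat a) * (x + 1 + of_nat a))"
      using xZ by (intro zp_cong_mult zp_cong_diff x zp_cong_refl Zp_add) auto
    thus ?thesis using True by auto
  next
    case False
    hence a: "a < p" "p - 1 - a < k" using assms(2) by auto
    let ?i = "p - 1 - a"
    have "zp_cong p 1 ((x - of_nat ?i) * (x + 1 + of_nat ?i)) ((x - of_nat ?i) * (of_nat a + 1 + of_nat ?i))"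
      using xZ by (intro zp_cong_mult zp_cong_add x zp_cong_refl Zp_diff) auto
    also have "of_nat a + 1 + of_nat ?i = (of_nat p :: rat)" using a by (simp add: of_nat_diff)
    also have "zp_cong p 1 ((x - of_nat ?i) * of_nat p) 0"
      using zp_cong_0_p[OF Zp_diff[OF xZ], of "of_nat ?i" 1] by (simp add: mult.commute)
    finally show ?thesis using a by blast
  qed
  then obtain i where i: "i < k" "zp_cong p 1 ((x - of_nat i) * (x + 1 + of_nat i)) 0" by blast
  have "Q k x = ((x - of_nat i) * (x + 1 + of_nat i)) * (\<Prod>j\<in>{..<k} - {i}. (x - of_nat j) * (x + 1 + of_nat j))"
    unfolding Q_def using i by (intro prod.remove) auto
  moreover have "(\<Prod>j\<in>{..<k} - {i}. (x - of_nat j) * (x + 1 + of_nat j)) \<in> Zp p"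
    using xZ by (intro Zp_prod Zp_mult Zp_diff Zp_add) auto
  ultimately show ?thesis using zp_cong_0_left[OF i(2)] by simp
qed

definition coeffS :: "nat \<Rightarrow> rat" where
  "coeffS k = (if k \<le> M then (-1) ^ k * of_nat ((2 * k) choose k) / (4 ^ k * fact k ^ 2) else 0)"

text \<open>The coefficient of \<open>Q k x\<close> after the sums over \<open>n\<close> and
  \<open>k\<close> in the alternating sum of the \<open>V n x\<close> are interchanged; the terms
  with \<open>n < k\<close> vanish.\<close>

definition coeffW :: "nat \<Rightarrow> rat" where
  "coeffW k = (\<Sum>n<p. (-1) ^ n * Q k (of_nat n)) / fact k ^ 4"

lemma Y_coeffS:
  "Y coeffS x = (\<Sum>k=0..(p-1) div 2. of_nat ((2*k) choose k) * (x gchoose k) * ((-1 - x) gchoose k) * (1 / 4 ^ k))"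
proof -
  have "Y coeffS x = (\<Sum>k\<in>{0..M}. coeffS k * Q k x)"
    unfolding Y_def by (rule sum.mono_neutral_right) (auto simp: coeffS_def p_eq)
  also have "\<dots> = (\<Sum>k\<in>{0..M}. of_nat ((2*k) choose k) * ((x gchoose k) * ((-1 - x) gchoose k)) * (1 / 4 ^ k))"
    unfolding gbinomial_mult_reflect by (intro sum.cong) (auto simp: coeffS_def field_simps)
  finally show ?thesis by (simp add: p_eq mult.assoc)
qed

lemma Y_coeffW: "Y coeffW x = (\<Sum>n=0..p-1. (-1) ^ n * V n x)"
proof -
  have "V n x = (\<Sum>k<p. Q k (of_nat n) * Q k x / fact k ^ 4)" if "n < p" for n
    unfolding V_eq_Q by (rule sum.mono_neutral_left) (use that in \<open>auto simp: Q_nat_0\<close>)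
  hence "(\<Sum>n<p. (-1) ^ n * V n x) = (\<Sum>n<p. \<Sum>k<p. (-1) ^ n * Q k (of_nat n) * Q k x / fact k ^ 4)"
    by (intro sum.cong refl) (simp add: sum_distrib_left algebra_simps)
  also have "\<dots> = (\<Sum>k<p. \<Sum>n<p. (-1) ^ n * Q k (of_nat n) * Q k x / fact k ^ 4)"
    by (rule sum.swap)
  also have "\<dots> = Y coeffW x" unfolding Y_def coeffW_def
    by (simp add: sum_distrib_left sum_distrib_right sum_divide_distrib algebra_simps)
  finally show ?thesis using p_gt by (simp add: atLeast0AtMost lessThan_Suc_atMost[symmetric])
qed

text \<open>Below the cut-off the recurrence of the central binomial coefficients makes
  \<open>telescoper\<close> vanish identically. At \<open>k = M\<close> the missing next coefficient
  leaves \<open>(2 M + 1) y M = p y M\<close>. The second factor \<open>p\<close> comes from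
  \<open>2 x + 1\<close> if \<open>x\<close> has residue \<open>M\<close>, and from
  \<open>Q M x\<close> for all other residues.\<close>

lemma admissible_coeffS: "admissible coeffS"
  unfolding admissible_def
proof (intro conjI allI impI ballI)
  show "coeffS 0 = 1" by (simp add: coeffS_def)
  have "\<not> p \<le> M" using p_eq by linarith
  thus "coeffS p = 0" by (simp add: coeffS_def)
  fix k assume k: "k < p"
  have four: "(4::rat) ^ k = 2 ^ (2 * k)" by (simp add: power_mult)
  have "coeffS k = (-1) ^ k * of_nat ((2 * k) choose k) * inverse 2 ^ (2 * k) * inverse (fact k) ^ 2" if "k \<le> M"
    using that by (simp add: coeffS_def four field_simps)
  moreover have "(-1) ^ k * of_nat ((2 * k) choose k) * inverse 2 ^ (2 * k) * inverse (fact k) ^ 2 \<in> Zp p"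
    by (intro Zp_mult Zp_power two_unit Zp_inverse_fact[OF k] Zp_minus Zp_1 Zp_nat)
  moreover have "coeffS k = 0" if "\<not> k \<le> M" using that by (simp add: coeffS_def)
  ultimately show y: "coeffS k \<in> Zp p" by (cases "k \<le> M") simp_all
  fix x assume x: "x \<in> Zp p"
  show "zp_cong p 2 ((2 * x + 1) * Q k x * telescoper coeffS k) 0"
  proof (cases k M rule: linorder_cases)
    case less
    have alg: "m * (s * c / (g * F\<^sup>2)) + 2 * K ^ 3 * (- s * c' / (4 * g * (K * F)\<^sup>2)) = s / (g * F\<^sup>2) * (m * c - c' * K / 2)"
      if "K \<noteq> 0" "F \<noteq> 0" "g \<noteq> 0" for m s c c' g F K :: rat
      using that by (simp add: field_simps power2_eq_square power3_eq_cube)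
    have K: "of_nat k + 1 \<noteq> (0::rat)" using of_nat_neq_0[of k, where ?'a = rat] by (simp add: algebra_simps)
    have S: "coeffS (Suc k) = - ((-1) ^ k) * of_nat ((2 * Suc k) choose Suc k) / (4 * 4 ^ k * ((of_nat k + 1) * fact k)\<^sup>2)"
      using less by (simp add: coeffS_def add.commute del: mult_Suc_right binomial_Suc_Suc)
    have S0: "coeffS k = (-1) ^ k * of_nat ((2 * k) choose k) / (4 ^ k * (fact k)\<^sup>2)"
      using less by (simp add: coeffS_def)
    have "telescoper coeffS k = (-1) ^ k / (4 ^ k * (fact k)\<^sup>2) * ((2 * of_nat k + 1) * of_nat ((2 * k) choose k)
        - of_nat ((2 * Suc k) choose Suc k) * (of_nat k + 1) / 2)"
      unfolding telescoper_def S S0 by (rule alg) (use K in auto)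
    also have "\<dots> = 0" unfolding central_binom_Suc by simp
    finally show ?thesis by (auto intro: zp_cong_refl)
  next
    case greater
    thus ?thesis by (auto simp: telescoper_def coeffS_def intro: zp_cong_refl)
  next
    case equal
    let ?a = "zp_residue p x"
    have "zp_cong p 1 ((2 * x + 1) * Q k x) 0"
    proof (cases "?a = M")
      case True
      have "zp_cong p 1 (2 * x + 1) (2 * of_nat M + 1)"
        using zp_residue(2)[OF x] True by (intro zp_cong_mult zp_cong_add zp_cong_refl) auto
      also have "2 * of_nat M + 1 = (of_nat p ^ 1 * 1 :: rat)" by (simp add: p_eq)
      also have "zp_cong p 1 \<dots> 0" by (rule zp_cong_0_p) auto
      finally show ?thesis by (rule zp_cong_0_left) (rule Zp_Q[OF x])
    next
      case False
      hence "?a < k \<or> (?a < p \<and> p - 1 - ?a < k)" using zp_residue(1)[OF x] p_eq equal by linarith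
      from zp_cong_Q_0[OF zp_residue(2)[OF x] this] show ?thesis
        by (rule zp_cong_0_right) (intro Zp_add Zp_mult x Zp_numeral Zp_1)
    qed
    moreover have "telescoper coeffS k = of_nat p ^ 1 * coeffS k" using equal by (simp add: telescoper_def coeffS_def p_eq)
    hence "zp_cong p 1 (telescoper coeffS k) 0" using zp_cong_0_p[OF y, of 1] by simp
    ultimately show ?thesis using zp_cong_0_mult[of 1 _ 1] by (simp add: numeral_2_eq_2)
  qed
qed

text \<open>The alternating sum over \<open>n\<close> telescopes: up to a factor free of
  \<open>n\<close>, the summand is \<open>f (n + 1) + f n\<close> with
  \<open>f n = n (n - k) Q k n\<close>. As \<open>f 0 = 0\<close> and \<open>p\<close> is odd, only
  \<open>f p\<close> survives.\<close>

lemma telescoper_coeffW: assumes "k < p"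
  shows "telescoper coeffW k = of_nat p * (of_nat p - of_nat k) * Q k (of_nat p) / ((of_nat k + 1) * fact k ^ 4)"
proof -
  define f where "f n = of_nat n * (of_nat n - of_nat k) * Q k (of_nat n)" for n
  have step: "f (Suc n) + f n = Q k (of_nat n) * (2 * of_nat n ^ 2 + 2 * of_nat n + of_nat k + 1)" for n
  proof -
    have "f (Suc n) = (of_nat n + 1) * (Q k (of_nat n + 1) * (of_nat n + 1 - of_nat k))"
      by (simp add: f_def algebra_simps)
    also have "\<dots> = (of_nat n + 1) * (Q k (of_nat n) * (of_nat n + 1 + of_nat k))" unfolding Q_shift ..
    finally show ?thesis by (simp add: f_def power2_eq_square algebra_simps)
  qed
  have tel: "(\<Sum>n<N. (-1) ^ n * (f (Suc n) + f n)) = f 0 - (-1) ^ N * f N" for N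
    by (induction N) (auto simp: algebra_simps)
  have "telescoper coeffW k = (\<Sum>n<p. (-1) ^ n * ((2 * of_nat k + 1) * Q k (of_nat n) / fact k ^ 4
        + 2 * (of_nat k + 1) ^ 3 * Q (Suc k) (of_nat n) / fact (Suc k) ^ 4))"
    unfolding telescoper_def coeffW_def by (simp add: sum_distrib_left sum_divide_distrib sum.distrib[symmetric] algebra_simps del: fact_Suc)
  also have "\<dots> = (\<Sum>n<p. (-1) ^ n * (f (Suc n) + f n) / ((of_nat k + 1) * fact k ^ 4))"
  proof (intro sum.cong refl)
    fix n
    have k0: "of_nat k + 1 \<noteq> (0::rat)" using of_nat_neq_0[of k, where ?'a = rat] by (simp add: algebra_simps)
    have "2 * (of_nat k + 1) ^ 3 * Q (Suc k) (of_nat n) / fact (Suc k) ^ 4 = 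
       2 * Q (Suc k) (of_nat n) / ((of_nat k + 1) * fact k ^ 4)"
      using k0 by (simp add: power_mult_distrib divide_simps add.commute) (simp add: eval_nat_numeral algebra_simps)
    moreover have "(2 * of_nat k + 1) * Q k (of_nat n) / fact k ^ 4 
        = (of_nat k + 1) * (2 * of_nat k + 1) * Q k (of_nat n) / ((of_nat k + 1) * fact k ^ 4)"
      using k0 by simp
    ultimately show "(-1) ^ n * ((2 * of_nat k + 1) * Q k (of_nat n) / fact k ^ 4
        + 2 * (of_nat k + 1) ^ 3 * Q (Suc k) (of_nat n) / fact (Suc k) ^ 4) 
        = (-1) ^ n * (f (Suc n) + f n) / ((of_nat k + 1) * fact k ^ 4)"
      unfolding step by (simp add: add_divide_distrib[symmetric] Q_Suc power2_eq_square algebra_simps)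
  qed
  also have "\<dots> = (\<Sum>n<p. (-1) ^ n * (f (Suc n) + f n)) / ((of_nat k + 1) * fact k ^ 4)"
    by (simp add: sum_divide_distrib)
  also have "(\<Sum>n<p. (-1) ^ n * (f (Suc n) + f n)) = of_nat p * (of_nat p - of_nat k) * Q k (of_nat p)"
    unfolding tel using p_odd by (simp add: f_def)
  finally show ?thesis .
qed

lemma zp_cong_Q_p: "0 < k \<Longrightarrow> zp_cong p 1 (Q k (of_nat p)) 0"
  by (rule zp_cong_Q_0[of _ 0]) (use zp_cong_iff[of 1 "of_nat p" 0] in auto)

text \<open>Two factors \<open>p\<close> are needed. For \<open>k = 0\<close> both are explicit; for
  \<open>0 < k < p - 1\<close> one is explicit and one sits in \<open>Q k p\<close>. For
  \<open>k = p - 1\<close> the denominator \<open>k + 1\<close> cancels the explicit one, but then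
  \<open>Q k x\<close> vanishes modulo \<open>p\<close> for every residue of
  \<open>x\<close>.\<close>

lemma admissible_coeffW: "admissible coeffW"
  unfolding admissible_def
proof (intro conjI allI impI ballI)
  have "(\<Sum>n<2 * m + 1. (-1) ^ n) = (1 :: rat)" for m by (induction m) auto
  hence "(\<Sum>n<p. (-1) ^ n) = (1 :: rat)" unfolding p_eq by blast
  thus "coeffW 0 = 1" by (simp add: coeffW_def)
  show "coeffW p = 0" by (simp add: coeffW_def Q_nat_0)
  fix k assume k: "k < p"
  show y: "coeffW k \<in> Zp p" unfolding coeffW_def divide_inverse power_inverse[symmetric]
    by (intro Zp_mult Zp_sum Zp_power Zp_inverse_fact[OF k] Zp_Q Zp_minus) auto
  fix x assume x: "x \<in> Zp p"
  consider "k = 0" | "0 < k" "k < p - 1" | "k = p - 1" using k by linarith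
  thus "zp_cong p 2 ((2 * x + 1) * Q k x * telescoper coeffW k) 0"
  proof cases
    case 1
    have "zp_cong p 2 (of_nat p ^ 2 * (2 * x + 1)) 0" using x by (intro zp_cong_0_p) auto
    thus ?thesis using 1 p_gt by (simp add: telescoper_coeffW power2_eq_square algebra_simps)
  next
    case 2
    let ?c = "(2 * x + 1) * Q k x * (of_nat p - of_nat k) * inverse (of_nat (Suc k)) * inverse (fact k) ^ 4"
    have "?c \<in> Zp p" using x 2 k by (intro Zp_mult Zp_Q Zp_power Zp_inverse_fact nat_unit) auto
    hence c: "zp_cong p 1 (?c * Q k (of_nat p)) 0" by (rule zp_cong_0_right[OF zp_cong_Q_p[OF 2(1)]])
    have eq: "(2 * x + 1) * Q k x * telescoper coeffW k = of_nat p * (?c * Q k (of_nat p))"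
      unfolding telescoper_coeffW[OF k] by (simp add: divide_inverse power_inverse mult_ac add.commute)
    show ?thesis using zp_cong_p_mult[OF c] unfolding eq by (simp only: numeral_2_eq_2 One_nat_def mult_zero_right)
  next
    case 3
    have "zp_cong p 1 (Q k x) 0"
      using zp_residue[OF x] 3 p_gt by (intro zp_cong_Q_0[of _ "zp_residue p x"]) auto
    hence A: "zp_cong p 1 ((2 * x + 1) * Q k x * inverse (fact k) ^ 4) 0"
      by (intro zp_cong_0_left zp_cong_0_right Zp_add Zp_mult x Zp_numeral Zp_1 Zp_power Zp_inverse_fact[OF k])
    have B: "zp_cong p 1 (Q k (of_nat p)) 0" using 3 p_gt by (intro zp_cong_Q_p) auto
    have k1: "of_nat k + 1 = (of_nat p :: rat)" and k2: "of_nat p - of_nat k = (1 :: rat)"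
      using 3 p_gt by (auto simp: of_nat_diff)
    have "telescoper coeffW k = inverse (fact k) ^ 4 * Q k (of_nat p)"
      unfolding telescoper_coeffW[OF k] k1 k2 using p_gt by (simp add: divide_inverse power_inverse)
    thus ?thesis using zp_cong_0_mult[OF A B] by (simp add: numeral_2_eq_2 algebra_simps)
  qed
qed


section \<open>First order expansions\<close>

text \<open>A value modulo \<open>p^2\<close> is recorded by a leading factor \<open>A\<close> and a
  logarithmic first order term \<open>u\<close>. Under products the \<open>A\<close> multiply and
  the \<open>u\<close> add, and \<open>u\<close> matters only modulo \<open>p\<close>.\<close>

definition first_order :: "rat \<Rightarrow> rat \<Rightarrow> rat \<Rightarrow> bool" where
  "first_order a A u \<longleftrightarrow> A \<in> Zp p \<and> u \<in> Zp p \<and> zp_cong p 2 a (A * (1 + of_nat p * u))"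

lemma first_orderI: "A \<in> Zp p \<Longrightarrow> u \<in> Zp p \<Longrightarrow> a = A * (1 + of_nat p * u) \<Longrightarrow> first_order a A u"
  unfolding first_order_def by (auto intro!: zp_cong_refl Zp_mult Zp_add)

lemma first_order_mult: assumes "first_order a A u" "first_order b B v" shows "first_order (a * b) (A * B) (u + v)"
proof -
  have Z: "A \<in> Zp p" "B \<in> Zp p" "u \<in> Zp p" "v \<in> Zp p" using assms unfolding first_order_def by auto
  have "zp_cong p 2 (a * b) ((A * (1 + of_nat p * u)) * (B * (1 + of_nat p * v)))"
    using assms unfolding first_order_def by (intro zp_cong_mult) auto
  also have "(A * (1 + of_nat p * u)) * (B * (1 + of_nat p * v))
     = A * B * (1 + of_nat p * (u + v)) + of_nat p ^ 2 * (A * B * u * v)"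
    by (simp add: algebra_simps power2_eq_square)
  also have "zp_cong p 2 \<dots> (A * B * (1 + of_nat p * (u + v)) + 0)"
    by (rule zp_cong_add[OF zp_cong_refl zp_cong_0_p]) (intro Zp_mult Zp_add Zp_1 Zp_nat Z)+
  finally show ?thesis using Z unfolding first_order_def by auto
qed

lemma first_order_cong: assumes "first_order a A u" "zp_cong p 1 u v" shows "first_order a A v"
proof -
  have Z: "A \<in> Zp p" using assms unfolding first_order_def by auto
  have "zp_cong p 2 (1 + of_nat p * u) (1 + of_nat p * v)"
    using zp_cong_add[OF zp_cong_refl[OF Zp_1] zp_cong_p_mult[OF assms(2)]] by (simp add: numeral_2_eq_2)
  from zp_cong_mult[OF zp_cong_refl[OF Z] this] show ?thesis
    using assms zp_cong_trans zp_cong_Zp(2)[OF assms(2)] unfolding first_order_def by blast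
qed

lemma first_order_zp_cong: "first_order a A u \<Longrightarrow> first_order b A u \<Longrightarrow> zp_cong p 2 a b"
  unfolding first_order_def using zp_cong_trans zp_cong_sym by blast

lemma first_order_sq: "first_order a A u \<Longrightarrow> first_order (a\<^sup>2) (A\<^sup>2) (2 * u)"
  using first_order_mult[of a A u a A u] by (simp add: power2_eq_square)

lemma first_order_zc1: assumes "first_order a A u" shows "zp_cong p 1 a A"
proof -
  have "zp_cong p 1 a (A * (1 + of_nat p * u))" using assms zp_cong_weaken unfolding first_order_def by fastforce
  also have "A * (1 + of_nat p * u) = A + of_nat p ^ 1 * (A * u)" by (simp add: algebra_simps)
  also have "zp_cong p 1 \<dots> (A + 0)"
    using assms unfolding first_order_def by (intro zp_cong_add zp_cong_refl zp_cong_0_p Zp_mult) auto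
  finally show ?thesis by simp
qed

section \<open>Harmonic sums and the binomial coefficients of M\<close>

definition odd_harmonic :: "nat \<Rightarrow> rat" where "odd_harmonic i = (\<Sum>l=1..i. inverse (of_nat (2 * l - 1)))"
definition harmonic :: "nat \<Rightarrow> rat" where "harmonic i = (\<Sum>l=1..i. inverse (of_nat l))"
text \<open>This is \<open>(2 i choose i) / 4 ^ i\<close>, the coefficient of \<open>X^i\<close> in
  \<open>(1 - X)^(-1/2)\<close>.\<close>

definition central_ratio :: "nat \<Rightarrow> rat" where "central_ratio i = (\<Prod>l=1..i. of_nat (2 * l - 1) * inverse (of_nat (2 * l)))"

lemma Zp_odd_harmonic: "i \<le> M \<Longrightarrow> odd_harmonic i \<in> Zp p" unfolding odd_harmonic_def using p_eq by (intro Zp_sum nat_unit) auto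
lemma Zp_harmonic: "i \<le> M \<Longrightarrow> harmonic i \<in> Zp p" unfolding harmonic_def using p_eq by (intro Zp_sum nat_unit) auto
lemma first_order_prod:
  assumes "\<And>j. j \<in> A \<Longrightarrow> c j \<in> Zp p" "\<And>j. j \<in> A \<Longrightarrow> e j \<in> Zp p" "finite A"
  shows "first_order (\<Prod>j\<in>A. e j * (1 + of_nat p * c j)) (prod e A) (sum c A)"
proof -
  have "zp_cong p 2 (prod e A * (\<Prod>j\<in>A. 1 + of_nat p * c j)) (prod e A * (1 + of_nat p * sum c A))"
    using assms by (intro zp_cong_mult[OF zp_cong_refl zp_cong_prod_linear]) auto
  thus ?thesis unfolding first_order_def prod.distrib using assms by auto
qed

text \<open>Each factor \<open>M + 1 - l\<close> of the falling factorial is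
  \<open>(p - (2 l - 1)) / 2\<close>.\<close>

lemma first_order_binom: assumes "i \<le> M" shows "first_order (of_nat (M choose i)) ((-1) ^ i * central_ratio i) (- odd_harmonic i)"
proof -
  have "of_nat (M choose i) = (\<Prod>l=1..i. of_nat (M + 1 - l) * inverse (of_nat l :: rat))"
    using assms
  proof (induction i)
    case (Suc i)
    have "Suc i * (M choose Suc i) = (M - i) * (M choose i)"
      using Suc.prems binomial_absorb_comp[of M i] binomial_absorption[of i M] by (simp add: mult.commute)
    hence "of_nat (Suc i) * (of_nat (M choose Suc i) :: rat) = of_nat (M - i) * of_nat (M choose i)"
      by (metis of_nat_mult)
    hence "(of_nat (M choose Suc i) :: rat) = of_nat (M choose i) * (of_nat (M - i) * inverse (of_nat (Suc i)))"
      by (simp add: field_simps del: of_nat_Suc binomial_Suc_Suc)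
    thus ?case using Suc by simp
  qed simp
  also have "\<dots> = (\<Prod>l=1..i. (- of_nat (2 * l - 1) * inverse (of_nat (2 * l))) * (1 + of_nat p * (- inverse (of_nat (2 * l - 1)))))"
  proof (intro prod.cong refl)
    fix l assume l: "l \<in> {1..i}"
    have "of_nat (M + 1 - l) = (of_nat p - of_nat (2 * l - 1) :: rat) / 2"
      using l assms by (simp add: p_eq of_nat_diff)
    moreover have "of_nat (2 * l - 1) \<noteq> (0::rat)" "of_nat l \<noteq> (0::rat)" using l by auto
    moreover have "(q - y) / 2 * inverse z = (- y * inverse (2 * z)) * (1 + q * (- inverse y))"
      if "y \<noteq> 0" "z \<noteq> 0" for q y z :: rat using that by (simp add: field_simps)
    ultimately show "of_nat (M + 1 - l) * inverse (of_nat l)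
       = (- of_nat (2 * l - 1) * inverse (of_nat (2 * l))) * (1 + of_nat p * (- inverse (of_nat (2 * l - 1) :: rat)))"
      by (simp only: of_nat_mult of_nat_numeral not_False_eq_True)
  qed
  finally have e: "of_nat (M choose i) = (\<Prod>l=1..i. (- of_nat (2 * l - 1) * inverse (of_nat (2 * l))) * (1 + of_nat p * (- inverse (of_nat (2 * l - 1) :: rat))))" .
  have u: "inverse (of_nat (2 * l - 1)) \<in> Zp p" "inverse (of_nat (2 * l)) \<in> Zp p" if "l \<in> {1..i}" for l
  proof -
    have "0 < 2 * l - 1" "2 * l - 1 < p" "0 < 2 * l" "2 * l < p" using that assms p_eq by auto
    thus "inverse (of_nat (2 * l - 1)) \<in> Zp p" "inverse (of_nat (2 * l)) \<in> Zp p" using nat_unit by blast+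
  qed
  have "first_order (of_nat (M choose i)) (\<Prod>l=1..i. - of_nat (2 * l - 1) * inverse (of_nat (2 * l))) (\<Sum>l=1..i. - inverse (of_nat (2 * l - 1)))"
    unfolding e by (rule first_order_prod) (intro Zp_mult Zp_minus Zp_nat u finite_atLeastAtMost; assumption)+
  moreover have "(\<Prod>l=1..i. - of_nat (2 * l - 1) * inverse (of_nat (2 * l))) = (-1) ^ i * central_ratio i"
  proof -
    have "(\<Prod>l=1..i. - f l) = (-1) ^ i * prod f {1..i}" for f :: "nat \<Rightarrow> rat" by (induction i) auto
    thus ?thesis unfolding central_ratio_def by (simp only: mult_minus_left)
  qed
  ultimately show ?thesis by (simp add: odd_harmonic_def sum_negf)
qed

text \<open>The coefficients of \<open>(1 - X)^M\<close>. As \<open>M\<close> is congruent to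
  \<open>-1/2\<close> modulo \<open>p\<close>, they agree modulo \<open>p\<close> with those of
  \<open>(1 - X)^(-1/2)\<close>.\<close>

definition alt_binom :: "nat \<Rightarrow> rat" where "alt_binom i = (-1) ^ i * of_nat (M choose i)"

lemma Zp_alt_binom [intro]: "alt_binom i \<in> Zp p" unfolding alt_binom_def by (intro Zp_mult Zp_power Zp_minus) auto

lemma alt_binom_central_ratio: assumes "i \<le> M" shows "zp_cong p 1 (alt_binom i) (central_ratio i)"
proof -
  have "zp_cong p 1 (alt_binom i) ((-1) ^ i * ((-1) ^ i * central_ratio i))"
    unfolding alt_binom_def by (intro zp_cong_mult[OF zp_cong_refl first_order_zc1[OF first_order_binom[OF assms]]] Zp_power Zp_minus Zp_1)
  thus ?thesis by (simp add: mult.assoc[symmetric] power_mult_distrib[symmetric])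
qed

text \<open>Both sides are the coefficient of \<open>X^n\<close> in the derivative of \<open>(1 - X)^(- s)\<close> with respect to \<open>s\<close> at \<open>s = 1/2\<close>.\<close>

lemma central_ratio_sum: "(\<Sum>i<n. central_ratio i / of_nat (n - i)) = 2 * central_ratio n * odd_harmonic n"
proof (induction n)
  case 0
  show ?case by (simp add: odd_harmonic_def)
next
  case (Suc n)
  define A where "A n = (\<Sum>i<n. central_ratio i / of_nat (n - i))" for n
  have Cs: "2 * of_nat (Suc i) * central_ratio (Suc i) = of_nat (2 * i + 1) * central_ratio i" for i
    by (simp add: central_ratio_def field_simps)
  \<comment> \<open>Splitting \<open>n + 1 = (n + 1 - i) + i\<close> and applying \<open>Cs\<close>
    to the second part yields the recursion
    \<open>2 (n + 1) A (n + 1) = (2 n + 1) A n + 2 central_ratio n\<close>.\<close>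
  have "2 * of_nat (Suc n) * A (Suc n) = (\<Sum>i<Suc n. 2 * central_ratio i + 2 * of_nat i * central_ratio i / of_nat (Suc n - i))"
    unfolding A_def sum_distrib_left
  proof (intro sum.cong refl)
    fix i assume "i \<in> {..<Suc n}"
    hence "of_nat (Suc n - i) \<noteq> (0::rat)" "(of_nat (Suc n) :: rat) = of_nat (Suc n - i) + of_nat i" by (auto simp: of_nat_diff)
    moreover have "2 * N * (c / d) = 2 * c + 2 * I * c / d" if "d \<noteq> 0" "N = d + I" for N c d I :: rat
      using that by (simp add: field_simps)
    ultimately show "2 * of_nat (Suc n) * (central_ratio i / of_nat (Suc n - i)) = 2 * central_ratio i + 2 * of_nat i * central_ratio i / of_nat (Suc n - i)"
      by blast
  qed
  also have "\<dots> = 2 * (\<Sum>i<Suc n. central_ratio i) + (\<Sum>i<Suc n. 2 * of_nat i * central_ratio i / of_nat (Suc n - i))"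
    by (simp add: sum.distrib sum_distrib_left)
  also have "(\<Sum>i<Suc n. 2 * of_nat i * central_ratio i / of_nat (Suc n - i)) = (\<Sum>i<n. of_nat (2 * i + 1) * central_ratio i / of_nat (n - i))"
    unfolding sum.lessThan_Suc_shift using Cs by simp
  also have "\<dots> = (\<Sum>i<n. of_nat (2 * n + 1) * (central_ratio i / of_nat (n - i)) - 2 * central_ratio i)"
  proof (intro sum.cong refl)
    fix i assume "i \<in> {..<n}"
    hence "of_nat (n - i) \<noteq> (0::rat)" "(of_nat n :: rat) = of_nat (n - i) + of_nat i" by (auto simp: of_nat_diff)
    moreover have "(2 * I + 1) * c / d = (2 * N + 1) * (c / d) - 2 * c" if "d \<noteq> 0" "N = d + I" for N c d I :: rat
      using that by (simp add: field_simps)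
    ultimately show "of_nat (2 * i + 1) * central_ratio i / of_nat (n - i) = of_nat (2 * n + 1) * (central_ratio i / of_nat (n - i)) - 2 * central_ratio i"
      unfolding of_nat_add of_nat_mult of_nat_numeral of_nat_1 by blast
  qed
  also have "\<dots> = of_nat (2 * n + 1) * A n - 2 * (\<Sum>i<n. central_ratio i)"
    unfolding A_def by (simp add: sum_subtractf sum_distrib_left)
  finally have "2 * of_nat (Suc n) * A (Suc n) = of_nat (2 * n + 1) * (2 * central_ratio n * odd_harmonic n) + 2 * central_ratio n"
    using Suc.IH by (simp add: A_def)
  also have "\<dots> = 2 * (of_nat (2 * n + 1) * central_ratio n) * odd_harmonic (Suc n)"
  proof -
    have "odd_harmonic (Suc n) = odd_harmonic n + inverse (of_nat (2 * n + 1))" by (simp add: odd_harmonic_def)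
    moreover have "K * (2 * c * o') + 2 * c = 2 * (K * c) * (o' + inverse K)" if "K \<noteq> 0" for K c o' :: rat
      using that by (simp add: field_simps)
    moreover have "of_nat (2 * n + 1) \<noteq> (0 :: rat)" by (simp only: of_nat_eq_0_iff)
    ultimately show ?thesis by (simp only: not_False_eq_True)
  qed
  also have "\<dots> = 2 * of_nat (Suc n) * (2 * central_ratio (Suc n) * odd_harmonic (Suc n))" unfolding Cs[symmetric] by simp
  finally show ?case unfolding A_def by (simp del: of_nat_Suc)
qed

lemma alt_binom_sum: assumes "n \<le> M"
  shows "zp_cong p 1 (\<Sum>i<n. alt_binom i * inverse (of_nat (n - i))) (2 * alt_binom n * odd_harmonic n)"
proof -
  have "zp_cong p 1 (\<Sum>i<n. alt_binom i * inverse (of_nat (n - i))) (\<Sum>i<n. central_ratio i * inverse (of_nat (n - i)))"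
    using assms p_eq by (intro zp_cong_sum zp_cong_mult alt_binom_central_ratio zp_cong_refl nat_unit) auto
  also have "\<dots> = 2 * central_ratio n * odd_harmonic n" using central_ratio_sum[of n] by (simp add: divide_inverse)
  also have "zp_cong p 1 \<dots> (2 * alt_binom n * odd_harmonic n)"
    using assms by (intro zp_cong_mult zp_cong_sym[OF alt_binom_central_ratio] zp_cong_refl Zp_odd_harmonic) auto
  finally show ?thesis .
qed

lemma alt_binom_reflect: "i \<le> M \<Longrightarrow> alt_binom (M - i) = (-1) ^ M * alt_binom i"
proof -
  assume i: "i \<le> M"
  have "(-1) ^ M = ((-1) ^ (M - i) * (-1) ^ i :: rat)"
    using power_add[of "-1 :: rat" "M - i" i] i by simp
  hence "(-1) ^ M * (-1) ^ i = ((-1) ^ (M - i) * ((-1) ^ i * (-1) ^ i) :: rat)" by simp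
  also have "(-1) ^ i * (-1) ^ i = (1 :: rat)" by (simp flip: power_mult_distrib)
  finally show ?thesis using i binomial_symmetric[OF i] by (simp add: alt_binom_def)
qed

lemma alt_binom_sum': assumes "n \<le> M"
  shows "zp_cong p 1 (\<Sum>i=Suc n..M. alt_binom i * inverse (of_nat (i - n))) (2 * alt_binom n * odd_harmonic (M - n))"
proof -
  have s: "(-1) ^ M * (-1) ^ M = (1 :: rat)" by (simp flip: power_mult_distrib)
  have "(\<Sum>i=Suc n..M. alt_binom i * inverse (of_nat (i - n))) = (\<Sum>j<M - n. alt_binom (M - j) * inverse (of_nat (M - n - j)))"
    using assms by (intro sum.reindex_bij_witness[of _ "\<lambda>j. M - j" "\<lambda>i. M - i"]) auto
  also have "\<dots> = (-1) ^ M * (\<Sum>j<M - n. alt_binom j * inverse (of_nat (M - n - j)))"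
    by (simp add: alt_binom_reflect sum_distrib_left mult.assoc)
  also have "zp_cong p 1 \<dots> ((-1) ^ M * (2 * alt_binom (M - n) * odd_harmonic (M - n)))"
    by (intro zp_cong_mult[OF zp_cong_refl alt_binom_sum] Zp_power Zp_minus Zp_1) auto
  also have "(-1) ^ M * (2 * alt_binom (M - n) * odd_harmonic (M - n)) = ((-1) ^ M * (-1) ^ M) * (2 * alt_binom n * odd_harmonic (M - n))"
    using assms by (simp add: alt_binom_reflect)
  finally show ?thesis by (simp add: s)
qed

text \<open>Under \<open>l\<close> to \<open>M + 1 - l\<close> the odd number \<open>2 l - 1\<close>
  becomes \<open>p - 2 l\<close>, which is \<open>-2 l\<close> modulo \<open>p\<close>.\<close>

lemma odd_harmonic_reflect: assumes "n \<le> M" shows "zp_cong p 1 (odd_harmonic (M - n)) (- (H - harmonic n) / 2)"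
proof -
  have "odd_harmonic (M - n) = (\<Sum>l=Suc n..M. inverse (of_nat p - of_nat (2 * l)))"
    unfolding odd_harmonic_def
    by (rule sum.reindex_bij_witness[of _ "\<lambda>l. M + 1 - l" "\<lambda>l. M + 1 - l"])
      (use assms in \<open>auto simp: p_eq of_nat_diff\<close>)
  also have "zp_cong p 1 \<dots> (\<Sum>l=Suc n..M. - inverse (of_nat (2 * l)))"
  proof (rule zp_cong_sum)
    fix l assume l: "l \<in> {Suc n..M}"
    have u: "inverse (of_nat (2 * l)) \<in> Zp p" using l p_eq by (intro nat_unit) auto
    have l': "0 < p - 2 * l" "p - 2 * l < p" "2 * l \<le> p" using l p_eq by auto
    have e: "of_nat p - of_nat (2 * l) = (of_nat (p - 2 * l) :: rat)" using l'(3) by (rule of_nat_diff[symmetric])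
    have v: "inverse (of_nat p - of_nat (2 * l)) \<in> Zp p" unfolding e using l' by (intro nat_unit)
    have nz: "of_nat p - of_nat (2 * l) \<noteq> (0::rat)" "of_nat (2 * l) \<noteq> (0::rat)" unfolding e of_nat_eq_0_iff using l' l by auto
    have "inverse (q - z) = - inverse z + q ^ 1 * (inverse (q - z) * inverse z)" if "q - z \<noteq> 0" "z \<noteq> 0" for q z :: rat
      using that by (simp add: field_simps)
    note this[OF nz]
    thus "zp_cong p 1 (inverse (of_nat p - of_nat (2 * l))) (- inverse (of_nat (2 * l)))"
      unfolding zp_cong_iff using u v by blast
  qed
  also have "(\<Sum>l=Suc n..M. - inverse (of_nat (2 * l))) = - (\<Sum>l=Suc n..M. inverse (of_nat l)) / (2 :: rat)"
    by (simp add: sum_negf sum_divide_distrib field_simps)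
  also have "(\<Sum>l=Suc n..M. inverse (of_nat l)) = H - harmonic n"
  proof -
    have "{1..M} = {1..n} \<union> {Suc n..M}" "{1..n} \<inter> {Suc n..M} = {}" using assms by auto
    thus ?thesis unfolding H_def harmonic_def by (simp add: sum.union_disjoint)
  qed
  finally show ?thesis .
qed

section \<open>The quotients of p choose r by p, and sums over them\<close>

definition phi :: "nat \<Rightarrow> int" where "phi r = int (p choose r) div int p"

lemma choose_p: assumes "0 < r" "r < p" shows "int (p choose r) = int p * phi r"
  using dvd_choose_prime[of r p] assms p_prime by (simp add: phi_def flip: int_dvd_int_iff)

lemma choose_pm1: "j < p \<Longrightarrow> [int ((p - 1) choose j) = (-1) ^ j] (mod int p)"
proof (induction j)
  case (Suc j)
  have "p choose Suc j = ((p - 1) choose j) + ((p - 1) choose Suc j)"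
    using p_gt by (metis Suc_pred' binomial_Suc_Suc gr_implies_not0 neq0_conv)
  hence "int ((p - 1) choose Suc j) = int p * phi (Suc j) - int ((p - 1) choose j)"
    using choose_p[of "Suc j"] Suc.prems by simp
  moreover have "[int p * phi (Suc j) - int ((p - 1) choose j) = 0 - (-1) ^ j] (mod int p)"
    using Suc by (intro cong_diff) (auto simp: cong_def)
  ultimately show ?case by simp
qed simp

text \<open>From \<open>r (p choose r) = p ((p - 1) choose (r - 1))\<close> together with
  \<open>choose_pm1\<close>.\<close>

lemma phi_cong: assumes "0 < r" "r < p" shows "zp_cong p 1 (of_int (phi r)) (- ((-1) ^ r) * inverse (of_nat r))"
proof -
  obtain j where j: "r = Suc j" using assms by (cases r) auto
  have "int r * int (p choose r) = int p * int ((p - 1) choose j)"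
    using binomial_absorption[of j "p"] unfolding j by (metis of_nat_mult)
  hence "int p * (int r * phi r) = int p * int ((p - 1) choose j)" using choose_p[OF assms] by simp
  hence "int r * phi r = int ((p - 1) choose j)" using p_gt by simp
  hence "[int r * phi r = (-1) ^ j] (mod int p ^ 1)" using choose_pm1[of j] assms j by simp
  hence "zp_cong p 1 (of_int (int r * phi r)) (of_int ((-1) ^ j))" using zp_cong_of_int[of 1] by blast
  from zp_cong_mult[OF zp_cong_refl[OF nat_unit[OF assms]] this]
  have "zp_cong p 1 (inverse (of_nat r) * of_int (int r * phi r)) (inverse (of_nat r) * of_int ((-1) ^ j))" .
  moreover have "inverse (of_nat r) * of_int (int r * phi r) = (of_int (phi r) :: rat)" using assms by simp
  moreover have "inverse (of_nat r) * of_int ((-1) ^ j) = - ((-1) ^ r) * inverse (of_nat r :: rat)" by (simp add: j)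
  ultimately show ?thesis by (simp only:)
qed

text \<open>The sums run over the pairs \<open>(i, r)\<close> with \<open>i + r\<close> congruent to \<open>n\<close> modulo \<open>p - 1\<close>, and with \<open>i + r + 1\<close>
congruent to \<open>n\<close> modulo \<open>p + 1\<close>, respectively.\<close>

definition T_split :: "nat \<Rightarrow> int" where
  "T_split n = (\<Sum>i<n. int ((M - 1) choose i) * phi (n - i)) + (\<Sum>i=n..<M. int ((M - 1) choose i) * phi (p - 1 + n - i))"

definition T_inert :: "nat \<Rightarrow> int" where
  "T_inert n = (\<Sum>i<n - 1. int ((M - 1) choose i) * phi (n - 1 - i)) + (\<Sum>i=Suc n..<M. int ((M - 1) choose i) * phi (p + n - i))"

lemma M_choose1: "of_nat M * of_nat ((M - 1) choose i) = (of_nat (Suc i) * of_nat (M choose Suc i) :: rat)"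
  using binomial_absorption[of i M] M_pos by (metis of_nat_mult)

lemma M_choose2: "i \<le> M \<Longrightarrow> of_nat M * of_nat ((M - 1) choose i) = (of_nat (M - i) * of_nat (M choose i) :: rat)"
  using binomial_absorb_comp[of M i] by (metis of_nat_mult)


lemma phi_reflect: "k \<le> p \<Longrightarrow> phi (p - k) = phi k"
  unfolding phi_def using binomial_symmetric[of k p] by simp

text \<open>The factor \<open>M\<close> turns binomials of \<open>M - 1\<close> into weighted
  binomials of \<open>M\<close>, and the symmetry of \<open>phi\<close> moves the wrapped-around
  second sum to the indices above \<open>n\<close>. Both sums then depend on the distance of
  \<open>i\<close> to \<open>n\<close>.\<close>

lemma M_T_split: assumes "n \<le> M"
  shows "of_nat M * of_int (T_split n) = ((\<Sum>i<n. of_nat (M - i) * of_nat (M choose i) * of_int (phi (n - i)))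
     + (\<Sum>i=Suc n..M. of_nat i * of_nat (M choose i) * of_int (phi (i - n))) :: rat)"
proof -
  have "(\<Sum>i=n..<M. of_nat M * of_nat ((M - 1) choose i) * of_int (phi (p - 1 + n - i)))
      = (\<Sum>i=Suc n..M. of_nat i * of_nat (M choose i) * (of_int (phi (i - n)) :: rat))"
  proof (rule sum.reindex_bij_witness[of _ "\<lambda>i. i - 1" Suc])
    fix i assume i: "i \<in> {n..<M}"
    have "p - 1 + n - i = p - (Suc i - n)" "Suc i - n \<le> p" using i p_eq by auto
    hence "phi (p - 1 + n - i) = phi (Suc i - n)" by (simp only: phi_reflect)
    thus "of_nat (Suc i) * of_nat (M choose Suc i) * (of_int (phi (Suc i - n)) :: rat)
       = of_nat M * of_nat ((M - 1) choose i) * of_int (phi (p - 1 + n - i))"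
      by (simp only: M_choose1)
  qed auto
  moreover have "(\<Sum>i<n. of_nat M * of_nat ((M - 1) choose i) * of_int (phi (n - i)))
     = (\<Sum>i<n. of_nat (M - i) * of_nat (M choose i) * (of_int (phi (n - i)) :: rat))"
    using assms by (intro sum.cong refl) (simp only: M_choose2 lessThan_iff less_imp_le order.strict_trans2)
  ultimately show ?thesis by (simp add: T_split_def distrib_left sum_distrib_left mult.assoc)
qed

text \<open>Compared with the split case the two weights are exchanged. The terms
  \<open>i = 0\<close> and \<open>i = M\<close> that appear in the new ranges have weight
  zero.\<close>

lemma M_T_inert: assumes "n \<le> M"
  shows "of_nat M * of_int (T_inert n) = ((\<Sum>i<n. of_nat i * of_nat (M choose i) * of_int (phi (n - i)))
     + (\<Sum>i=Suc n..M. of_nat (M - i) * of_nat (M choose i) * of_int (phi (i - n))) :: rat)"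
proof -
  have "(\<Sum>i=Suc n..<M. of_nat M * of_nat ((M - 1) choose i) * of_int (phi (p + n - i)))
      = (\<Sum>i=Suc n..<M. of_nat (M - i) * of_nat (M choose i) * (of_int (phi (i - n)) :: rat))"
  proof (rule sum.cong[OF refl])
    fix i assume i: "i \<in> {Suc n..<M}"
    have "p + n - i = p - (i - n)" "i - n \<le> p" using i p_eq by auto
    hence "phi (p + n - i) = phi (i - n)" by (simp only: phi_reflect)
    thus "of_nat M * of_nat ((M - 1) choose i) * of_int (phi (p + n - i))
      = of_nat (M - i) * of_nat (M choose i) * (of_int (phi (i - n)) :: rat)"
      using M_choose2[of i] i by simp
  qed
  also have "\<dots> = (\<Sum>i=Suc n..M. of_nat (M - i) * of_nat (M choose i) * (of_int (phi (i - n)) :: rat))"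
    by (rule sum.mono_neutral_left) auto
  finally have A: "(\<Sum>i=Suc n..<M. of_nat M * of_nat ((M - 1) choose i) * of_int (phi (p + n - i)))
    = (\<Sum>i=Suc n..M. of_nat (M - i) * of_nat (M choose i) * (of_int (phi (i - n)) :: rat))" .
  have B: "(\<Sum>i<n - 1. of_nat M * of_nat ((M - 1) choose i) * of_int (phi (n - 1 - i)))
     = (\<Sum>i<n. of_nat i * of_nat (M choose i) * (of_int (phi (n - i)) :: rat))"
  proof (cases n)
    case (Suc m)
    show ?thesis unfolding Suc sum.lessThan_Suc_shift diff_Suc_1
      by (simp only: M_choose1 of_nat_0 mult_zero_left add_0 diff_Suc_Suc)
  qed simp
  show ?thesis unfolding A[symmetric] B[symmetric] by (simp add: T_inert_def distrib_left sum_distrib_left mult.assoc)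
qed

lemma sign_alt_binom: "(-1) ^ k * of_nat (M choose i) = (-1) ^ n * alt_binom i" if "k = n - i \<and> i \<le> n \<or> k = i - n \<and> n \<le> i"
proof -
  have "even (n + i) \<longleftrightarrow> even k" using that by auto
  hence "(-1) ^ k = ((-1) ^ n * (-1) ^ i :: rat)" by (metis neg_one_even_power neg_one_odd_power power_add)
  thus ?thesis by (simp add: alt_binom_def)
qed

lemma phi_sum_lt: assumes "n \<le> M"
  shows "zp_cong p 1 (\<Sum>i<n. of_nat (w i) * of_nat (M choose i) * of_int (phi (n - i)))
     (- ((-1) ^ n) * (\<Sum>i<n. of_nat (w i) * alt_binom i * inverse (of_nat (n - i))))"
proof -
  have "zp_cong p 1 (\<Sum>i<n. of_nat (w i) * of_nat (M choose i) * of_int (phi (n - i)))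
     (\<Sum>i<n. of_nat (w i) * of_nat (M choose i) * (- ((-1) ^ (n - i)) * inverse (of_nat (n - i))))"
    using assms p_eq by (intro zp_cong_sum zp_cong_mult[OF zp_cong_refl phi_cong] Zp_mult Zp_nat) auto
  also have "\<dots> = (\<Sum>i<n. - (of_nat (w i) * ((-1) ^ (n - i) * of_nat (M choose i)) * inverse (of_nat (n - i))))"
    by (simp add: mult_ac)
  also have "\<dots> = (\<Sum>i<n. - (of_nat (w i) * ((-1) ^ n * alt_binom i) * inverse (of_nat (n - i))))"
    by (intro sum.cong refl) (subst sign_alt_binom[of _ n], auto)
  finally show ?thesis by (simp add: sum_negf sum_distrib_left mult_ac)
qed

lemma phi_sum_gt: assumes "n \<le> M"
  shows "zp_cong p 1 (\<Sum>i=Suc n..M. of_nat (w i) * of_nat (M choose i) * of_int (phi (i - n)))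
     (- ((-1) ^ n) * (\<Sum>i=Suc n..M. of_nat (w i) * alt_binom i * inverse (of_nat (i - n))))"
proof -
  have "zp_cong p 1 (\<Sum>i=Suc n..M. of_nat (w i) * of_nat (M choose i) * of_int (phi (i - n)))
     (\<Sum>i=Suc n..M. of_nat (w i) * of_nat (M choose i) * (- ((-1) ^ (i - n)) * inverse (of_nat (i - n))))"
    using assms p_eq by (intro zp_cong_sum zp_cong_mult[OF zp_cong_refl phi_cong] Zp_mult Zp_nat) auto
  also have "\<dots> = (\<Sum>i=Suc n..M. - (of_nat (w i) * ((-1) ^ (i - n) * of_nat (M choose i)) * inverse (of_nat (i - n))))"
    by (simp add: mult_ac)
  also have "\<dots> = (\<Sum>i=Suc n..M. - (of_nat (w i) * ((-1) ^ n * alt_binom i) * inverse (of_nat (i - n))))"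
    by (intro sum.cong refl) (subst sign_alt_binom[of _ n], auto)
  finally show ?thesis by (simp add: sum_negf sum_distrib_left mult_ac)
qed

text \<open>The polynomial \<open>(1 - X)^M\<close> vanishes at \<open>X = 1\<close>, and the term
  \<open>i = n\<close> is the only one left out.\<close>

lemma alt_binom_total: assumes "n \<le> M" shows "(\<Sum>i<n. alt_binom i) + (\<Sum>i=Suc n..M. alt_binom i) = - alt_binom n"
proof -
  have "{..M} = ({..<n} \<union> {Suc n..M}) \<union> {n}" using assms by auto
  hence "(\<Sum>i\<le>M. alt_binom i) = ((\<Sum>i<n. alt_binom i) + (\<Sum>i=Suc n..M. alt_binom i)) + alt_binom n"
    by (simp only:, subst sum.union_disjoint; simp) (subst sum.union_disjoint; auto)
  moreover have "(\<Sum>i\<le>M. alt_binom i) = 0" using choose_alternating_sum[OF M_pos, where ?'a = rat] by (simp add: alt_binom_def)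
  ultimately show ?thesis by linarith
qed

lemma sign_alt_binom_self: "(-1) ^ n * alt_binom n = of_nat (M choose n)"
  by (simp add: alt_binom_def mult.assoc[symmetric] flip: power_mult_distrib)

text \<open>The weights are \<open>M - i = (n - i) + (M - n)\<close> and
  \<open>i = (i - n) + n\<close>. The first parts cancel the denominators and add up to
  \<open>- alt_binom n\<close>; the second parts are constant in \<open>i\<close> and leave the sums
  of \<open>alt_binom_sum\<close> and \<open>alt_binom_sum'\<close>.\<close>

lemma M_T_split_cong: assumes "n \<le> M"
  shows "zp_cong p 1 (of_nat M * of_int (T_split n))
     (of_nat (M choose n) * (1 - 2 * of_nat (M - n) * odd_harmonic n - 2 * of_nat n * odd_harmonic (M - n)))"
proof -
  let ?s = "- ((-1) ^ n) :: rat"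
  have sZ: "?s \<in> Zp p" by (intro Zp_minus Zp_power Zp_1)
  have A: "(\<Sum>i<n. of_nat (M - i) * alt_binom i * inverse (of_nat (n - i)))
      = (\<Sum>i<n. alt_binom i) + of_nat (M - n) * (\<Sum>i<n. alt_binom i * inverse (of_nat (n - i)))"
    unfolding sum_distrib_left sum.distrib[symmetric]
  proof (intro sum.cong refl)
    fix i assume "i \<in> {..<n}"
    hence "of_nat (n - i) \<noteq> (0::rat)" "of_nat (M - i) = (of_nat (n - i) + of_nat (M - n) :: rat)"
      using assms by (auto simp flip: of_nat_add)
    moreover have "W * c * inverse d = c + N * (c * inverse d)" if "d \<noteq> 0" "W = d + N" for W c d N :: rat
      using that by (simp add: field_simps)
    ultimately show "of_nat (M - i) * alt_binom i * inverse (of_nat (n - i)) = alt_binom i + of_nat (M - n) * (alt_binom i * inverse (of_nat (n - i)))"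
      by blast
  qed
  have B: "(\<Sum>i=Suc n..M. of_nat i * alt_binom i * inverse (of_nat (i - n)))
      = (\<Sum>i=Suc n..M. alt_binom i) + of_nat n * (\<Sum>i=Suc n..M. alt_binom i * inverse (of_nat (i - n)))"
    unfolding sum_distrib_left sum.distrib[symmetric]
  proof (intro sum.cong refl)
    fix i assume "i \<in> {Suc n..M}"
    hence "of_nat (i - n) \<noteq> (0::rat)" "of_nat i = (of_nat (i - n) + of_nat n :: rat)"
      using assms by (auto simp flip: of_nat_add)
    moreover have "W * c * inverse d = c + N * (c * inverse d)" if "d \<noteq> 0" "W = d + N" for W c d N :: rat
      using that by (simp add: field_simps)
    ultimately show "of_nat i * alt_binom i * inverse (of_nat (i - n)) = alt_binom i + of_nat n * (alt_binom i * inverse (of_nat (i - n)))"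
      by blast
  qed
  have "zp_cong p 1 (of_nat M * of_int (T_split n))
     (?s * (\<Sum>i<n. of_nat (M - i) * alt_binom i * inverse (of_nat (n - i)))
      + ?s * (\<Sum>i=Suc n..M. of_nat i * alt_binom i * inverse (of_nat (i - n))))"
    unfolding M_T_split[OF assms] by (rule zp_cong_add[OF phi_sum_lt[OF assms] phi_sum_gt[OF assms]])
  also have "\<dots> = ?s * (((\<Sum>i<n. alt_binom i) + (\<Sum>i=Suc n..M. alt_binom i)) + of_nat (M - n) * (\<Sum>i<n. alt_binom i * inverse (of_nat (n - i)))
       + of_nat n * (\<Sum>i=Suc n..M. alt_binom i * inverse (of_nat (i - n))))"
    unfolding A B by (simp only: algebra_simps)
  also have "\<dots> = ?s * (- alt_binom n + of_nat (M - n) * (\<Sum>i<n. alt_binom i * inverse (of_nat (n - i)))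
       + of_nat n * (\<Sum>i=Suc n..M. alt_binom i * inverse (of_nat (i - n))))"
    unfolding alt_binom_total[OF assms] ..
  also have "zp_cong p 1 \<dots> (?s * (- alt_binom n + of_nat (M - n) * (2 * alt_binom n * odd_harmonic n) + of_nat n * (2 * alt_binom n * odd_harmonic (M - n))))"
    by (intro zp_cong_mult[OF zp_cong_refl[OF sZ]] zp_cong_add zp_cong_mult[OF zp_cong_refl alt_binom_sum[OF assms]] 
      zp_cong_mult[OF zp_cong_refl alt_binom_sum'[OF assms]] zp_cong_refl Zp_nat Zp_minus Zp_alt_binom)
  also have "?s * (- alt_binom n + of_nat (M - n) * (2 * alt_binom n * odd_harmonic n) + of_nat n * (2 * alt_binom n * odd_harmonic (M - n)))
     = ((-1) ^ n * alt_binom n) * (1 - 2 * of_nat (M - n) * odd_harmonic n - 2 * of_nat n * odd_harmonic (M - n))"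
    by (simp add: algebra_simps)
  finally show ?thesis unfolding sign_alt_binom_self .
qed

text \<open>Here the weights are \<open>i = n - (n - i)\<close> and
  \<open>M - i = (M - n) - (i - n)\<close>, so the parts that cancel the denominators enter with the
  opposite sign.\<close>

lemma M_T_inert_cong: assumes "n \<le> M"
  shows "zp_cong p 1 (of_nat M * of_int (T_inert n))
     (of_nat (M choose n) * (- 1 - 2 * of_nat n * odd_harmonic n - 2 * of_nat (M - n) * odd_harmonic (M - n)))"
proof -
  let ?s = "- ((-1) ^ n) :: rat"
  have sZ: "?s \<in> Zp p" by (intro Zp_minus Zp_power Zp_1)
  have A: "(\<Sum>i<n. of_nat i * alt_binom i * inverse (of_nat (n - i)))
      = - (\<Sum>i<n. alt_binom i) + of_nat n * (\<Sum>i<n. alt_binom i * inverse (of_nat (n - i)))"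
    unfolding sum_distrib_left sum.distrib[symmetric] sum_negf[symmetric]
  proof (intro sum.cong refl)
    fix i assume "i \<in> {..<n}"
    hence "of_nat (n - i) \<noteq> (0::rat)" "of_nat n = (of_nat (n - i) + of_nat i :: rat)"
      using assms by (auto simp flip: of_nat_add)
    moreover have "I * c * inverse d = - c + N * (c * inverse d)" if "d \<noteq> 0" "N = d + I" for I c d N :: rat
      using that by (simp add: field_simps)
    ultimately show "of_nat i * alt_binom i * inverse (of_nat (n - i)) = - alt_binom i + of_nat n * (alt_binom i * inverse (of_nat (n - i)))"
      by blast
  qed
  have B: "(\<Sum>i=Suc n..M. of_nat (M - i) * alt_binom i * inverse (of_nat (i - n)))
      = - (\<Sum>i=Suc n..M. alt_binom i) + of_nat (M - n) * (\<Sum>i=Suc n..M. alt_binom i * inverse (of_nat (i - n)))"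
    unfolding sum_distrib_left sum.distrib[symmetric] sum_negf[symmetric]
  proof (intro sum.cong refl)
    fix i assume "i \<in> {Suc n..M}"
    hence "of_nat (i - n) \<noteq> (0::rat)" "of_nat (M - n) = (of_nat (i - n) + of_nat (M - i) :: rat)"
      using assms by (auto simp flip: of_nat_add)
    moreover have "I * c * inverse d = - c + N * (c * inverse d)" if "d \<noteq> 0" "N = d + I" for I c d N :: rat
      using that by (simp add: field_simps)
    ultimately show "of_nat (M - i) * alt_binom i * inverse (of_nat (i - n)) = - alt_binom i + of_nat (M - n) * (alt_binom i * inverse (of_nat (i - n)))"
      by blast
  qed
  have "zp_cong p 1 (of_nat M * of_int (T_inert n))
     (?s * (\<Sum>i<n. of_nat i * alt_binom i * inverse (of_nat (n - i)))
      + ?s * (\<Sum>i=Suc n..M. of_nat (M - i) * alt_binom i * inverse (of_nat (i - n))))"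
    unfolding M_T_inert[OF assms] by (rule zp_cong_add[OF phi_sum_lt[OF assms] phi_sum_gt[OF assms]])
  also have "\<dots> = ?s * (- ((\<Sum>i<n. alt_binom i) + (\<Sum>i=Suc n..M. alt_binom i)) + of_nat n * (\<Sum>i<n. alt_binom i * inverse (of_nat (n - i)))
       + of_nat (M - n) * (\<Sum>i=Suc n..M. alt_binom i * inverse (of_nat (i - n))))"
    unfolding A B by (simp add: algebra_simps)
  also have "\<dots> = ?s * (alt_binom n + of_nat n * (\<Sum>i<n. alt_binom i * inverse (of_nat (n - i)))
       + of_nat (M - n) * (\<Sum>i=Suc n..M. alt_binom i * inverse (of_nat (i - n))))"
    unfolding alt_binom_total[OF assms] by simp
  also have "zp_cong p 1 \<dots> (?s * (alt_binom n + of_nat n * (2 * alt_binom n * odd_harmonic n) + of_nat (M - n) * (2 * alt_binom n * odd_harmonic (M - n))))"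
    by (intro zp_cong_mult[OF zp_cong_refl[OF sZ]] zp_cong_add zp_cong_mult[OF zp_cong_refl alt_binom_sum[OF assms]] 
      zp_cong_mult[OF zp_cong_refl alt_binom_sum'[OF assms]] zp_cong_refl Zp_nat Zp_minus Zp_alt_binom)
  also have "?s * (alt_binom n + of_nat n * (2 * alt_binom n * odd_harmonic n) + of_nat (M - n) * (2 * alt_binom n * odd_harmonic (M - n)))
     = ((-1) ^ n * alt_binom n) * (- 1 - 2 * of_nat n * odd_harmonic n - 2 * of_nat (M - n) * odd_harmonic (M - n))"
    by (simp add: algebra_simps)
  finally show ?thesis unfolding sign_alt_binom_self .
qed


section \<open>The closed forms X and their agreement with Y\<close>

definition X_split :: "nat \<Rightarrow> int" where
  "X_split n = (int p - 1) * (int (M choose n) + int p * (int M * T_split n))"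

definition X_inert :: "nat \<Rightarrow> int" where
  "X_inert n = (int p + 1) * (int (M choose n) + int p * (int M * T_inert n))"

lemma Zp_m1: "-1 \<in> Zp p" by (intro Zp_minus Zp_1)

text \<open>The sign \<open>e\<close> is 1 in the split and -1 in the inert case. The factor
  \<open>p - e\<close> is the number of terms of the sum to be evaluated, and it equals
  \<open>- e (1 - e p)\<close>.\<close>

lemma first_order_X:
  assumes "n \<le> M" "e \<in> {1, -1}" "w \<in> Zp p"
    and T: "zp_cong p 1 (of_nat M * of_int T) (of_nat (M choose n) * w)"
  shows "first_order (of_int ((int p - e) * (int (M choose n) + int p * (int M * T))))
     (- of_int e * ((-1) ^ n * central_ratio n)) (- of_int e - odd_harmonic n + w)"
proof -
  have eZ: "- of_int e \<in> Zp p" by (intro Zp_minus Zp_int)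
  have "first_order (of_int (int p - e)) (- of_int e) (- of_int e)"
    by (rule first_orderI) (use assms(2) eZ in auto)
  moreover have "first_order (of_nat (M choose n) + of_nat p * (of_nat M * of_int T)) ((-1) ^ n * central_ratio n) (- odd_harmonic n + w)"
  proof -
    have "zp_cong p 2 (of_nat p * (of_nat M * of_int T)) (of_nat p * (of_nat (M choose n) * w))"
      using zp_cong_p_mult[OF T] by (simp add: numeral_2_eq_2)
    from zp_cong_add[OF zp_cong_refl[OF Zp_nat[of "M choose n"]] this]
    have *: "zp_cong p 2 (of_nat (M choose n) + of_nat p * (of_nat M * of_int T)) (of_nat (M choose n) * (1 + of_nat p * w))"
      by (simp add: algebra_simps)
    have "first_order (of_nat (M choose n) * (1 * (1 + of_nat p * w))) ((-1) ^ n * central_ratio n * 1) (- odd_harmonic n + w)"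
      by (intro first_order_mult first_order_binom assms first_orderI refl Zp_1)
    thus ?thesis using zp_cong_trans[OF *] unfolding first_order_def by simp
  qed
  ultimately have "first_order (of_int (int p - e) * (of_nat (M choose n) + of_nat p * (of_nat M * of_int T)))
     (- of_int e * ((-1) ^ n * central_ratio n)) (- of_int e + (- odd_harmonic n + w))"
    by (rule first_order_mult)
  thus ?thesis by (simp add: algebra_simps)
qed

lemma half_p: "n \<le> M \<Longrightarrow> 2 * of_nat (M - n) = (of_nat p - 1 - 2 * of_nat n :: rat)"
  by (simp add: p_eq of_nat_diff)

lemma zp_cong_add_p: "a \<in> Zp p \<Longrightarrow> b \<in> Zp p \<Longrightarrow> zp_cong p 1 (a + of_nat p * b) a"
  using zp_cong_iff[of 1 "a + of_nat p * b" a] by auto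

lemma sign_sq: "((-1) ^ n * x)\<^sup>2 = (x :: rat)\<^sup>2"
  by (simp add: power_mult_distrib flip: power_mult)

text \<open>Rewriting \<open>2 (M - n)\<close> as \<open>p - 1 - 2 n\<close> removes the isolated
  \<open>odd_harmonic n\<close>, and \<open>odd_harmonic_reflect\<close> brings in
  \<open>H - harmonic n\<close>. The sign of the leading factor disappears on squaring.\<close>

lemma first_order_X_split: assumes "n \<le> M"
  shows "first_order ((of_int (X_split n))\<^sup>2) ((central_ratio n)\<^sup>2) (2 * of_nat n * (2 * odd_harmonic n + H - harmonic n))"
proof -
  let ?w = "1 - 2 * of_nat (M - n) * odd_harmonic n - 2 * of_nat n * odd_harmonic (M - n)"
  note Z = Zp_odd_harmonic[OF assms] Zp_odd_harmonic[of "M - n"] Zp_harmonic[OF assms] Zp_H Zp_nat Zp_numeral Zp_1 two_unit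
  have wZ: "?w \<in> Zp p" by (intro Zp_diff Zp_mult Z) auto
  have "first_order (of_int (X_split n)) (- of_int 1 * ((-1) ^ n * central_ratio n)) (- of_int 1 - odd_harmonic n + ?w)"
    unfolding X_split_def by (rule first_order_X[OF assms _ wZ M_T_split_cong[OF assms]]) simp
  moreover have "- of_int 1 - odd_harmonic n + ?w = (2 * of_nat n * odd_harmonic n - 2 * of_nat n * odd_harmonic (M - n)) + of_nat p * (- odd_harmonic n)"
    unfolding half_p[OF assms] by (simp add: algebra_simps)
  ultimately have "first_order (of_int (X_split n)) (- of_int 1 * ((-1) ^ n * central_ratio n)) ((2 * of_nat n * odd_harmonic n - 2 * of_nat n * odd_harmonic (M - n)) + of_nat p * (- odd_harmonic n))"
    by (simp only:)
  moreover have "zp_cong p 1 ((2 * of_nat n * odd_harmonic n - 2 * of_nat n * odd_harmonic (M - n)) + of_nat p * (- odd_harmonic n))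
      (2 * of_nat n * odd_harmonic n - 2 * of_nat n * odd_harmonic (M - n))"
    by (intro zp_cong_add_p Zp_diff Zp_mult Zp_minus Z) auto
  moreover have "zp_cong p 1 (2 * of_nat n * odd_harmonic n - 2 * of_nat n * odd_harmonic (M - n))
      (2 * of_nat n * odd_harmonic n - 2 * of_nat n * (- (H - harmonic n) / 2))"
    by (intro zp_cong_diff zp_cong_mult[OF zp_cong_refl odd_harmonic_reflect[OF assms]] zp_cong_refl Zp_mult Z)
  ultimately have "first_order (of_int (X_split n)) (- of_int 1 * ((-1) ^ n * central_ratio n)) (2 * of_nat n * odd_harmonic n - 2 * of_nat n * (- (H - harmonic n) / 2))"
    using first_order_cong zp_cong_trans by blast
  note sq = first_order_sq[OF this]
  have "(- of_int 1 * ((-1) ^ n * central_ratio n))\<^sup>2 = (central_ratio n)\<^sup>2" by (simp add: sign_sq)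
  moreover have "2 * (2 * of_nat n * odd_harmonic n - 2 * of_nat n * (- (H - harmonic n) / 2)) = 2 * of_nat n * (2 * odd_harmonic n + H - harmonic n)"
    by (simp add: field_simps)
  ultimately show ?thesis using sq by (simp only:)
qed

lemma first_order_X_inert: assumes "n \<le> M"
  shows "first_order ((of_int (X_inert n))\<^sup>2) ((central_ratio n)\<^sup>2) (- (2 * of_nat n + 1) * (2 * odd_harmonic n + H - harmonic n))"
proof -
  let ?w = "- 1 - 2 * of_nat n * odd_harmonic n - 2 * of_nat (M - n) * odd_harmonic (M - n)"
  let ?m = "2 * of_nat n + 1 :: rat"
  note Z = Zp_odd_harmonic[OF assms] Zp_odd_harmonic[of "M - n"] Zp_harmonic[OF assms] Zp_H Zp_nat Zp_numeral Zp_1 Zp_m1 two_unit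
  have wZ: "?w \<in> Zp p" by (intro Zp_diff Zp_mult Z) auto
  have mZ: "?m \<in> Zp p" by (intro Zp_add Zp_mult Z)
  have "first_order (of_int (X_inert n)) (- of_int (-1) * ((-1) ^ n * central_ratio n)) (- of_int (-1) - odd_harmonic n + ?w)"
    using first_order_X[OF assms _ wZ M_T_inert_cong[OF assms], of "-1"] by (simp add: X_inert_def)
  moreover have "- of_int (-1) - odd_harmonic n + ?w = (- ?m * odd_harmonic n + ?m * odd_harmonic (M - n)) + of_nat p * (- odd_harmonic (M - n))"
    unfolding half_p[OF assms] by (simp add: algebra_simps)
  ultimately have "first_order (of_int (X_inert n)) (- of_int (-1) * ((-1) ^ n * central_ratio n)) ((- ?m * odd_harmonic n + ?m * odd_harmonic (M - n)) + of_nat p * (- odd_harmonic (M - n)))"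
    by (simp only:)
  moreover have "zp_cong p 1 ((- ?m * odd_harmonic n + ?m * odd_harmonic (M - n)) + of_nat p * (- odd_harmonic (M - n))) (- ?m * odd_harmonic n + ?m * odd_harmonic (M - n))"
    using mZ by (intro zp_cong_add_p Zp_add[OF Zp_mult Zp_mult] Zp_mult Zp_minus Z) auto
  moreover have "zp_cong p 1 (- ?m * odd_harmonic n + ?m * odd_harmonic (M - n)) (- ?m * odd_harmonic n + ?m * (- (H - harmonic n) / 2))"
    using mZ by (intro zp_cong_add[OF zp_cong_refl zp_cong_mult[OF zp_cong_refl odd_harmonic_reflect[OF assms]]] Zp_mult Zp_minus Z) auto
  ultimately have "first_order (of_int (X_inert n)) (- of_int (-1) * ((-1) ^ n * central_ratio n)) (- ?m * odd_harmonic n + ?m * (- (H - harmonic n) / 2))"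
    using first_order_cong zp_cong_trans by blast
  note sq = first_order_sq[OF this]
  have "(- of_int (-1) * ((-1) ^ n * central_ratio n))\<^sup>2 = (central_ratio n)\<^sup>2" by (simp add: sign_sq)
  moreover have "2 * (- ?m * odd_harmonic n + ?m * (- (H - harmonic n) / 2)) = - ?m * (2 * odd_harmonic n + H - harmonic n)"
    by (simp add: field_simps)
  ultimately show ?thesis using sq by (simp only:)
qed

text \<open>In first order \<open>odds / evens\<close> at \<open>p t\<close> is
  \<open>central_ratio n\<close> times \<open>1 + p t (odd_harmonic n - harmonic n / 2)\<close>.
  With the factor \<open>1 + p t H\<close> the chain gives \<open>Y\<close> the exponent
  \<open>t (2 odd_harmonic n + H - harmonic n)\<close>, which is that of \<open>X^2\<close> as soon
  as \<open>s\<close> and \<open>t\<close> agree modulo \<open>p\<close>.\<close>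

lemma Y_eq_X:
  assumes n: "n \<le> M" and y: "admissible y" and t: "t \<in> Zp p" and X: "first_order (X\<^sup>2) ((central_ratio n)\<^sup>2) (s * (2 * odd_harmonic n + H - harmonic n))"
    and s: "zp_cong p 1 t s"
  shows "zp_cong p 2 (Y y (of_nat p * t + 2 * of_nat n)) (X\<^sup>2)"
proof -
  note Z = Zp_odd_harmonic[OF n] Zp_harmonic[OF n] Zp_H Zp_nat Zp_numeral Zp_1 two_unit t
  have o: "of_nat (2 * j - 1) = 2 * of_nat j - (1::rat)" if "j \<in> {1..n}" for j using that by (simp add: of_nat_diff)
  have u: "inverse (of_nat (2 * j - 1)) \<in> Zp p" "inverse (of_nat (2 * j)) \<in> Zp p" if "j \<in> {1..n}" for j
  proof -
    have "0 < 2 * j - 1" "2 * j - 1 < p" "0 < 2 * j" "2 * j < p" using that n p_eq by auto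
    thus "inverse (of_nat (2 * j - 1)) \<in> Zp p" "inverse (of_nat (2 * j)) \<in> Zp p" using nat_unit by blast+
  qed
  let ?N = "\<Prod>j=1..n. of_nat (2 * j - 1) :: rat"
  let ?D = "\<Prod>j=1..n. of_nat (2 * j) :: rat"
  have "odds n (of_nat p * t) = (\<Prod>j=1..n. of_nat (2 * j - 1) * (1 + of_nat p * (t * inverse (of_nat (2 * j - 1)))))"
    unfolding odds_def
  proof (intro prod.cong refl)
    fix j assume j: "j \<in> {1..n}"
    have "of_nat (2 * j - 1) \<noteq> (0::rat)" using j by (simp only: of_nat_eq_0_iff) auto
    moreover have "q * t + d = d * (1 + q * (t * inverse d))" if "d \<noteq> 0" for q d :: rat using that by (simp add: field_simps)
    ultimately show "of_nat p * t + 2 * of_nat j - 1 = of_nat (2 * j - 1) * (1 + of_nat p * (t * inverse (of_nat (2 * j - 1))))"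
      using o[OF j] by (metis add_diff_eq)
  qed
  moreover have "(\<Sum>j=1..n. t * inverse (of_nat (2 * j - 1))) = t * odd_harmonic n" by (simp add: odd_harmonic_def sum_distrib_left)
  moreover have "first_order (\<Prod>j=1..n. of_nat (2 * j - 1) * (1 + of_nat p * (t * inverse (of_nat (2 * j - 1))))) ?N
      (\<Sum>j=1..n. t * inverse (of_nat (2 * j - 1)))"
    by (rule first_order_prod) (intro Zp_mult t u Zp_nat finite_atLeastAtMost; assumption)+
  ultimately have N: "first_order (odds n (of_nat p * t)) ?N (t * odd_harmonic n)" by simp
  have "evens n (of_nat p * t) = (\<Prod>j=1..n. of_nat (2 * j) * (1 + of_nat p * (t * inverse (of_nat (2 * j)))))"
    unfolding evens_def
  proof (intro prod.cong refl)
    fix j assume j: "j \<in> {1..n}"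
    have "of_nat (2 * j) \<noteq> (0::rat)" using j by (simp only: of_nat_eq_0_iff) auto
    moreover have "q * t + d = d * (1 + q * (t * inverse d))" if "d \<noteq> 0" for q d :: rat using that by (simp add: field_simps)
    ultimately show "of_nat p * t + 2 * of_nat j = of_nat (2 * j) * (1 + of_nat p * (t * inverse (of_nat (2 * j))))"
      by (metis of_nat_mult of_nat_numeral)
  qed
  moreover have "(\<Sum>j=1..n. t * inverse (of_nat (2 * j))) = t * harmonic n / 2"
    by (simp add: harmonic_def sum_distrib_left sum_divide_distrib field_simps)
  moreover have "first_order (\<Prod>j=1..n. of_nat (2 * j) * (1 + of_nat p * (t * inverse (of_nat (2 * j))))) ?D
      (\<Sum>j=1..n. t * inverse (of_nat (2 * j)))"
    by (rule first_order_prod) (intro Zp_mult t u Zp_nat finite_atLeastAtMost; assumption)+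
  ultimately have D: "first_order (evens n (of_nat p * t)) ?D (t * harmonic n / 2)" by (simp only:)
  have CND: "?D * central_ratio n = ?N" unfolding central_ratio_def prod.distrib[symmetric]
    by (intro prod.cong refl) (simp add: o)
  have X': "first_order (X\<^sup>2) ((central_ratio n)\<^sup>2) (t * (2 * odd_harmonic n + H - harmonic n))"
    by (rule first_order_cong[OF X]) (intro zp_cong_mult[OF zp_cong_sym[OF s]] zp_cong_refl Zp_diff Zp_add Zp_mult Z)
  have "first_order ((evens n (of_nat p * t))\<^sup>2 * X\<^sup>2) (?D\<^sup>2 * (central_ratio n)\<^sup>2) (2 * (t * harmonic n / 2) + t * (2 * odd_harmonic n + H - harmonic n))"
    by (rule first_order_mult[OF first_order_sq[OF D] X'])
  moreover have "?D\<^sup>2 * (central_ratio n)\<^sup>2 = ?N\<^sup>2 * 1" unfolding CND[symmetric] by (simp add: power_mult_distrib)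
  moreover have "2 * (t * harmonic n / 2) + t * (2 * odd_harmonic n + H - harmonic n) = 2 * (t * odd_harmonic n) + t * H" by (simp add: algebra_simps)
  ultimately have A: "first_order ((evens n (of_nat p * t))\<^sup>2 * X\<^sup>2) (?N\<^sup>2 * 1) (2 * (t * odd_harmonic n) + t * H)" by simp
  have "first_order (1 + of_nat p * t * H) 1 (t * H)" by (rule first_orderI) (auto simp: Z intro!: Zp_mult Z)
  hence B: "first_order ((odds n (of_nat p * t))\<^sup>2 * (1 + of_nat p * t * H)) (?N\<^sup>2 * 1) (2 * (t * odd_harmonic n) + t * H)"
    by (intro first_order_mult first_order_sq N)
  have "zp_cong p 2 ((evens n (of_nat p * t))\<^sup>2 * Y y (of_nat p * t + 2 * of_nat n)) ((evens n (of_nat p * t))\<^sup>2 * X\<^sup>2)"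
    by (rule zp_cong_trans[OF Y_even[OF y t] first_order_zp_cong[OF B A]])
  thus ?thesis
  proof (rule zp_cong_cancel)
    have "2 * n < p" using n p_eq by simp
    note d = evens_unit[OF t this]
    show "inverse ((evens n (of_nat p * t))\<^sup>2) \<in> Zp p" using Zp_power[OF d(1), of 2] by (simp only: power_inverse)
    show "(evens n (of_nat p * t))\<^sup>2 \<noteq> 0" using d by simp
  qed
qed

text \<open>The binomial divides \<open>fact M\<close>, which is prime to \<open>p\<close>; the
  other factor of \<open>X\<close> is 1 or -1 modulo \<open>p\<close>.\<close>

lemma assumes "n \<le> M"
  shows X_split_unit: "\<not> int p dvd X_split n" and X_inert_unit: "\<not> int p dvd X_inert n"
proof -
  have "\<not> p dvd fact M" using p_eq by (subst prime_dvd_fact_iff[OF p_prime]) simp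
  moreover have "(M choose n) dvd fact M" using binomial_fact_lemma[OF assms] by (metis dvd_triv_right)
  ultimately have b: "\<not> int p dvd int (M choose n)" by auto
  have p1: "\<not> int p dvd int p - 1" "\<not> int p dvd int p + 1" using p_gt by (auto simp: dvd_diff_right_iff dvd_add_right_iff)
  have b': "\<not> int p dvd int (M choose n) + int p * z" for z using b by (simp add: dvd_add_left_iff)
  show "\<not> int p dvd X_split n" "\<not> int p dvd X_inert n"
    unfolding X_split_def X_inert_def using p1 b' pint by (auto simp: prime_dvd_mult_iff)
qed

end

section \<open>Quasi-periodic sequences with constant autocorrelation\<close>

text \<open>A pair \<open>(a, b)\<close> stands for \<open>a + b s\<close> with
  \<open>s^2 = - d\<close>. This is the Lucas sequence \<open>z^k + w^k\<close> for
  \<open>z w = -1\<close> and \<open>z + w = s\<close>. Keeping integer pairs lets the same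
  \<open>A\<close> and \<open>B\<close> serve over the complex numbers and modulo
  \<open>p^2\<close>.\<close>

fun lucas :: "int \<Rightarrow> nat \<Rightarrow> int \<times> int" where
  "lucas d 0 = (2, 0)"
| "lucas d (Suc 0) = (0, 1)"
| "lucas d (Suc (Suc k)) = (fst (lucas d k) - d * snd (lucas d (Suc k)), snd (lucas d k) + fst (lucas d (Suc k)))"

lemma lucas_power_sum:
  fixes z w :: "'a :: comm_ring_1"
  assumes "z * w = - 1" "(z + w)\<^sup>2 = - of_int d"
  shows "z ^ k + w ^ k = of_int (fst (lucas d k)) + of_int (snd (lucas d k)) * (z + w)"
proof (induction k rule: induct_nat_012)
  case (ge2 k)
  have "z ^ Suc (Suc k) + w ^ Suc (Suc k) = (z + w) * (z ^ Suc k + w ^ Suc k) - (z * w) * (z ^ k + w ^ k)"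
    by (simp add: algebra_simps)
  also have "\<dots> = (z + w) * of_int (fst (lucas d (Suc k))) + of_int (snd (lucas d (Suc k))) * (z + w)\<^sup>2
      + (of_int (fst (lucas d k)) + of_int (snd (lucas d k)) * (z + w))"
    unfolding ge2 assms(1) by (simp add: algebra_simps power2_eq_square)
  finally show ?case unfolding assms(2) by (simp add: algebra_simps)
qed auto

lemma periodic_sum_shift:
  fixes f :: "nat \<Rightarrow> 'a :: comm_monoid_add"
  assumes "\<And>k. f (k + n) = f k"
  shows "(\<Sum>k<n. f (l + k)) = (\<Sum>k<n. f k)"
proof (induction l)
  case (Suc l)
  show ?case
  proof (cases n)
    case (Suc m)
    have "(\<Sum>k<n. f (Suc l + k)) = (\<Sum>k<m. f (l + Suc k)) + f (l + n)" using Suc by simp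
    also have "f (l + n) = f (l + 0)" using assms[of l] by simp
    also have "(\<Sum>k<m. f (l + Suc k)) + f (l + 0) = (\<Sum>k<n. f (l + k))"
      unfolding Suc sum.lessThan_Suc_shift by (simp add: add.commute)
    finally show ?thesis using Suc.IH by simp
  qed simp
qed simp

lemma periodic_sum_reflect:
  fixes f :: "nat \<Rightarrow> 'a :: comm_monoid_add"
  assumes "\<And>k. f (k + n) = f k"
  shows "(\<Sum>k<n. f (n - k)) = (\<Sum>k<n. f k)"
proof -
  have "(\<Sum>k<n. f (n - k)) = (\<Sum>k<n. f (1 + k))"
    by (rule sum.reindex_bij_witness[of _ "\<lambda>k. n - 1 - k" "\<lambda>k. n - 1 - k"]) (auto simp: Suc_diff_Suc)
  thus ?thesis using periodic_sum_shift[of f n 1, OF assms] by simp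
qed

text \<open>Multiplying out \<open>E z * E (1 / z)\<close> collects the autocorrelations of
  \<open>e\<close>, and all but \<open>q\<close> drops out. The reflection gives
  \<open>E (- 1 / z) = E z\<close>, so \<open>2 E z = A + B (z - 1 / z)\<close>; replacing
  \<open>z\<close> by \<open>1 / z\<close> flips the sign of \<open>B\<close>.\<close>

lemma quasi_periodic_norm:
  fixes e :: "nat \<Rightarrow> int" and z :: complex and q c d t :: int
  assumes n: "even n" and c: "c = 1 \<or> c = - 1"
    and per: "\<And>k. e (k + n) = c * e k"
    and rfl: "\<And>k. k \<le> n \<Longrightarrow> e (n - k) = c * (-1) ^ k * e k"
    and corr: "\<And>j. j < n \<Longrightarrow> (\<Sum>k<n. e k * e (k + j)) = (if j = 0 then q else 0) - t * (1 + (-1) ^ j)"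
    and z: "z \<noteq> 0" "z ^ n = of_int c" "(z - 1 / z)\<^sup>2 = - of_int d" and t: "t \<noteq> 0 \<Longrightarrow> c = 1 \<and> z\<^sup>2 \<noteq> 1" and n0: "n > 0"
  shows "(\<Sum>k<n. fst (lucas d k) * e k)\<^sup>2 + d * (\<Sum>k<n. snd (lucas d k) * e k)\<^sup>2 = 4 * q"
proof -
  define E where "E z = (\<Sum>k<n. of_int (e k) * z ^ k)" for z :: complex
  have cc: "of_int c * of_int c = (1 :: complex)" using c by auto
  have perz: "of_int (e (k + n)) * y ^ (k + n) = of_int (e k) * y ^ k" if "y ^ n = of_int c" for k and y :: complex
  proof -
    have "of_int (e (k + n)) * y ^ (k + n) = (of_int c * of_int c) * (of_int (e k) * y ^ k)"
      unfolding per power_add that by simp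
    thus ?thesis using cc by simp
  qed
  have refl': "E (- 1 / y) = E y" if y: "y ^ n = of_int c" "y \<noteq> 0" for y
  proof -
    have "E y = (\<Sum>k<n. of_int (e (n - k)) * y ^ (n - k))"
      unfolding E_def by (rule periodic_sum_reflect[symmetric]) (rule perz[OF y(1)])
    also have "\<dots> = (\<Sum>k<n. of_int (e k) * (- 1 / y) ^ k)"
    proof (intro sum.cong refl)
      fix k assume "k \<in> {..<n}"
      hence k: "k \<le> n" by simp
      have "y ^ (n - k) = of_int c / y ^ k" using y k by (simp add: power_diff)
      hence "of_int (e (n - k)) * y ^ (n - k) = (of_int c * of_int c) * (of_int (e k) * ((-1) ^ k / y ^ k))"
        unfolding rfl[OF k] by simp
      thus "of_int (e (n - k)) * y ^ (n - k) = of_int (e k) * (- 1 / y) ^ k"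
        unfolding cc by (simp add: power_divide power_minus')
    qed
    finally show ?thesis by (simp add: E_def)
  qed
  have yn: "(1 / z) ^ n = of_int c" using z(2) c by (auto simp: power_divide)
  have norm: "E z * E (1 / z) = of_int q"
  proof -
    have sh: "(\<Sum>k<n. of_int (e k) * z ^ k) = (\<Sum>j<n. of_int (e (l + j)) * z ^ (l + j))" for l
      by (rule periodic_sum_shift[of "\<lambda>k. of_int (e k) * z ^ k" n l, symmetric]) (rule perz[OF z(2)])
    have "E z * E (1 / z) = (\<Sum>l<n. (\<Sum>k<n. of_int (e k) * z ^ k) * (of_int (e l) * (1 / z) ^ l))"
      unfolding E_def by (simp add: sum_distrib_left)
    also have "\<dots> = (\<Sum>l<n. (\<Sum>j<n. of_int (e (l + j)) * z ^ (l + j)) * (of_int (e l) * (1 / z) ^ l))"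
      by (intro sum.cong refl arg_cong2[of _ _ _ _ "(*)"] sh)
    also have "\<dots> = (\<Sum>l<n. \<Sum>j<n. z ^ j * of_int (e l * e (l + j)))"
      unfolding sum_distrib_right using z(1) by (intro sum.cong refl) (simp add: power_add power_divide)
    also have "\<dots> = (\<Sum>j<n. z ^ j * of_int (\<Sum>l<n. e l * e (l + j)))"
      by (subst sum.swap) (simp add: sum_distrib_left)
    also have "\<dots> = (\<Sum>j<n. z ^ j * of_int ((if j = 0 then q else 0) - t * (1 + (-1) ^ j)))"
      by (intro sum.cong refl) (simp add: corr)
    also have "\<dots> = (\<Sum>j<n. if j = 0 then of_int q else 0) - of_int t * ((\<Sum>j<n. z ^ j) + (\<Sum>j<n. (- z) ^ j))"
      unfolding sum.distrib[symmetric] sum_distrib_left sum_subtractf[symmetric]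
      by (intro sum.cong refl) (auto simp: algebra_simps power_minus')
    also have "(\<Sum>j<n. if j = 0 then of_int q else 0) = (of_int q :: complex)"
      using n0 by (simp add: sum.delta)
    \<comment> \<open>The correction terms of the autocorrelation form geometric series in
      \<open>z\<close> and \<open>- z\<close>; both vanish because \<open>z ^ n = 1\<close>,
      \<open>n\<close> is even and \<open>z\<close> is neither 1 nor -1.\<close>
    also have "of_int t * ((\<Sum>j<n. z ^ j) + (\<Sum>j<n. (- z) ^ j)) = 0"
    proof (cases "t = 0")
      case False
      hence "z\<^sup>2 \<noteq> 1" "z ^ n = 1" using t z(2) by auto
      moreover from this have "z \<noteq> 1" "- z \<noteq> 1" "(- z) ^ n = 1" using n minus_equation_iff[of z 1] by (auto simp: power2_eq_1_iff)
      ultimately show ?thesis by (simp add: geometric_sum[of z] geometric_sum[of "- z"])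
    qed simp
    finally show ?thesis by simp
  qed
  let ?A = "\<Sum>k<n. fst (lucas d k) * e k" and ?B = "\<Sum>k<n. snd (lucas d k) * e k"
  have lincomb: "(\<Sum>k<n. of_int (e k) * (of_int (F k) + of_int (G k) * u))
      = of_int (\<Sum>k<n. F k * e k) + of_int (\<Sum>k<n. G k * e k) * (u :: complex)" for F G u
    by (simp add: sum.distrib sum_distrib_left sum_distrib_right algebra_simps)
  have double: "2 * E y = of_int ?A + of_int ?B * (y - 1 / y)" if y: "y ^ n = of_int c" "y \<noteq> 0" "(y - 1 / y)\<^sup>2 = - of_int d" for y
  proof -
    have "2 * E y = (\<Sum>k<n. of_int (e k) * (y ^ k + (- 1 / y) ^ k))"
      using refl'[OF y(1,2)] by (simp add: E_def sum.distrib algebra_simps)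
    also have "\<dots> = (\<Sum>k<n. of_int (e k) * (of_int (fst (lucas d k)) + of_int (snd (lucas d k)) * (y - 1 / y)))"
      using lucas_power_sum[of y "- 1 / y" d] y by simp
    also have "\<dots> = of_int ?A + of_int ?B * (y - 1 / y)" by (rule lincomb)
    finally show ?thesis .
  qed
  have "(1 / z - 1 / (1 / z))\<^sup>2 = - of_int d" using z(3) by (simp add: power2_commute)
  hence "2 * E (1 / z) = of_int ?A - of_int ?B * (z - 1 / z)"
    using double[OF yn] z(1) by (simp add: algebra_simps)
  note double' = this
  have "4 * of_int q = (2 * E z) * (2 * E (1 / z))" using norm by (simp add: mult.assoc mult.left_commute)
  also have "\<dots> = (of_int ?A + of_int ?B * (z - 1 / z)) * (of_int ?A - of_int ?B * (z - 1 / z))"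
    unfolding double' double[OF z(2,1,3)] ..
  also have "\<dots> = (of_int ?A)\<^sup>2 - (of_int ?B)\<^sup>2 * (z - 1 / z)\<^sup>2" by (simp add: algebra_simps power2_eq_square)
  also have "\<dots> = (of_int (?A\<^sup>2 + d * ?B\<^sup>2) :: complex)" unfolding z(3) by (simp add: algebra_simps)
  finally have "(of_int (4 * q) :: complex) = of_int (?A\<^sup>2 + d * ?B\<^sup>2)" by simp
  thus ?thesis by (simp only: of_int_eq_iff)
qed

context odd_prime
begin

section \<open>Legendre symbols and their sum over the projective line\<close>

definition L :: "int \<Rightarrow> int" where "L a = Legendre a (int p)"

lemma L_values: "L a = 0 \<or> L a = 1 \<or> L a = - 1"
  unfolding L_def Legendre_def by auto

lemma L_euler: "[L a = a ^ M] (mod int p)"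
proof -
  have "(p - 1) div 2 = M" using p_eq by simp
  thus ?thesis using euler_criterion[OF p_prime p_gt, of a] by (simp only: L_def)
qed

lemma L_eqI: "[L a = x] (mod int p) \<Longrightarrow> x = 0 \<or> x = 1 \<or> x = - 1 \<Longrightarrow> L a = x"
proof -
  assume "[L a = x] (mod int p)" and x: "x = 0 \<or> x = 1 \<or> x = - 1"
  hence "int p dvd L a - x" by (simp add: cong_iff_dvd_diff)
  moreover have "\<bar>L a - x\<bar> < int p" using L_values[of a] x p_gt by auto
  ultimately show "L a = x" using dvd_imp_le_int[of "L a - x" "int p"] by linarith
qed

lemma L_mult: "L (a * b) = L a * L b"
proof (rule L_eqI)
  have "[L (a * b) = a ^ M * b ^ M] (mod int p)" using L_euler[of "a * b"] by (simp add: power_mult_distrib)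
  thus "[L (a * b) = L a * L b] (mod int p)" using cong_mult[OF L_euler[of a] L_euler[of b]] cong_sym cong_trans by blast
qed (use L_values[of a] L_values[of b] in auto)

lemma L_cong: "[a = b] (mod int p) \<Longrightarrow> L a = L b"
  by (rule L_eqI[OF _ L_values]) (meson L_euler cong_pow cong_sym cong_trans)

lemma L_0_iff: "L a = 0 \<longleftrightarrow> int p dvd a"
  unfolding L_def Legendre_def by (auto simp: cong_0_iff)

lemma L_1: "L 1 = 1"
  by (rule L_eqI) (use L_euler[of 1] in auto)

lemma L_power: "L (a ^ k) = L a ^ k" by (induction k) (auto simp: L_1 L_mult)

text \<open>Multiplication by the non-residue \<open>g\<close> permutes the residues and negates
  every symbol.\<close>

lemma sum_L: assumes "L g = - 1" shows "(\<Sum>r<p. L (int r)) = 0"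
proof -
  have g: "\<not> int p dvd g" using assms L_0_iff[of g] by auto
  let ?f = "\<lambda>r. nat (g * int r mod int p)"
  have pp: "int p > 0" using p_gt by simp
  have f: "int (?f r) = g * int r mod int p" for r using pp by simp
  have inj: "inj_on ?f {..<p}"
  proof (rule inj_onI)
    fix r s assume rs: "r \<in> {..<p}" "s \<in> {..<p}" "?f r = ?f s"
    hence "[g * int r = g * int s] (mod int p)" unfolding cong_def using f by metis
    hence "int p dvd g * (int r - int s)" by (simp add: cong_iff_dvd_diff right_diff_distrib)
    hence "int p dvd int r - int s" using g pint by (simp add: prime_dvd_mult_iff)
    moreover have "\<bar>int r - int s\<bar> < int p" using rs by auto
    ultimately show "r = s" using dvd_imp_le_int[of "int r - int s" "int p"] by linarith
  qed
  have "?f ` {..<p} \<subseteq> {..<p}" using pp by (auto simp: nat_less_iff)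
  hence im: "?f ` {..<p} = {..<p}" using inj by (simp add: endo_inj_surj)
  have "(\<Sum>r<p. L (int r)) = (\<Sum>r\<in>?f ` {..<p}. L (int r))" using im by simp
  also have "\<dots> = (\<Sum>r<p. L (int (?f r)))" by (rule sum.reindex[OF inj, unfolded o_def])
  also have "\<dots> = (\<Sum>r<p. L g * L (int r))"
    unfolding f by (intro sum.cong refl) (metis L_cong L_mult cong_mod_left cong_refl)
  also have "\<dots> = - (\<Sum>r<p. L (int r))" using assms by (simp add: sum_negf)
  finally show ?thesis by simp
qed

text \<open>The points \<open>(a k : b k)\<close> exhaust the projective line over the field with p elements.\<close>

lemma sum_L_projective:
  fixes a b :: "'k \<Rightarrow> int"
  assumes K: "finite K" "card K = p + 1" and g: "L g = - 1"
    and npr: "\<And>k l. k \<in> K \<Longrightarrow> l \<in> K \<Longrightarrow> k \<noteq> l \<Longrightarrow> \<not> int p dvd a k * b l - a l * b k"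
  shows "(\<Sum>k\<in>K. L (a k * b k)) = 0"
proof -
  define K' where "K' = {k \<in> K. \<not> int p dvd b k}"
  \<comment> \<open>The power \<open>b k ^ (p - 2)\<close> inverts \<open>b k\<close> modulo
    \<open>p\<close>, so \<open>r k\<close> is the affine coordinate of the point.\<close>
  define r where "r k = nat (a k * b k ^ (p - 2) mod int p)" for k
  have pp: "int p > 0" using p_gt by simp
  have r: "int (r k) = a k * b k ^ (p - 2) mod int p" for k using pp by (simp add: r_def)
  have fermat: "[b k * b k ^ (p - 2) = 1] (mod int p)" if "k \<in> K'" for k
  proof -
    have "Suc (p - 2) = M * 2" using p_eq M_pos by simp
    hence "b k * b k ^ (p - 2) = (b k ^ M) ^ 2" by (simp only: power_mult[symmetric] power_Suc[symmetric])
    moreover have "[(b k ^ M) ^ 2 = L (b k) ^ 2] (mod int p)" using L_euler cong_sym cong_pow by blast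
    moreover have "L (b k) ^ 2 = 1" using that L_0_iff[of "b k"] L_values[of "b k"] by (auto simp: K'_def)
    ultimately show ?thesis by metis
  qed
  have rb: "[int (r k) * b k = a k] (mod int p)" if "k \<in> K'" for k
  proof -
    have "[int (r k) * b k = a k * b k ^ (p - 2) * b k] (mod int p)" unfolding r by (intro cong_mult) (auto simp: cong_def)
    also have "a k * b k ^ (p - 2) * b k = a k * (b k * b k ^ (p - 2))" by simp
    also have "[\<dots> = a k * 1] (mod int p)" by (intro cong_mult fermat that cong_refl)
    finally show ?thesis by simp
  qed
  have inj: "inj_on r K'"
  proof (rule inj_onI)
    fix k l assume kl: "k \<in> K'" "l \<in> K'" "r k = r l"
    have "[a k * b l = int (r k) * b k * b l] (mod int p)" "[a l * b k = int (r l) * b l * b k] (mod int p)"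
      by (intro cong_mult cong_sym[OF rb] kl cong_refl)+
    hence "[a k * b l - a l * b k = int (r k) * b k * b l - int (r l) * b l * b k] (mod int p)" by (rule cong_diff)
    hence "int p dvd a k * b l - a l * b k" using kl(3) by (simp add: mult_ac cong_0_iff)
    thus "k = l" using npr kl by (auto simp: K'_def)
  qed
  have fin: "finite K'" "finite (K - K')" using K by (auto simp: K'_def)
  \<comment> \<open>Two points with \<open>b\<close> divisible by \<open>p\<close> would have a
    determinant divisible by \<open>p\<close>. So at least \<open>p\<close> points are affine, and
    with distinct coordinates they hit every residue.\<close>
  have "card (K - K') \<le> Suc 0"
    unfolding card_le_Suc0_iff_eq[OF fin(2)]
  proof (intro ballI)
    fix k l assume "k \<in> K - K'" "l \<in> K - K'"
    thus "k = l" using npr[of k l] by (auto simp: K'_def)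
  qed
  moreover have "card K = card K' + card (K - K')"
    using K fin card_Un_disjoint[of K' "K - K'"] by (metis Diff_disjoint K'_def Un_Diff_cancel mem_Collect_eq subsetI sup.absorb2)
  ultimately have "card K' \<ge> p" using K(2) by linarith
  hence "card (r ` K') \<ge> p" using card_image[OF inj] by simp
  moreover have "r ` K' \<subseteq> {..<p}" using pp by (auto simp: r_def nat_less_iff)
  ultimately have im: "r ` K' = {..<p}" using card_subset_eq[of "{..<p}" "r ` K'"] card_mono[of "{..<p}" "r ` K'"] by simp
  have "(\<Sum>k\<in>K. L (a k * b k)) = (\<Sum>k\<in>K'. L (a k * b k))"
    using K by (intro sum.mono_neutral_right) (auto simp: K'_def L_0_iff)
  also have "\<dots> = (\<Sum>k\<in>K'. L (int (r k)))"
  proof (intro sum.cong refl)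
    fix k assume k: "k \<in> K'"
    have "L (a k) = L (int (r k)) * L (b k)" using L_cong[OF rb[OF k]] L_mult by simp
    moreover have "L (b k) * L (b k) = 1" using k L_0_iff[of "b k"] L_values[of "b k"] by (auto simp: K'_def)
    ultimately show "L (a k * b k) = L (int (r k))" by (simp add: L_mult mult.assoc)
  qed
  also have "\<dots> = (\<Sum>r<p. L (int r))" unfolding im[symmetric] by (rule sum.reindex[OF inj, unfolded o_def, symmetric])
  also have "\<dots> = 0" by (rule sum_L[OF g])
  finally show ?thesis .
qed

end

section \<open>Congruences in an order of complex numbers\<close>

text \<open>\<open>Or\<close> will be the ring of integers or, for a non-residue \<open>N\<close>, the ring of all \<open>a + b sqrt N\<close>.\<close>

locale prime_order = odd_prime +
  fixes Or :: "complex set"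
  assumes Or_1: "1 \<in> Or" and Or_add: "x \<in> Or \<Longrightarrow> y \<in> Or \<Longrightarrow> x + y \<in> Or"
    and Or_mult: "x \<in> Or \<Longrightarrow> y \<in> Or \<Longrightarrow> x * y \<in> Or" and Or_uminus: "x \<in> Or \<Longrightarrow> - x \<in> Or"
    and Or_int_dvd: "x \<in> Or \<Longrightarrow> of_int m = of_nat p ^ k * x \<Longrightarrow> int p ^ k dvd m"
begin

lemma Or_0: "0 \<in> Or" using Or_add[OF Or_1 Or_uminus[OF Or_1]] by simp
lemma Or_nat: "of_nat n \<in> Or" by (induction n) (auto intro: Or_0 Or_1 Or_add)
lemma Or_int: "of_int n \<in> Or" using Or_nat Or_uminus by (cases n rule: int_cases2) auto
lemma Or_diff: "x \<in> Or \<Longrightarrow> y \<in> Or \<Longrightarrow> x - y \<in> Or" using Or_add[of x "- y"] Or_uminus by simp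
lemma Or_power: "x \<in> Or \<Longrightarrow> x ^ n \<in> Or" by (induction n) (auto intro: Or_1 Or_mult)
lemma Or_sum: "(\<And>i. i \<in> A \<Longrightarrow> f i \<in> Or) \<Longrightarrow> sum f A \<in> Or"
  by (induction A rule: infinite_finite_induct) (auto intro: Or_0 Or_add)

lemmas Or_intros = Or_0 Or_1 Or_nat Or_int Or_add Or_mult Or_uminus Or_diff Or_power Or_sum

definition cg :: "nat \<Rightarrow> complex \<Rightarrow> complex \<Rightarrow> bool" where
  "cg k x y \<longleftrightarrow> x \<in> Or \<and> y \<in> Or \<and> (\<exists>a\<in>Or. x = y + of_nat p ^ k * a)"

lemma cgI: "y \<in> Or \<Longrightarrow> a \<in> Or \<Longrightarrow> x = y + of_nat p ^ k * a \<Longrightarrow> cg k x y"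
  unfolding cg_def by (auto intro!: Or_intros)

lemma cg_Or: "cg k x y \<Longrightarrow> x \<in> Or" "cg k x y \<Longrightarrow> y \<in> Or" unfolding cg_def by auto

lemma cg_refl: "x \<in> Or \<Longrightarrow> cg k x x" by (rule cgI[OF _ Or_0]) auto

lemma cg_sym: assumes "cg k x y" shows "cg k y x"
proof -
  obtain a where a: "a \<in> Or" "x = y + of_nat p ^ k * a" "x \<in> Or" using assms unfolding cg_def by auto
  show ?thesis by (rule cgI[OF a(3) Or_uminus[OF a(1)]]) (simp add: a(2))
qed

lemma cg_trans [trans]: assumes "cg k x y" "cg k y z" shows "cg k x z"
proof -
  obtain a b where a: "a \<in> Or" "x = y + of_nat p ^ k * a" "b \<in> Or" "y = z + of_nat p ^ k * b" "z \<in> Or"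
    using assms unfolding cg_def by auto
  show ?thesis by (rule cgI[OF a(5) Or_add[OF a(1,3)]]) (simp add: a(2,4) algebra_simps)
qed

lemma cg_add: assumes "cg k x y" "cg k x' y'" shows "cg k (x + x') (y + y')"
proof -
  obtain a b where a: "a \<in> Or" "x = y + of_nat p ^ k * a" "b \<in> Or" "x' = y' + of_nat p ^ k * b" "y + y' \<in> Or"
    using assms Or_add unfolding cg_def by auto
  show ?thesis by (rule cgI[OF a(5) Or_add[OF a(1,3)]]) (simp add: a(2,4) algebra_simps)
qed

lemma cg_mult: assumes "cg k x y" "cg k x' y'" shows "cg k (x * x') (y * y')"
proof -
  obtain a b where a: "a \<in> Or" "x = y + of_nat p ^ k * a" "b \<in> Or" "x' = y' + of_nat p ^ k * b" "y * y' \<in> Or"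
    and y: "y \<in> Or" "y' \<in> Or"
    using assms Or_mult unfolding cg_def by auto
  have "a * y' + y * b + of_nat p ^ k * a * b \<in> Or" using a y by (intro Or_intros)
  thus ?thesis by (rule cgI[OF a(5)]) (simp add: a(2,4) algebra_simps)
qed

lemma cg_uminus: "cg k x y \<Longrightarrow> cg k (- x) (- y)"
  using cg_mult[OF cg_refl[OF Or_uminus[OF Or_1]], of k x y] by simp
lemma cg_diff: "cg k x y \<Longrightarrow> cg k x' y' \<Longrightarrow> cg k (x - x') (y - y')"
  using cg_add[OF _ cg_uminus, of k x y x' y'] by simp
lemma cg_power: "cg k x y \<Longrightarrow> cg k (x ^ n) (y ^ n)"
  by (induction n) (auto intro: cg_mult cg_refl Or_1)
lemma cg_sum: "(\<And>i. i \<in> A \<Longrightarrow> cg k (f i) (g i)) \<Longrightarrow> cg k (sum f A) (sum g A)"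
  by (induction A rule: infinite_finite_induct) (auto intro: cg_add cg_refl Or_0)

lemma cg_left: "cg k x y \<Longrightarrow> a \<in> Or \<Longrightarrow> cg k (a * x) (a * y)" using cg_mult cg_refl by blast
lemma cg_right: "cg k x y \<Longrightarrow> a \<in> Or \<Longrightarrow> cg k (x * a) (y * a)" using cg_mult cg_refl by blast

lemma cg_weaken: assumes "cg 2 x y" shows "cg 1 x y"
proof -
  obtain a where a: "a \<in> Or" "x = y + of_nat p ^ 2 * a" "y \<in> Or" using assms unfolding cg_def by auto
  have "of_nat p * a \<in> Or" using a by (intro Or_intros)
  thus ?thesis by (rule cgI[OF a(3)]) (simp add: a(2) power2_eq_square)
qed

text \<open>The bridge back to the integers: \<open>Or_int_dvd\<close> excludes that an integer
  becomes divisible by \<open>p^k\<close> only inside \<open>Or\<close>.\<close>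

lemma cg_of_int: "cg k (of_int a) (of_int b) \<longleftrightarrow> [a = b] (mod int p ^ k)"
proof
  assume "cg k (of_int a) (of_int b)"
  then obtain c where c: "c \<in> Or" "(of_int a :: complex) = of_int b + of_nat p ^ k * c" unfolding cg_def by auto
  hence "of_int (a - b) = of_nat p ^ k * c" by simp
  from Or_int_dvd[OF c(1) this] show "[a = b] (mod int p ^ k)" by (simp add: cong_iff_dvd_diff)
next
  assume "[a = b] (mod int p ^ k)"
  then obtain c where "a = b + int p ^ k * c" by (metis cong_iff_lin cong_sym)
  thus "cg k (of_int a) (of_int b)" by (intro cgI[OF Or_int Or_int[of c]]) simp
qed

text \<open>In \<open>x^p - y^p = (x - y) * S\<close> the sum \<open>S\<close> has \<open>p\<close>
  terms, all congruent to \<open>y^(p - 1)\<close>, and so supplies a second factor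
  \<open>p\<close>. This is what turns roots of unity modulo \<open>p\<close> into roots modulo
  \<open>p^2\<close>.\<close>

lemma cg_pow_p: assumes "cg 1 x y" shows "cg 2 (x ^ p) (y ^ p)"
proof -
  obtain a where a: "a \<in> Or" "x = y + of_nat p ^ 1 * a" "x \<in> Or" "y \<in> Or" using assms unfolding cg_def by auto
  have "cg 1 (\<Sum>i<p. y ^ (p - Suc i) * x ^ i) (\<Sum>i<p. y ^ (p - Suc i) * y ^ i)"
    using assms a by (intro cg_sum cg_left cg_power Or_power) auto
  also have "(\<Sum>i<p. y ^ (p - Suc i) * y ^ i) = (\<Sum>i<p. y ^ (p - 1))"
    by (intro sum.cong refl) (simp flip: power_add)
  also have "\<dots> = 0 + of_nat p ^ 1 * y ^ (p - 1)" by simp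
  also have "cg 1 \<dots> 0" by (rule cgI[OF Or_0 Or_power[OF a(4), of "p - 1"]]) simp
  finally obtain b where b: "b \<in> Or" "(\<Sum>i<p. y ^ (p - Suc i) * x ^ i) = of_nat p ^ 1 * b"
    unfolding cg_def by auto
  have "x ^ p = y ^ p + (x - y) * (\<Sum>i<p. y ^ (p - Suc i) * x ^ i)"
    using power_diff_sumr2[of x p y] by (metis add.commute diff_add_cancel)
  also have "\<dots> = y ^ p + (of_nat p * a) * (of_nat p ^ 1 * b)" unfolding b(2) using a(2) by simp
  also have "\<dots> = y ^ p + of_nat p ^ 2 * (a * b)" by (simp add: power2_eq_square algebra_simps)
  finally have e: "x ^ p = y ^ p + of_nat p ^ 2 * (a * b)" .
  show ?thesis by (rule cgI[OF Or_power[OF a(4)] Or_mult[OF a(1) b(1)] e])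
qed

section \<open>Units modulo powers of p\<close>

definition un :: "nat \<Rightarrow> complex \<Rightarrow> bool" where "un k x \<longleftrightarrow> x \<in> Or \<and> (\<exists>y\<in>Or. cg k (x * y) 1)"

lemma un_cancel: assumes "un k x" "cg k (x * a) (x * b)" "a \<in> Or" "b \<in> Or" shows "cg k a b"
proof -
  obtain y where y: "y \<in> Or" "cg k (x * y) 1" "x \<in> Or" using assms(1) unfolding un_def by auto
  have "cg k a (x * y * a)" using cg_sym[OF cg_right[OF y(2) assms(3)]] by simp
  also have "cg k \<dots> (x * y * b)" using cg_left[OF assms(2) y(1)] by (simp add: mult_ac)
  also have "cg k \<dots> b" using cg_right[OF y(2) assms(4)] by simp
  finally show ?thesis .
qed

lemma un_mult: assumes "un k x" "un k y" shows "un k (x * y)"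
proof -
  obtain a b where ab: "a \<in> Or" "b \<in> Or" "cg k (x * a) 1" "cg k (y * b) 1" "x \<in> Or" "y \<in> Or"
    using assms unfolding un_def by auto
  have "cg k (x * y * (a * b)) 1" using cg_mult[OF ab(3,4)] by (simp add: mult_ac)
  thus ?thesis unfolding un_def using ab Or_mult by blast
qed

lemma un_dvd: assumes "un k (x * y)" "x \<in> Or" "y \<in> Or" shows "un k x"
  using assms unfolding un_def by (metis Or_mult mult.assoc)

lemma un_cong: assumes "un k x" "cg k y x" shows "un k y"
proof -
  obtain a where a: "a \<in> Or" "cg k (x * a) 1" using assms unfolding un_def by auto
  have "cg k (y * a) 1" using cg_trans[OF cg_right[OF assms(2) a(1)] a(2)] .
  thus ?thesis unfolding un_def using a cg_Or[OF assms(2)] by auto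
qed

text \<open>A Newton step: if \<open>x y = 1 + p a\<close>, then \<open>y (1 - p a)\<close> inverts
  \<open>x\<close> modulo \<open>p^2\<close>.\<close>

lemma un_lift: assumes "un 1 x" shows "un 2 x"
proof -
  obtain y where y: "y \<in> Or" "cg 1 (x * y) 1" "x \<in> Or" using assms unfolding un_def by auto
  then obtain a where a: "a \<in> Or" "x * y = 1 + of_nat p ^ 1 * a" unfolding cg_def by auto
  have "x * (y * (1 - of_nat p * a)) = (1 + of_nat p ^ 1 * a) * (1 - of_nat p * a)" using a(2) by (simp add: mult.assoc[symmetric])
  also have "\<dots> = 1 + of_nat p ^ 2 * (- (a * a))" by (simp add: power2_eq_square algebra_simps)
  finally have e: "x * (y * (1 - of_nat p * a)) = 1 + of_nat p ^ 2 * (- (a * a))" .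
  have "cg 2 (x * (y * (1 - of_nat p * a))) 1" by (rule cgI[OF Or_1 _ e]) (intro Or_intros a)
  moreover have "y * (1 - of_nat p * a) \<in> Or" using y a by (intro Or_intros)
  ultimately show ?thesis using y unfolding un_def by blast
qed

lemma un_1: "un k 1" unfolding un_def using Or_1 cg_refl[OF Or_1] by auto
lemma un_power: "un k x \<Longrightarrow> un k (x ^ n)" by (induction n) (auto intro: un_1 un_mult)
lemma un_uminus: "un k x \<Longrightarrow> un k (- x)" unfolding un_def by (metis Or_uminus minus_mult_minus)

lemma un_int: assumes "un 1 x" "cg 1 (of_int m) x" shows "\<not> int p dvd m"
proof
  assume "int p dvd m"
  hence "cg 1 (of_int m) (of_int 0)" unfolding cg_of_int by (simp add: cong_0_iff)
  hence "cg 1 x 0" using cg_trans[OF cg_sym[OF assms(2)]] by simp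
  then obtain y where y: "y \<in> Or" "cg 1 (x * y) 1" "cg 1 (x * y) (0 * y)" using assms(1) cg_right unfolding un_def by blast
  hence "cg 1 (of_int 1) (of_int 0)" using cg_trans[OF cg_sym[OF y(2)] y(3)] by simp
  thus False unfolding cg_of_int using p_gt by (simp add: cong_def)
qed

section \<open>The trace relation modulo the square of p\<close>

lemma lucas_cong:
  assumes G: "G \<in> Or" "W \<in> Or" "cg 2 (G * W) (- 1)" "cg 2 ((G + W)\<^sup>2) (- of_int d)"
  shows "cg 2 (G ^ k + W ^ k) (of_int (fst (lucas d k)) + of_int (snd (lucas d k)) * (G + W))"
proof (induction k rule: induct_nat_012)
  case 0
  show ?case using cg_refl[OF Or_int[of 2]] by simp
next
  case 1
  show ?case using G by (auto intro!: cg_refl Or_intros)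
next
  case (ge2 k)
  let ?s = "G + W"
  have s: "?s \<in> Or" using G Or_add by auto
  have "G ^ Suc (Suc k) + W ^ Suc (Suc k) = ?s * (G ^ Suc k + W ^ Suc k) - (G * W) * (G ^ k + W ^ k)"
    by (simp add: algebra_simps)
  also have "cg 2 \<dots> (?s * (of_int (fst (lucas d (Suc k))) + of_int (snd (lucas d (Suc k))) * ?s)
      - (- 1) * (of_int (fst (lucas d k)) + of_int (snd (lucas d k)) * ?s))"
    by (intro cg_diff cg_mult G ge2 cg_refl s)
  also have "\<dots> = ?s * of_int (fst (lucas d (Suc k))) + of_int (snd (lucas d (Suc k))) * ?s\<^sup>2
      + (of_int (fst (lucas d k)) + of_int (snd (lucas d k)) * ?s)"
    by (simp add: algebra_simps power2_eq_square)
  also have "cg 2 \<dots> (?s * of_int (fst (lucas d (Suc k))) + of_int (snd (lucas d (Suc k))) * (- of_int d)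
      + (of_int (fst (lucas d k)) + of_int (snd (lucas d k)) * ?s))"
    by (intro cg_add cg_left[OF G(4)] cg_refl Or_intros G)
  finally show ?case by (simp add: algebra_simps)
qed

text \<open>The substitution \<open>k\<close> to \<open>n - k\<close> shows that evaluation at
  \<open>G\<close> and at \<open>W\<close> gives the same \<open>X\<close>, hence
  \<open>2 X = A + B (G + W)\<close> modulo \<open>p^2\<close>. Squaring \<open>2 X - A\<close>
  eliminates \<open>G + W\<close>, and the norm equation turns the result into
  \<open>4 (X^2 + p - A X) = 0\<close>.\<close>

lemma quasi_periodic_cong:
  fixes e :: "nat \<Rightarrow> int"
  assumes c: "c = 1 \<or> c = - 1" and per: "\<And>k. e (k + n) = c * e k"
    and rfl: "\<And>k. k \<le> n \<Longrightarrow> e (n - k) = c * (-1) ^ k * e k"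
    and G: "G \<in> Or" "W \<in> Or" "cg 2 (G * W) (- 1)" "cg 2 ((G + W)\<^sup>2) (- of_int d)" "cg 2 (G ^ n) (of_int c)"
    and X: "cg 2 (\<Sum>k<n. of_int (e k) * G ^ k) (of_int X)"
    and AB: "(\<Sum>k<n. fst (lucas d k) * e k)\<^sup>2 + d * (\<Sum>k<n. snd (lucas d k) * e k)\<^sup>2 = 4 * int p"
    and n0: "n > 0"
  shows "[X\<^sup>2 + int p = (\<Sum>k<n. fst (lucas d k) * e k) * X] (mod int p ^ 2)"
proof -
  let ?A = "\<Sum>k<n. fst (lucas d k) * e k" and ?B = "\<Sum>k<n. snd (lucas d k) * e k"
  let ?f = "\<lambda>k. of_int (e k) * G ^ k"
  have cc: "c * c = 1" using c by auto
  have "(\<Sum>k<n. ?f (n - k)) = (\<Sum>k<n. ?f (Suc k))"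
    by (rule sum.reindex_bij_witness[of _ "\<lambda>k. n - 1 - k" "\<lambda>k. n - 1 - k"]) (auto simp: Suc_diff_Suc)
  also have "\<dots> = (\<Sum>k<Suc n. ?f k) - ?f 0" unfolding sum.lessThan_Suc_shift by simp
  also have "\<dots> = (\<Sum>k<n. ?f k) + of_int (c * e 0) * G ^ n - ?f 0" using per[of 0] by simp
  also have "cg 2 \<dots> ((\<Sum>k<n. ?f k) + of_int (c * e 0) * of_int c - ?f 0)"
    by (intro cg_diff cg_add cg_left[OF G(5)] cg_refl Or_intros G)
  also have "(\<Sum>k<n. ?f k) + of_int (c * e 0) * of_int c - ?f 0 = (\<Sum>k<n. ?f k)"
    using c by auto
  finally have 1: "cg 2 (\<Sum>k<n. ?f (n - k)) (\<Sum>k<n. ?f k)" .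
  have 2: "cg 2 (\<Sum>k<n. ?f (n - k)) (\<Sum>k<n. of_int (e k) * W ^ k)"
  proof (rule cg_sum)
    fix k assume "k \<in> {..<n}"
    hence k: "k \<le> n" by simp
    have s: "(- 1) ^ k * (- 1) ^ k = (1 :: complex)" by (simp flip: power_mult_distrib)
    have "G ^ (n - k) = (-1) ^ k * (G ^ (n - k) * (- 1) ^ k)" using s by simp
    also have "cg 2 \<dots> ((-1) ^ k * (G ^ (n - k) * (G * W) ^ k))"
      by (intro cg_left cg_power cg_sym[OF G(3)] Or_intros G)
    also have "(-1) ^ k * (G ^ (n - k) * (G * W) ^ k) = (-1) ^ k * W ^ k * G ^ n"
      using k by (simp add: power_mult_distrib power_add[symmetric] mult_ac)
    also have "cg 2 \<dots> ((-1) ^ k * W ^ k * of_int c)"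
      by (intro cg_left G Or_intros)
    finally have "cg 2 (?f (n - k)) (of_int (c * (-1) ^ k * e k) * ((-1) ^ k * W ^ k * of_int c))"
      unfolding rfl[OF k] by (rule cg_left) (rule Or_int)
    also have "of_int (c * (-1) ^ k * e k) * ((-1) ^ k * W ^ k * of_int c)
        = of_int (c * c) * ((-1) ^ k * (-1) ^ k) * (of_int (e k) * W ^ k)" by simp
    finally show "cg 2 (?f (n - k)) (of_int (e k) * W ^ k)" unfolding s cc by simp
  qed
  have 3: "cg 2 (\<Sum>k<n. of_int (e k) * W ^ k) (of_int X)"
    using cg_trans[OF cg_sym[OF 2] cg_trans[OF 1 X]] .
  have "cg 2 (\<Sum>k<n. of_int (e k) * (G ^ k + W ^ k)) (\<Sum>k<n. of_int (e k) * (of_int (fst (lucas d k)) + of_int (snd (lucas d k)) * (G + W)))"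
    by (intro cg_sum cg_left lucas_cong G Or_int)
  moreover have "(\<Sum>k<n. of_int (e k) * (of_int (fst (lucas d k)) + of_int (snd (lucas d k)) * (G + W))) = of_int ?A + of_int ?B * (G + W)"
    by (simp add: sum.distrib sum_distrib_left sum_distrib_right algebra_simps)
  moreover have "(\<Sum>k<n. of_int (e k) * (G ^ k + W ^ k)) = (\<Sum>k<n. ?f k) + (\<Sum>k<n. of_int (e k) * W ^ k)"
    by (simp add: sum.distrib algebra_simps)
  ultimately have "cg 2 (of_int X + of_int X) (of_int ?A + of_int ?B * (G + W))"
    using cg_trans[OF cg_sym[OF cg_add[OF X 3]]] by simp
  from cg_diff[OF this cg_refl[OF Or_int[of ?A]]] have "cg 2 (of_int (2 * X - ?A)) (of_int ?B * (G + W))" by simp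
  from cg_power[OF this, of 2] have "cg 2 ((of_int (2 * X - ?A))\<^sup>2) ((of_int ?B)\<^sup>2 * (G + W)\<^sup>2)"
    by (simp add: power_mult_distrib)
  also have "cg 2 \<dots> ((of_int ?B)\<^sup>2 * (- of_int d))"
    by (intro cg_left G Or_intros)
  finally have "cg 2 (of_int ((2 * X - ?A)\<^sup>2)) (of_int (?B\<^sup>2 * (- d)))" by simp
  hence "int p ^ 2 dvd (2 * X - ?A)\<^sup>2 - ?B\<^sup>2 * (- d)" unfolding cg_of_int by (simp add: cong_iff_dvd_diff)
  also have "(2 * X - ?A)\<^sup>2 - ?B\<^sup>2 * (- d) = 4 * (X\<^sup>2 - ?A * X) + (?A\<^sup>2 + d * ?B\<^sup>2)"
    by (simp add: power2_eq_square algebra_simps)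
  also have "\<dots> = 4 * (X\<^sup>2 + int p - ?A * X)" unfolding AB by simp
  finally have "int p ^ 2 dvd 2 ^ 2 * (X\<^sup>2 + int p - ?A * X)" by simp
  moreover have "coprime (int p) 2" using p_odd by (subst coprime_right_2_iff_odd) simp
  hence "coprime (int p ^ 2) (2 ^ 2)" by (intro coprime_power_left_iff[THEN iffD2] coprime_power_right_iff[THEN iffD2] disjI1)
  ultimately have "int p ^ 2 dvd X\<^sup>2 + int p - ?A * X" by (simp only: coprime_dvd_mult_right_iff)
  thus ?thesis by (simp add: cong_iff_dvd_diff)
qed


section \<open>Expansion of p-th powers of sums and evaluation by orthogonality\<close>

lemma cg_pow_first_order: assumes AB: "A \<in> Or" "B \<in> Or"
  shows "cg 2 ((A + of_nat p * B) ^ n) (A ^ n + of_nat p * (of_nat n * A ^ (n - 1) * B))"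
proof (induction n)
  case (Suc n)
  have e: "A * (of_nat n * A ^ (n - 1)) = of_nat n * A ^ n" by (cases n) auto
  have "cg 2 ((A + of_nat p * B) ^ Suc n) ((A + of_nat p * B) * (A ^ n + of_nat p * (of_nat n * A ^ (n - 1) * B)))"
    unfolding power_Suc by (intro cg_left Suc.IH Or_intros AB)
  also have "(A + of_nat p * B) * (A ^ n + of_nat p * (of_nat n * A ^ (n - 1) * B))
     = A ^ Suc n + of_nat p * (A * (of_nat n * A ^ (n - 1)) * B + A ^ n * B) + of_nat p ^ 2 * (of_nat n * A ^ (n - 1) * B * B)"
    by (simp add: algebra_simps power2_eq_square)
  also have "cg 2 \<dots> (A ^ Suc n + of_nat p * (A * (of_nat n * A ^ (n - 1)) * B + A ^ n * B))"
    by (rule cgI[OF _ _ refl]) (intro Or_intros AB)+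
  also have "A * (of_nat n * A ^ (n - 1)) * B + A ^ n * B = of_nat (Suc n) * A ^ (Suc n - 1) * B"
    unfolding e by (simp add: algebra_simps)
  finally show ?case .
qed (auto intro: cg_refl Or_1)

text \<open>The numbers \<open>phi r\<close> are the coefficients of the integral polynomial
  \<open>((x + y)^p - x^p - y^p) / p\<close>.\<close>

lemma freshman:
  "(x + y :: complex) ^ p = x ^ p + y ^ p + of_nat p * (\<Sum>r=1..<p. of_int (phi r) * x ^ r * y ^ (p - r))"
proof -
  have s: "{..p} = insert 0 (insert p {1..<p})" using p_gt by auto
  have "(x + y) ^ p = (\<Sum>r\<le>p. of_nat (p choose r) * x ^ r * y ^ (p - r))" by (rule binomial_ring)
  also have "\<dots> = x ^ p + y ^ p + (\<Sum>r=1..<p. of_nat (p choose r) * x ^ r * y ^ (p - r))"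
    unfolding s using p_gt by simp
  also have "(\<Sum>r=1..<p. of_nat (p choose r) * x ^ r * y ^ (p - r)) = (\<Sum>r=1..<p. of_nat p * (of_int (phi r) * x ^ r * y ^ (p - r)))"
  proof (intro sum.cong refl)
    fix r assume "r \<in> {1..<p}"
    hence "int (p choose r) = int p * phi r" by (intro choose_p) auto
    hence "(of_nat (p choose r) :: complex) = of_nat p * of_int (phi r)" by (metis of_int_mult of_int_of_nat_eq)
    thus "of_nat (p choose r) * x ^ r * y ^ (p - r) = of_nat p * (of_int (phi r) * x ^ r * y ^ (p - r))" by simp
  qed
  finally show ?thesis by (simp add: sum_distrib_left)
qed

text \<open>Used for \<open>x\<close> and \<open>y\<close> whose \<open>p\<close>-th powers are
  known modulo \<open>p^2\<close>: they are fixed in the split case and interchanged in the inert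
  case. By \<open>L_lift\<close> the left side is the Legendre symbol of
  \<open>x + y\<close>.\<close>

lemma cg_pow_pM:
  assumes "x \<in> Or" "y \<in> Or" "cg 2 (x ^ p) x'" "cg 2 (y ^ p) y'"
  shows "cg 2 ((x + y) ^ (p * M)) ((x' + y') ^ M
     + of_nat p * (of_nat M * (x' + y') ^ (M - 1) * (\<Sum>r=1..<p. of_int (phi r) * x ^ r * y ^ (p - r))))"
proof -
  let ?S = "\<Sum>r=1..<p. of_int (phi r) * x ^ r * y ^ (p - r)"
  have S: "?S \<in> Or" by (intro Or_intros assms)
  have "cg 2 ((x + y) ^ p) (x' + y' + of_nat p * ?S)"
    unfolding freshman by (intro cg_add assms(3,4) cg_refl Or_mult Or_nat S)
  from cg_power[OF this, of M] have "cg 2 ((x + y) ^ (p * M)) ((x' + y' + of_nat p * ?S) ^ M)" by (simp add: power_mult)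
  also have "cg 2 \<dots> ((x' + y') ^ M + of_nat p * (of_nat M * (x' + y') ^ (M - 1) * ?S))"
    by (rule cg_pow_first_order[OF _ S]) (intro Or_add cg_Or(2)[OF assms(3)] cg_Or(2)[OF assms(4)])
  finally show ?thesis .
qed

lemma one_plus_pow: "(1 + y :: complex) ^ m = (\<Sum>i\<le>m. of_nat (m choose i) * y ^ i)"
  using binomial_ring[of y 1 m] by (simp add: add.commute)

definition orth :: "nat \<Rightarrow> nat \<Rightarrow> int" where "orth n m = (if n dvd m then int n else 0)"

text \<open>The exponent \<open>e\<close> comes from the root of unity, and \<open>c\<close> from an
  additional factor \<open>u^k\<close>: it is 0 in the split and 1 in the inert case. After
  expanding both binomials the sum over \<open>k\<close> is carried out by orthogonality.\<close>

lemma eval_sum: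
  assumes u: "u \<in> Or" and orth: "\<And>m. cg 2 (\<Sum>k<n. u ^ (k * m)) (of_int (orth n m))"
  shows "cg 2 (\<Sum>k<n. u ^ (k * e) * ((1 + u ^ k) ^ M + of_nat p * (of_nat M * (1 + u ^ k) ^ (M - 1)
        * (u ^ (k * c) * (\<Sum>r=1..<p. of_int (phi r) * u ^ (k * r))))))
     (of_int ((\<Sum>i\<le>M. int (M choose i) * orth n (e + i))
       + int p * (int M * (\<Sum>i<M. \<Sum>r=1..<p. int ((M - 1) choose i) * phi r * orth n (e + (c + i + r))))))"
proof -
  have M1: "{..M - 1} = {..<M}" using M_pos by auto
  have 1: "u ^ (k * e) * (1 + u ^ k) ^ M = (\<Sum>i\<le>M. of_nat (M choose i) * u ^ (k * (e + i)))" for k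
    unfolding one_plus_pow sum_distrib_left by (intro sum.cong refl) (simp add: power_add power_mult distrib_left)
  have 2: "u ^ (k * e) * ((1 + u ^ k) ^ (M - 1) * (u ^ (k * c) * (\<Sum>r=1..<p. of_int (phi r) * u ^ (k * r))))
     = (\<Sum>i<M. \<Sum>r=1..<p. of_nat ((M - 1) choose i) * of_int (phi r) * u ^ (k * (e + (c + i + r))))" for k
  proof -
    have "(1 + u ^ k) ^ (M - 1) * (u ^ (k * c) * (\<Sum>r=1..<p. of_int (phi r) * u ^ (k * r)))
       = (\<Sum>i<M. \<Sum>r=1..<p. (of_nat ((M - 1) choose i) * (u ^ k) ^ i) * (u ^ (k * c) * (of_int (phi r) * u ^ (k * r))))"
      unfolding one_plus_pow M1 sum_distrib_left[of "u ^ (k * c)"] sum_product ..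
    note expand = this
    show ?thesis by (simp only: expand) (simp add: sum_distrib_left power_add distrib_left mult_ac flip: power_mult)
  qed
  have A: "cg 2 (\<Sum>i\<le>M. of_nat (M choose i) * (\<Sum>k<n. u ^ (k * (e + i)))) (\<Sum>i\<le>M. of_nat (M choose i) * of_int (orth n (e + i)))"
    by (rule cg_sum) (rule cg_left[OF orth Or_nat])
  have B: "cg 2 (\<Sum>i<M. \<Sum>r=1..<p. of_nat ((M - 1) choose i) * of_int (phi r) * (\<Sum>k<n. u ^ (k * (e + (c + i + r)))))
     (\<Sum>i<M. \<Sum>r=1..<p. of_nat ((M - 1) choose i) * of_int (phi r) * of_int (orth n (e + (c + i + r))))"
    by (rule cg_sum, rule cg_sum) (rule cg_left[OF orth Or_mult[OF Or_nat Or_int]])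
  have E1: "(\<Sum>k<n. u ^ (k * e) * ((1 + u ^ k) ^ M + of_nat p * (of_nat M * (1 + u ^ k) ^ (M - 1)
        * (u ^ (k * c) * (\<Sum>r=1..<p. of_int (phi r) * u ^ (k * r))))))
     = (\<Sum>k<n. u ^ (k * e) * (1 + u ^ k) ^ M)
      + of_nat p * (of_nat M * (\<Sum>k<n. u ^ (k * e) * ((1 + u ^ k) ^ (M - 1) * (u ^ (k * c) * (\<Sum>r=1..<p. of_int (phi r) * u ^ (k * r))))))"
    unfolding sum_distrib_left sum.distrib[symmetric] by (intro sum.cong refl) (simp add: algebra_simps sum_distrib_left)
  have E2: "(\<Sum>k<n. u ^ (k * e) * (1 + u ^ k) ^ M) = (\<Sum>i\<le>M. of_nat (M choose i) * (\<Sum>k<n. u ^ (k * (e + i))))"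
    unfolding 1 by (subst sum.swap) (simp add: sum_distrib_left)
  have E3: "(\<Sum>k<n. u ^ (k * e) * ((1 + u ^ k) ^ (M - 1) * (u ^ (k * c) * (\<Sum>r=1..<p. of_int (phi r) * u ^ (k * r)))))
     = (\<Sum>i<M. \<Sum>r=1..<p. of_nat ((M - 1) choose i) * of_int (phi r) * (\<Sum>k<n. u ^ (k * (e + (c + i + r)))))"
    unfolding 2 by (subst sum.swap, rule sum.cong[OF refl], subst sum.swap) (simp add: sum_distrib_left)
  have E4: "cg 2 ((\<Sum>i\<le>M. of_nat (M choose i) * (\<Sum>k<n. u ^ (k * (e + i))))
      + of_nat p * (of_nat M * (\<Sum>i<M. \<Sum>r=1..<p. of_nat ((M - 1) choose i) * of_int (phi r) * (\<Sum>k<n. u ^ (k * (e + (c + i + r)))))))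
     ((\<Sum>i\<le>M. of_nat (M choose i) * of_int (orth n (e + i)))
      + of_nat p * (of_nat M * (\<Sum>i<M. \<Sum>r=1..<p. of_nat ((M - 1) choose i) * of_int (phi r) * of_int (orth n (e + (c + i + r))))))"
    by (rule cg_add[OF A cg_left[OF cg_left[OF B Or_nat] Or_nat]])
  show ?thesis unfolding E1 E2 E3 of_int_add of_int_mult of_int_sum of_int_of_nat_eq by (rule E4)
qed

text \<open>The number \<open>n - i0 + x\<close> is positive and below \<open>3 n\<close>, so its
  only possible multiples of \<open>n\<close> are \<open>n\<close> and \<open>2 n\<close>.\<close>

lemma orth_shift: assumes "i0 < n" "x < i0 + 2 * n"
  shows "orth n (n - i0 + x) = (if x = i0 \<or> x = i0 + n then int n else 0)"
proof -
  have "n dvd n - i0 + x \<longleftrightarrow> x = i0 \<or> x = i0 + n"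
  proof
    assume "n dvd n - i0 + x"
    then obtain q where q: "n - i0 + x = n * q" by (elim dvdE)
    have "q < 3"
    proof (rule ccontr)
      assume "\<not> q < 3"
      hence "n * 3 \<le> n * q" by simp
      thus False using q assms by linarith
    qed
    hence "q = 0 \<or> q = 1 \<or> q = 2" by auto
    thus "x = i0 \<or> x = i0 + n" using q assms by auto
  next
    assume "x = i0 \<or> x = i0 + n"
    hence "n - i0 + x = n \<or> n - i0 + x = 2 * n" using assms by auto
    thus "n dvd n - i0 + x" by auto
  qed
  thus ?thesis by (simp add: orth_def)
qed

lemma eval_binom: assumes "i0 \<le> M" "M < n"
  shows "(\<Sum>i\<le>M. int (M choose i) * orth n (n - i0 + i)) = int n * int (M choose i0)"
proof -
  have "(\<Sum>i\<le>M. int (M choose i) * orth n (n - i0 + i)) = (\<Sum>i\<le>M. if i = i0 then int (M choose i0) * int n else 0)"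
    by (intro sum.cong refl, subst orth_shift) (use assms in auto)
  thus ?thesis using assms by simp
qed

text \<open>For fixed \<open>x\<close> at most one \<open>r\<close> contributes. The proposition
  \<open>P\<close> records whether it exists and \<open>s0\<close> is its value; if \<open>P\<close>
  is false, \<open>s0\<close> is arbitrary.\<close>

lemma eval_phi:
  assumes i0: "i0 < n" and P: "P \<Longrightarrow> s0 \<in> {1..<p}" and b: "\<And>r. r \<in> {1..<p} \<Longrightarrow> x + r < i0 + 2 * n"
    and eq: "\<And>r. r \<in> {1..<p} \<Longrightarrow> (x + r = i0 \<or> x + r = i0 + n) \<longleftrightarrow> (P \<and> r = s0)"
  shows "(\<Sum>r=1..<p. int B * phi r * orth n (n - i0 + (x + r))) = (if P then int n * (int B * phi s0) else 0)"
proof -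
  have "(\<Sum>r=1..<p. int B * phi r * orth n (n - i0 + (x + r))) = (\<Sum>r=1..<p. if r = s0 then (if P then int n * (int B * phi s0) else 0) else 0)"
  proof (intro sum.cong refl)
    fix r assume r: "r \<in> {1..<p}"
    show "int B * phi r * orth n (n - i0 + (x + r)) = (if r = s0 then (if P then int n * (int B * phi s0) else 0) else 0)"
      unfolding orth_shift[OF i0 b[OF r]] eq[OF r] by auto
  qed
  also have "\<dots> = (if P then int n * (int B * phi s0) else 0)" using P by (simp add: sum.delta)
  finally show ?thesis .
qed

lemma eval_split: assumes "i0 \<le> M" and n: "n = p - 1"
  shows "(\<Sum>i<M. \<Sum>r=1..<p. int ((M - 1) choose i) * phi r * orth n (n - i0 + (0 + i + r))) = int n * T_split i0"
proof -
  have pM: "p = Suc (2 * M)" "n = 2 * M" using p_eq n by auto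
  have 1: "(\<Sum>r=1..<p. int ((M - 1) choose i) * phi r * orth n (n - i0 + (0 + i + r))) = int n * (int ((M - 1) choose i) * phi (i0 - i))"
    if "i < i0" for i
    by (subst eval_phi[where P = True and ?s0.0 = "i0 - i"]) (use that assms pM M_pos in auto)
  have 2: "(\<Sum>r=1..<p. int ((M - 1) choose i) * phi r * orth n (n - i0 + (0 + i + r))) = int n * (int ((M - 1) choose i) * phi (p - 1 + i0 - i))"
    if "i0 \<le> i" "i < M" for i
    by (subst eval_phi[where P = True and ?s0.0 = "p - 1 + i0 - i"]) (use that assms pM M_pos in auto)
  have U: "{..<M} = {..<i0} \<union> {i0..<M}" using assms by auto
  have e: "sum g ({..<i0} \<union> {i0..<M}) = sum g {..<i0} + sum g {i0..<M}" for g :: "nat \<Rightarrow> int"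
    by (rule sum.union_disjoint) auto
  have "(\<Sum>i<M. \<Sum>r=1..<p. int ((M - 1) choose i) * phi r * orth n (n - i0 + (0 + i + r)))
    = (\<Sum>i<i0. \<Sum>r=1..<p. int ((M - 1) choose i) * phi r * orth n (n - i0 + (0 + i + r)))
     + (\<Sum>i=i0..<M. \<Sum>r=1..<p. int ((M - 1) choose i) * phi r * orth n (n - i0 + (0 + i + r)))"
    unfolding U e ..
  also have "\<dots> = (\<Sum>i<i0. int n * (int ((M - 1) choose i) * phi (i0 - i))) + (\<Sum>i=i0..<M. int n * (int ((M - 1) choose i) * phi (p - 1 + i0 - i)))"
    by (intro arg_cong2[of _ _ _ _ "(+)"] sum.cong refl 1 2) auto
  finally show ?thesis by (simp add: T_split_def sum_distrib_left distrib_left)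
qed

lemma eval_inert: assumes "i0 \<le> M" and n: "n = p + 1"
  shows "(\<Sum>i<M. \<Sum>r=1..<p. int ((M - 1) choose i) * phi r * orth n (n - i0 + (1 + i + r))) = int n * T_inert i0"
proof -
  have pM: "p = Suc (2 * M)" "n = 2 * M + 2" using p_eq n by auto
  let ?g = "\<lambda>i. \<Sum>r=1..<p. int ((M - 1) choose i) * phi r * orth n (n - i0 + (1 + i + r))"
  have 1: "?g i = int n * (int ((M - 1) choose i) * phi (i0 - 1 - i))" if "i < i0 - 1" for i
    by (subst eval_phi[where P = True and ?s0.0 = "i0 - 1 - i"]) (use that assms pM M_pos in auto)
  have 2: "?g i = int n * (int ((M - 1) choose i) * phi (p + i0 - i))" if "Suc i0 \<le> i" "i < M" for i
    by (subst eval_phi[where P = True and ?s0.0 = "p + i0 - i"]) (use that assms pM M_pos in auto)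
  \<comment> \<open>These two indices would require \<open>r = p\<close> and \<open>r = 0\<close>,
    which lie just outside the range of \<open>r\<close>.\<close>
  have 3: "?g i = 0" if "i = i0 \<or> Suc i = i0" "i < M" for i
    by (subst eval_phi[where P = False and ?s0.0 = 1]) (use that assms pM M_pos in auto)
  have "(\<Sum>i<M. ?g i) = (\<Sum>i\<in>{..<i0 - 1} \<union> {Suc i0..<M}. ?g i)"
    by (intro sum.mono_neutral_right ballI 3) (use assms in auto)
  also have "\<dots> = (\<Sum>i<i0 - 1. ?g i) + (\<Sum>i=Suc i0..<M. ?g i)"
    by (rule sum.union_disjoint) auto
  also have "\<dots> = (\<Sum>i<i0 - 1. int n * (int ((M - 1) choose i) * phi (i0 - 1 - i))) + (\<Sum>i=Suc i0..<M. int n * (int ((M - 1) choose i) * phi (p + i0 - i)))"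
    by (intro arg_cong2[of _ _ _ _ "(+)"] sum.cong refl 1 2) auto
  finally show ?thesis by (simp add: T_inert_def sum_distrib_left distrib_left)
qed

lemma eval_X_split:
  assumes u: "u \<in> Or" and orth: "\<And>m. cg 2 (\<Sum>k<p - 1. u ^ (k * m)) (of_int (orth (p - 1) m))" and i0: "i0 \<le> M"
  shows "cg 2 (\<Sum>k<p - 1. u ^ (k * (p - 1 - i0)) * ((1 + u ^ k) ^ M + of_nat p * (of_nat M * (1 + u ^ k) ^ (M - 1)
        * (\<Sum>r=1..<p. of_int (phi r) * u ^ (k * r))))) (of_int (X_split i0))"
proof -
  have M: "M < p - 1" "int (p - 1) = int p - 1" using p_eq M_pos by auto
  have X: "int (p - 1) * int (M choose i0) + int p * (int M * (int (p - 1) * T_split i0)) = X_split i0"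
    unfolding M(2) by (simp add: X_split_def algebra_simps)
  show ?thesis using eval_sum[OF u orth, of "p - 1 - i0" 0]
    unfolding eval_binom[OF i0 M(1)] eval_split[OF i0 refl] X by (simp only: mult_0_right power_0 mult_1)
qed

lemma eval_X_inert:
  assumes u: "u \<in> Or" and orth: "\<And>m. cg 2 (\<Sum>k<p + 1. u ^ (k * m)) (of_int (orth (p + 1) m))" and i0: "i0 \<le> M"
  shows "cg 2 (\<Sum>k<p + 1. u ^ (k * (p + 1 - i0)) * ((1 + u ^ k) ^ M + of_nat p * (of_nat M * (1 + u ^ k) ^ (M - 1)
        * (u ^ k * (\<Sum>r=1..<p. of_int (phi r) * u ^ (k * r)))))) (of_int (X_inert i0))"
proof -
  have M: "M < p + 1" using p_eq by auto
  have X: "int (p + 1) * int (M choose i0) + int p * (int M * (int (p + 1) * T_inert i0)) = X_inert i0"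
    by (simp add: X_inert_def algebra_simps)
  show ?thesis using eval_sum[OF u orth, of "p + 1 - i0" 1]
    unfolding eval_binom[OF i0 M] eval_inert[OF i0 refl] X by (simp only: mult_1_right)
qed

text \<open>A geometric series. Cancelling modulo \<open>p^2\<close> requires
  \<open>u ^ m - 1\<close> to be a unit; being nonzero modulo \<open>p^2\<close> would not
  suffice.\<close>

lemma orthogonality:
  assumes u: "u \<in> Or" "cg 2 (u ^ n) 1" and un: "\<And>m. \<not> n dvd m \<Longrightarrow> un 2 (u ^ m - 1)"
  shows "cg 2 (\<Sum>k<n. u ^ (k * m)) (of_int (orth n m))"
proof (cases "n dvd m")
  case True
  then obtain q where q: "m = n * q" by auto
  have "cg 2 (\<Sum>k<n. u ^ (k * m)) (\<Sum>k<n. 1)"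
  proof (rule cg_sum)
    fix k
    have "cg 2 ((u ^ n) ^ (k * q)) (1 ^ (k * q))" by (rule cg_power[OF u(2)])
    thus "cg 2 (u ^ (k * m)) 1" by (simp add: q mult_ac flip: power_mult)
  qed
  thus ?thesis using True by (simp add: orth_def)
next
  case False
  have "(u ^ m - 1) * (\<Sum>k<n. u ^ (k * m)) = (u ^ n) ^ m - 1"
    using power_diff_1_eq[of "u ^ m" n] by (simp add: mult.commute flip: power_mult)
  moreover have "cg 2 ((u ^ n) ^ m - 1) (1 ^ m - 1)" by (intro cg_diff cg_power u cg_refl Or_1)
  ultimately have "cg 2 ((u ^ m - 1) * (\<Sum>k<n. u ^ (k * m))) ((u ^ m - 1) * 0)" by simp
  from un_cancel[OF un[OF False] this] show ?thesis
    using False u by (auto simp: orth_def intro!: Or_intros)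
qed

text \<open>From \<open>g^(m/2) = -1\<close> one gets \<open>h^2 = - g^(m/2 - 2)\<close>. For
  \<open>m = 8\<close> the squares then cancel. For \<open>m = 6\<close> and \<open>m = 12\<close>
  the factor \<open>g + 1\<close> or \<open>g^2 + 1\<close> of \<open>g^(m/2) + 1\<close> is a unit,
  so the cyclotomic value \<open>g^2 - g + 1\<close> or \<open>g^4 - g^2 + 1\<close>
  vanishes.\<close>

lemma root_of_unity:
  assumes g: "g \<in> Or" "cg 2 (g ^ m) 1" and un: "\<And>j. \<not> m dvd j \<Longrightarrow> un 2 (g ^ j - 1)"
    and md: "(m, d) \<in> {(6, 3), (8, 2), (12, 1)}" and h: "h \<in> Or" "cg 2 (g * h) 1"
  shows "cg 2 (g ^ (m div 2)) (- 1)" "cg 2 ((h - g)\<^sup>2) (- of_int d)"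
proof -
  have m: "m = m div 2 + m div 2" "\<not> m dvd m div 2" using md by auto
  have "(g ^ (m div 2) - 1) * (g ^ (m div 2) + 1) = g ^ m - 1" by (subst (3) m(1)) (simp add: power_add algebra_simps)
  moreover have "cg 2 (g ^ m - 1) (1 - 1)" by (intro cg_diff g cg_refl Or_1)
  ultimately have "cg 2 ((g ^ (m div 2) - 1) * (g ^ (m div 2) + 1)) ((g ^ (m div 2) - 1) * 0)" by simp
  from un_cancel[OF un[OF m(2)] this] have "cg 2 (g ^ (m div 2) + 1) 0" using g by (auto intro!: Or_intros)
  from cg_diff[OF this cg_refl[OF Or_1]] show half: "cg 2 (g ^ (m div 2)) (- 1)" by simp
  have h2: "cg 2 ((h - g)\<^sup>2) (h ^ 2 + g ^ 2 - 2)"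
  proof -
    have "(h - g)\<^sup>2 = h ^ 2 + g ^ 2 - (g * h + g * h)" by (simp add: power2_eq_square algebra_simps)
    also have "cg 2 \<dots> (h ^ 2 + g ^ 2 - (1 + 1))" by (intro cg_diff cg_add h cg_refl Or_intros g)
    finally show ?thesis by simp
  qed
  have hg: "cg 2 (h ^ 2 * g ^ 2) 1"
    using cg_power[OF h(2), of 2] by (simp add: power_mult_distrib mult.commute)
  have neg: "cg 2 (h ^ 2) (- (g ^ (m div 2 - 2)))"
  proof -
    have e: "m div 2 = 2 + (m div 2 - 2)" using md by auto
    have "cg 2 (h ^ 2) (- (h ^ 2 * (- 1)))" using h by (auto intro!: cg_refl Or_intros)
    also have "cg 2 \<dots> (- (h ^ 2 * g ^ (m div 2)))" by (intro cg_uminus cg_left cg_sym[OF half] Or_intros h)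
    also have "h ^ 2 * g ^ (m div 2) = h ^ 2 * g ^ 2 * g ^ (m div 2 - 2)" by (subst e) (simp only: power_add mult.assoc)
    also have "cg 2 (- (h ^ 2 * g ^ 2 * g ^ (m div 2 - 2))) (- (1 * g ^ (m div 2 - 2)))"
      by (intro cg_uminus cg_right hg Or_intros g)
    finally show ?thesis by simp
  qed
  have h3: "cg 2 ((h - g)\<^sup>2) (- (g ^ (m div 2 - 2)) + g ^ 2 - 2)"
    using cg_trans[OF h2 cg_diff[OF cg_add[OF neg cg_refl] cg_refl]] g Or_power Or_int[of 2] by simp
  from md consider "m = 8" "d = 2" | "m = 6" "d = 3" | "m = 12" "d = 1" by auto
  thus "cg 2 ((h - g)\<^sup>2) (- of_int d)"
  proof cases
    case 1
    thus ?thesis using h3 by simp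
  next
    case 2
    have "(g + 1) * (g ^ 2 - g + 1) = g ^ 3 + 1" by (simp add: power2_eq_square power3_eq_cube algebra_simps)
    hence hc: "cg 2 ((g + 1) * (g ^ 2 - g + 1)) ((g + 1) * 0)"
      using cg_add[OF half cg_refl[OF Or_1]] 2 by simp
    have "un 2 ((g + 1) * (g - 1))" using un[of 2] 2 by (simp add: power2_eq_square algebra_simps)
    hence hu: "un 2 (g + 1)" by (rule un_dvd) (intro Or_intros g)+
    have "g ^ 2 - g + 1 \<in> Or" by (intro Or_intros g)
    from un_cancel[OF hu hc this Or_0] have "cg 2 (g ^ 2 - g + 1) 0" .
    from cg_diff[OF this cg_refl[OF Or_int[of 3]]] have "cg 2 (- (g ^ (m div 2 - 2)) + g ^ 2 - 2) (- 3)"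
      using 2 by (simp add: algebra_simps)
    thus ?thesis using cg_trans[OF h3] 2 by simp
  next
    case 3
    have "(g ^ 2 + 1) * (g ^ 4 - g ^ 2 + 1) = g ^ 6 + 1" by (simp add: algebra_simps flip: power_add)
    hence hc: "cg 2 ((g ^ 2 + 1) * (g ^ 4 - g ^ 2 + 1)) ((g ^ 2 + 1) * 0)"
      using cg_add[OF half cg_refl[OF Or_1]] 3 by simp
    have "un 2 ((g ^ 2 + 1) * (g ^ 2 - 1))" using un[of 4] 3 by (simp add: algebra_simps flip: power_add)
    hence hu: "un 2 (g ^ 2 + 1)" by (rule un_dvd) (intro Or_intros g)+
    have "g ^ 4 - g ^ 2 + 1 \<in> Or" by (intro Or_intros g)
    from un_cancel[OF hu hc this Or_0] have "cg 2 (g ^ 4 - g ^ 2 + 1) 0" .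
    from cg_diff[OF cg_uminus[OF this] cg_refl[OF Or_1]] have "cg 2 (- (g ^ (m div 2 - 2)) + g ^ 2 - 2) (- 1)"
      using 3 by (simp add: algebra_simps)
    thus ?thesis using cg_trans[OF h3] 3 by simp
  qed
qed

end

section \<open>The split case\<close>

text \<open>For \<open>z = exp (2 pi i / m)\<close> the difference \<open>z - 1/z\<close> is
  \<open>2 i sin (2 pi / m)\<close>, and \<open>4 sin^2\<close> takes the values 3, 2, 1 at 60, 45
  and 30 degrees.\<close>

lemma complex_root_exists:
  assumes "(m, d) \<in> {(6, 3), (8, 2), (12, 1 :: int)}"
  obtains z :: complex where "z \<noteq> 0" "z ^ (m div 2) = - 1" "(z - 1 / z)\<^sup>2 = - of_int d" "z\<^sup>2 \<noteq> 1"
proof -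
  define z where "z = cis (pi / real (m div 2))"
  have z: "z \<noteq> 0" by (simp add: z_def)
  have zm: "z ^ (m div 2) = - 1" using assms by (auto simp: z_def DeMoivre)
  have "1 / z = cis (- (pi / real (m div 2)))" by (simp add: z_def divide_inverse)
  hence "z - 1 / z = complex_of_real (2 * sin (pi / real (m div 2))) * \<i>"
    unfolding z_def by (simp add: complex_eq_iff)
  hence "(z - 1 / z)\<^sup>2 = - complex_of_real ((2 * sin (pi / real (m div 2)))\<^sup>2)"
    by (simp add: power_mult_distrib)
  also have "(2 * sin (pi / real (m div 2)))\<^sup>2 = real_of_int d"
    using assms by (auto simp: sin_60 sin_45 sin_30 power_mult_distrib power_divide)
  finally have s: "(z - 1 / z)\<^sup>2 = - of_int d" by simp
  have "z\<^sup>2 \<noteq> 1"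
  proof
    assume "z\<^sup>2 = 1"
    hence "z = 1 / z" using z by (simp add: field_simps power2_eq_square)
    hence "(z - 1 / z)\<^sup>2 = 0" by simp
    thus False using s assms by auto
  qed
  thus ?thesis using that z zm s by blast
qed

section \<open>Parity of the trace A\<close>

lemma lucas_3_period: "lucas 3 (k + 6) = lucas 3 k"
  by (induction k rule: induct_nat_012) (simp_all add: eval_nat_numeral)

lemma lucas_1_shift: "lucas 1 (k + 6) = (- fst (lucas 1 k), - snd (lucas 1 k))"
  by (induction k rule: induct_nat_012) (simp_all add: eval_nat_numeral)

text \<open>The first components repeat 2, 0, -1, 0, -1, 0.\<close>

lemma lucas_3_odd_iff: "odd (fst (lucas 3 k)) \<longleftrightarrow> even k \<and> \<not> 3 dvd k"
proof (induction k rule: less_induct)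
  case (less k)
  show ?case
  proof (cases "k < 6")
    case True
    hence "k = 0 \<or> k = 1 \<or> k = 2 \<or> k = 3 \<or> k = 4 \<or> k = 5" by auto
    thus ?thesis by (elim disjE) (simp_all add: eval_nat_numeral, presburger+)
  next
    case False
    hence "k = (k - 6) + 6" by simp
    hence "lucas 3 k = lucas 3 (k - 6)" using lucas_3_period by metis
    thus ?thesis using less[of "k - 6"] False by simp presburger
  qed
qed

lemma lucas_1_mult: "fst (lucas 1 (6 * b + c)) = (-1) ^ b * fst (lucas 1 c)"
proof (induction b)
  case (Suc b)
  have "6 * Suc b + c = (6 * b + c) + 6" by simp
  thus ?case using lucas_1_shift[of "6 * b + c"] Suc by (simp only: fst_conv power_Suc)
qed simp

lemma lucas_1_small: "lucas 1 1 = (0, 1)" "lucas 1 2 = (1, 0)" "lucas 1 3 = (0, 2)" "lucas 1 4 = (- 1, 0)" "lucas 1 5 = (0, 1)"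
  by (simp_all add: eval_nat_numeral)

lemma less_6_cases: "(k::nat) < 6 \<Longrightarrow> k = 0 \<or> k = 1 \<or> k = 2 \<or> k = 3 \<or> k = 4 \<or> k = 5" by auto

lemma lucas_1_odd_iff: "odd (fst (lucas 1 k)) \<longleftrightarrow> even k \<and> \<not> 3 dvd k"
proof -
  define b c where "b = k div 6" and "c = k mod 6"
  have k: "k = 6 * b + c" "c < 6" by (simp_all add: b_def c_def)
  have "odd (fst (lucas 1 c)) \<longleftrightarrow> even c \<and> \<not> 3 dvd c"
    using less_6_cases[OF k(2)] by (elim disjE) (simp_all add: lucas_1_small)
  moreover have "even k \<longleftrightarrow> even c" "3 dvd k \<longleftrightarrow> 3 dvd c" unfolding k(1) by presburger+
  ultimately show ?thesis unfolding k(1) lucas_1_mult by simp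
qed

lemma lucas_1_odd: assumes "odd k" shows "fst (lucas 1 k) = 0"
proof -
  define b c where "b = k div 6" and "c = k mod 6"
  have k: "k = 6 * b + c" "c < 6" by (simp_all add: b_def c_def)
  have "odd c" using assms k(1) by simp
  hence "fst (lucas 1 c) = 0"
    using less_6_cases[OF k(2)] by (elim disjE) (simp_all add: lucas_1_small)
  thus ?thesis unfolding k(1) lucas_1_mult by simp
qed

text \<open>For even \<open>k\<close> the first component is \<open>2 cos (pi k / 6)\<close>, and
  \<open>k\<close> to \<open>6 j - k\<close> replaces the angle by \<open>pi j\<close> minus
  itself.\<close>

lemma lucas_1_reflect: assumes "even k" "k \<le> 6 * j" shows "fst (lucas 1 (6 * j - k)) = (-1) ^ j * fst (lucas 1 k)"
proof -
  define b c where "b = k div 6" and "c = k mod 6"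
  have k: "k = 6 * b + c" "c < 6" by (simp_all add: b_def c_def)
  have s: "(-1) ^ b * (-1) ^ b = (1 :: int)" by (simp flip: power_mult_distrib)
  have "even c" using assms(1) k(1) by simp
  hence "c = 0 \<or> c = 2 \<or> c = 4" using less_6_cases[OF k(2)] by auto
  thus ?thesis
  proof
    assume c: "c = 0"
    hence "b \<le> j" using assms(2) k(1) by simp
    then obtain i where i: "j = b + i" using le_Suc_ex by blast
    have "fst (lucas 1 (6 * i + 0)) = (-1) ^ i * 2" by (subst lucas_1_mult) simp
    moreover have "fst (lucas 1 (6 * b + 0)) = (-1) ^ b * 2" by (subst lucas_1_mult) simp
    ultimately show ?thesis using c k(1) i s by (simp add: power_add)
  next
    assume c: "c = 2 \<or> c = 4"
    hence "b < j" using assms(2) k(1) by auto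
    then obtain i where i: "j = Suc (b + i)" using less_imp_Suc_add by blast
    have "fst (lucas 1 (6 * i + (6 - c))) = (-1) ^ i * fst (lucas 1 (6 - c))" by (rule lucas_1_mult)
    moreover have "fst (lucas 1 (6 - c)) = - fst (lucas 1 c)" using c by (auto simp: lucas_1_small)
    moreover have "6 * j - k = 6 * i + (6 - c)" using i k by simp
    ultimately show ?thesis using k(1) i s lucas_1_mult[of b c] by (simp add: power_add)
  qed
qed

lemma sum_symmetric:
  fixes F :: "nat \<Rightarrow> int"
  assumes "\<And>k. k \<le> 2 * h \<Longrightarrow> F (2 * h - k) = F k" "h > 0"
  shows "(\<Sum>k<2 * h. F k) = F 0 + F h + 2 * (\<Sum>k=1..<h. F k)"
proof -
  have "{..<2 * h} = {0, h} \<union> ({1..<h} \<union> {h + 1..<2 * h})" using assms(2) by auto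
  moreover have "sum F ({0, h} \<union> ({1..<h} \<union> {h + 1..<2 * h})) = sum F {0, h} + (sum F {1..<h} + sum F {h + 1..<2 * h})"
    by (subst sum.union_disjoint; auto)+
  moreover have "sum F {h + 1..<2 * h} = sum F {1..<h}"
    by (rule sum.reindex_bij_witness[of _ "\<lambda>k. 2 * h - k" "\<lambda>k. 2 * h - k"]) (auto simp: assms(1))
  ultimately show ?thesis using assms(2) by simp
qed

lemma even_sum_iff_card:
  fixes F :: "'a \<Rightarrow> int"
  assumes "finite A" shows "even (\<Sum>k\<in>A. F k) \<longleftrightarrow> even (card {k \<in> A. odd (F k)})"
  using assms
proof (induction A rule: finite_induct)
  case (insert x A)
  have "{k \<in> insert x A. odd (F k)} = (if odd (F x) then insert x {k \<in> A. odd (F k)} else {k \<in> A. odd (F k)})" by auto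
  thus ?case using insert by simp
qed simp

lemma card_2_4_mod_6: "card {k. k < 6 * q \<and> even k \<and> \<not> 3 dvd k} = 2 * q"
proof (induction q)
  case (Suc q)
  have "{k. k < 6 * Suc q \<and> even k \<and> \<not> 3 dvd k} = insert (6 * q + 4) (insert (6 * q + 2) {k. k < 6 * q \<and> even k \<and> \<not> 3 dvd k})"
    by auto presburger+
  thus ?case using Suc by simp
qed simp

text \<open>The one index at which \<open>e\<close> may be even is \<open>3 q\<close>, where the
  Lucas component is even anyway. This leaves exactly \<open>2 q\<close> odd terms.\<close>

lemma even_trace_3:
  fixes e :: "nat \<Rightarrow> int"
  assumes e: "\<And>k. k < 6 * q \<Longrightarrow> k \<noteq> 3 * q \<Longrightarrow> odd (e k)"
  shows "even (\<Sum>k<6 * q. fst (lucas 3 k) * e k)"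
proof -
  have "{k \<in> {..<6 * q}. odd (fst (lucas 3 k) * e k)} = {k. k < 6 * q \<and> even k \<and> \<not> 3 dvd k}"
    using e by (auto simp: lucas_3_odd_iff) (metis dvd_triv_left)
  thus ?thesis by (simp only: even_sum_iff_card[OF finite_lessThan] card_2_4_mod_6) simp
qed

text \<open>The parity of the number of \<open>k < 3 j\<close> congruent to 2 or 4 modulo 6 is that of \<open>j\<close>.\<close>

lemma trace_1_mod_4:
  fixes e :: "nat \<Rightarrow> int"
  assumes rfl: "\<And>k. k \<le> 6 * j \<Longrightarrow> e (6 * j - k) = (-1) ^ j * (-1) ^ k * e k"
    and odd: "\<And>k. k < 6 * j \<Longrightarrow> k \<noteq> 3 * j \<Longrightarrow> odd (e k)" and zero: "e (3 * j) = 0" and j: "j > 0"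
  shows "[(\<Sum>k<6 * j. fst (lucas 1 k) * e k) = (if even j then 2 else 0)] (mod 4)"
proof -
  let ?F = "\<lambda>k. fst (lucas 1 k) * e k"
  have sym: "?F (2 * (3 * j) - k) = ?F k" if k: "k \<le> 2 * (3 * j)" for k
  proof (cases "even k")
    case True
    have "fst (lucas 1 (6 * j - k)) = (-1) ^ j * fst (lucas 1 k)" using True k by (intro lucas_1_reflect) auto
    moreover have "(-1) ^ j * (-1) ^ j = (1 :: int)" by (simp flip: power_mult_distrib)
    ultimately show ?thesis using rfl[of k] k True by simp
  next
    case False
    moreover from this k have "odd (6 * j - k)" by auto
    ultimately show ?thesis by (simp add: lucas_1_odd)
  qed
  \<comment> \<open>Pairing \<open>k\<close> with \<open>6 j - k\<close> reduces the value modulo 4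
    to the parity of the half sum, \<open>e 0\<close> being odd.\<close>
  have S: "(\<Sum>k<6 * j. ?F k) = 2 * e 0 + 2 * (\<Sum>k=1..<3 * j. ?F k)"
    using sum_symmetric[of "3 * j" ?F, OF sym] j zero by simp
  have "{k \<in> {1..<3 * j}. odd (?F k)} = {k \<in> {1..<3 * j}. even k \<and> \<not> 3 dvd k}"
  proof (intro Collect_cong conj_cong refl)
    fix k assume "k \<in> {1..<3 * j}"
    hence "odd (e k)" using odd by simp
    moreover note lucas_1_odd_iff[of k]
    ultimately show "odd (?F k) \<longleftrightarrow> even k \<and> \<not> 3 dvd k" by simp
  qed
  hence P: "even (\<Sum>k=1..<3 * j. ?F k) \<longleftrightarrow> even (card {k \<in> {1..<3 * j}. even k \<and> \<not> 3 dvd k})"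
    by (simp add: even_sum_iff_card)
  have C: "even (card {k \<in> {1..<3 * j}. even k \<and> \<not> 3 dvd k}) \<longleftrightarrow> even j"
  proof (cases "even j")
    case True
    then obtain i where i: "j = 2 * i" by auto
    have "{k \<in> {1..<3 * j}. even k \<and> \<not> 3 dvd k} = {k. k < 6 * i \<and> even k \<and> \<not> 3 dvd k}"
      unfolding i by (auto intro!: Suc_leI gr0I)
    thus ?thesis using True by (simp add: card_2_4_mod_6)
  next
    case False
    then obtain i where i: "j = 2 * i + 1" by (elim oddE)
    have "{k \<in> {1..<3 * j}. even k \<and> \<not> 3 dvd k} = insert (6 * i + 2) {k. k < 6 * i \<and> even k \<and> \<not> 3 dvd k}"
      unfolding i by (auto intro!: Suc_leI gr0I) presburger+
    thus ?thesis using False by (simp add: card_2_4_mod_6)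
  qed
  have "odd (e 0)" using odd[of 0] j by simp
  thus ?thesis unfolding S using P C by (cases "even j") (simp_all add: cong_def, presburger+)
qed

section \<open>Lifting Legendre symbols, and the combined trace identity\<close>

context prime_order
begin

text \<open>Euler's criterion modulo \<open>p\<close> is raised to the \<open>p\<close>-th power;
  the symbol is its own \<open>p\<close>-th power because \<open>p\<close> is odd.\<close>

lemma L_lift: "cg 2 (of_int (L a)) (of_int a ^ (p * M))"
proof -
  have "[L a = a ^ M] (mod int p ^ 1)" using L_euler by simp
  hence "cg 1 (of_int (L a)) (of_int (a ^ M))" unfolding cg_of_int .
  from cg_pow_p[OF this] have "cg 2 (of_int (L a ^ p)) (of_int a ^ (p * M))"
    by (simp add: mult.commute flip: power_mult)
  moreover have "L a ^ p = L a" using L_values[of a] p_odd p_gt by (auto simp: power_0_left)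
  ultimately show ?thesis by simp
qed

end

context odd_prime
begin

lemma prime_order_Ints: "prime_order p M (range of_int)"
proof (unfold_locales)
  fix x :: complex and m k assume x: "x \<in> range of_int" "of_int m = of_nat p ^ k * x"
  then obtain y where "x = of_int y" by auto
  hence "(of_int m :: complex) = of_int (int p ^ k * y)" using x by simp
  hence "m = int p ^ k * y" by (simp only: of_int_eq_iff)
  thus "int p ^ k dvd m" by simp
qed (auto intro: range_eqI[of _ of_int "a + b" for a b] simp flip: of_int_add of_int_mult of_int_minus intro!: rangeI[of _ 1, simplified])

end

context prime_order
begin

text \<open>The complex root \<open>z\<close> yields the norm equation, and the root
  \<open>h\<close> modulo \<open>p^2\<close> the congruence for the same \<open>A\<close>. The
  partner of \<open>h\<close> with product -1 is \<open>- g\<close>. The conditions on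
  \<open>r\<close> give \<open>z ^ n = c\<close> and, modulo \<open>p^2\<close>,
  \<open>g ^ n = c\<close>.\<close>

lemma trace_identity:
  fixes e :: "nat \<Rightarrow> int"
  assumes md: "(m, d) \<in> {(6, 3), (8, 2), (12, 1)}" and n: "even n" "n > 0" and c: "c = 1 \<or> c = - 1"
    and per: "\<And>k. e (k + n) = c * e k"
    and rfl: "\<And>k. k \<le> n \<Longrightarrow> e (n - k) = c * (-1) ^ k * e k"
    and corr: "\<And>j. j < n \<Longrightarrow> (\<Sum>k<n. e k * e (k + j)) = (if j = 0 then int p else 0) - t * (1 + (-1) ^ j)"
    and t: "t \<noteq> 0 \<Longrightarrow> c = 1" and nm: "n = (m div 2) * r" "c = (- 1) ^ r"
    and g: "g \<in> Or" "cg 2 (g ^ m) 1" and un: "\<And>j. \<not> m dvd j \<Longrightarrow> un 2 (g ^ j - 1)"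
    and h: "h \<in> Or" "cg 2 (g * h) 1" and X: "cg 2 (\<Sum>k<n. of_int (e k) * h ^ k) (of_int X)"
  shows "(\<Sum>k<n. fst (lucas d k) * e k)\<^sup>2 + d * (\<Sum>k<n. snd (lucas d k) * e k)\<^sup>2 = 4 * int p"
    "[X\<^sup>2 + int p = (\<Sum>k<n. fst (lucas d k) * e k) * X] (mod int p ^ 2)"
proof -
  obtain z :: complex where z: "z \<noteq> 0" "z ^ (m div 2) = - 1" "(z - 1 / z)\<^sup>2 = - of_int d" "z\<^sup>2 \<noteq> 1"
    using complex_root_exists[OF md] by blast
  have zn: "z ^ n = of_int c" unfolding nm by (simp add: power_mult z(2))
  show norm: "(\<Sum>k<n. fst (lucas d k) * e k)\<^sup>2 + d * (\<Sum>k<n. snd (lucas d k) * e k)\<^sup>2 = 4 * int p"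
    by (rule quasi_periodic_norm[where e = e, OF n(1) c per rfl corr z(1) zn z(3) _ n(2)]) (use t z(4) in auto)
  note R = root_of_unity[OF g un md h]
  have gn: "cg 2 (g ^ n) (of_int c)" unfolding nm using cg_power[OF R(1), of r] by (simp add: power_mult)
  have cc: "(of_int c :: complex) * of_int c = 1" using c by auto
  have "cg 2 (h ^ n) (h ^ n * (of_int c * of_int c))" unfolding cc using h by (simp add: cg_refl Or_power)
  also have "cg 2 \<dots> (h ^ n * (g ^ n * of_int c))" by (intro cg_left cg_right cg_sym[OF gn] Or_intros h)
  also have "h ^ n * (g ^ n * of_int c) = (g * h) ^ n * of_int c" by (simp add: power_mult_distrib mult_ac)
  also have "cg 2 \<dots> (1 ^ n * of_int c)" by (intro cg_right cg_power h Or_int)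
  finally have hn: "cg 2 (h ^ n) (of_int c)" by simp
  have gh: "cg 2 (h * (- g)) (- 1)" using cg_uminus[OF h(2)] by (simp add: mult.commute)
  have "cg 2 ((h + (- g))\<^sup>2) (- of_int d)" using R(2) by simp
  from quasi_periodic_cong[where e = e, OF c per rfl h(1) Or_uminus[OF g(1)] gh this hn X norm n(2)]
  show "[X\<^sup>2 + int p = (\<Sum>k<n. fst (lucas d k) * e k) * X] (mod int p ^ 2)" .
qed

end

context odd_prime
begin

lemma L_sq: "L a \<noteq> 0 \<Longrightarrow> L a * L a = 1" using L_values[of a] by auto

text \<open>The \<open>p\<close>-th power of a primitive root keeps its residue modulo
  \<open>p\<close> and is a root of unity modulo \<open>p^2\<close>.\<close>

lemma primitive_root_exists:
  obtains w :: int where "[w ^ (p - 1) = 1] (mod int p ^ 2)" "\<And>j. [w ^ j = 1] (mod int p) \<longleftrightarrow> (p - 1) dvd j"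
    "\<not> int p dvd w"
proof -
  obtain g where g: "residue_primroot p g" using prime_primitive_root_exists[of p] p_prime p_gt by auto
  have cop: "coprime p g" and o: "ord p g = p - 1"
    using g p_prime by (auto simp: residue_primroot_def totient_prime)
  have ndvd: "\<not> p dvd g" using coprime_common_divisor_nat[OF cop dvd_refl] p_gt by auto
  have f: "[g ^ (p - 1) = 1] (mod p)" using fermat_theorem[OF p_prime ndvd] .
  have ord: "[g ^ j = 1] (mod p) \<longleftrightarrow> (p - 1) dvd j" for j using ord_divides[of g j p] o by simp
  interpret Z: prime_order p M "range of_int" by (rule prime_order_Ints)
  have "[int g ^ (p - 1) = 1] (mod int p)" using f by (metis cong_int_iff of_nat_1 of_nat_power)
  hence "Z.cg 1 (of_int (int g ^ (p - 1))) (of_int 1)" unfolding Z.cg_of_int by simp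
  from Z.cg_pow_p[OF this] have "Z.cg 2 (of_int ((int g ^ p) ^ (p - 1))) (of_int 1)"
    by (simp add: mult.commute flip: power_mult)
  hence 1: "[(int g ^ p) ^ (p - 1) = 1] (mod int p ^ 2)" unfolding Z.cg_of_int .
  have gp: "[int g ^ p = int g] (mod int p)"
  proof -
    have "[int g * int g ^ (p - 1) = int g * 1] (mod int p)"
      using f by (intro cong_mult cong_refl) (metis cong_int_iff of_nat_1 of_nat_power)
    moreover have "int g * int g ^ (p - 1) = int g ^ p" using p_gt by (simp flip: power_Suc)
    ultimately show ?thesis by simp
  qed
  have 2: "[(int g ^ p) ^ j = 1] (mod int p) \<longleftrightarrow> (p - 1) dvd j" for j
  proof -
    have "[(int g ^ p) ^ j = 1] (mod int p) \<longleftrightarrow> [int g ^ j = 1] (mod int p)"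
      using cong_pow[OF gp, of j] cong_trans cong_sym by blast
    also have "\<dots> \<longleftrightarrow> [g ^ j = 1] (mod p)" by (metis cong_int_iff of_nat_1 of_nat_power)
    finally show ?thesis using ord by simp
  qed
  have 3: "\<not> int p dvd int g ^ p" using ndvd pint by (metis int_dvd_int_iff prime_dvd_power)
  show ?thesis by (rule that[OF 1 2 3])
qed

lemma trace_split:
  assumes md: "(m, d) \<in> {(6, 3), (8, 2), (12, 1)}" and mp: "m dvd p - 1"
  obtains A B where "A\<^sup>2 + d * B\<^sup>2 = 4 * int p" "[(X_split ((p - 1) div m))\<^sup>2 + int p = A * X_split ((p - 1) div m)] (mod int p ^ 2)"
    "d = 3 \<Longrightarrow> even A" "d = 1 \<Longrightarrow> [A = 2] (mod 4)"
proof -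
  interpret Z: prime_order p M "range of_int" by (rule prime_order_Ints)
  obtain w :: int where w: "[w ^ (p - 1) = 1] (mod int p ^ 2)" "\<And>j. [w ^ j = 1] (mod int p) \<longleftrightarrow> (p - 1) dvd j"
    "\<not> int p dvd w" by (rule primitive_root_exists) blast
  let ?n = "p - 1"
  obtain q where q: "?n = m * q" using mp by auto
  have m0: "m > 0" "even m" using md by auto
  have q0: "q > 0" using q p_gt by (cases q) auto
  have nM: "?n = 2 * M" using p_eq by simp
  have w1: "[w ^ ?n = 1] (mod int p)" using w(2) by simp
  have wk: "\<not> int p dvd w ^ k" for k using w(3) pint prime_dvd_power by blast
  have wj: "\<not> int p dvd w ^ j - 1" if "\<not> ?n dvd j" for j using w(2)[of j] that by (simp add: cong_iff_dvd_diff)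
  have un1: "Z.un 1 (of_int a)" if "\<not> int p dvd a" for a
  proof -
    have "coprime a (int p)" using that pint by (metis coprime_commute prime_imp_coprime)
    then obtain b where "[a * b = 1] (mod int p)" using cong_solve_coprime_int by blast
    hence "Z.cg 1 (of_int (a * b)) (of_int 1)" unfolding Z.cg_of_int by simp
    thus ?thesis unfolding Z.un_def by auto
  qed
  define W :: complex where "W = of_int w"
  have W: "W \<in> range of_int" by (simp add: W_def)
  have Wn: "Z.cg 2 (W ^ ?n) 1" using w(1) Z.cg_of_int[of 2 "w ^ ?n" 1] by (simp add: W_def)
  have unW: "Z.un 2 (W ^ j - 1)" if "\<not> ?n dvd j" for j
    using Z.un_lift[OF un1[OF wj[OF that]]] by (simp add: W_def)
  define e where "e k = L (1 + w ^ k)" for k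
  have Lw: "L w = - 1"
  proof -
    have "\<not> [w ^ M = 1] (mod int p)" using w(2)[of M] nM M_pos by (auto dest: dvd_imp_le)
    hence "L w \<noteq> 1" using L_euler[of w] by (metis cong_sym)
    thus ?thesis using L_values[of w] L_0_iff[of w] w(3) by auto
  qed
  have Lwk: "L (w ^ k) = (-1) ^ k" for k by (simp add: L_power Lw)
  have per: "e (k + ?n) = 1 * e k" for k
    unfolding e_def mult_1
  proof (rule L_cong)
    have "[1 + w ^ k * w ^ ?n = 1 + w ^ k * 1] (mod int p)" by (intro cong_add cong_mult cong_refl w1)
    thus "[1 + w ^ (k + ?n) = 1 + w ^ k] (mod int p)" by (simp add: power_add)
  qed
  have rfl: "e (?n - k) = 1 * (-1) ^ k * e k" if k: "k \<le> ?n" for k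
  proof -
    have "w ^ k * w ^ (?n - k) = w ^ ?n" using power_add[of w k "?n - k"] k by (simp only: le_add_diff_inverse)
    hence "w ^ k * (1 + w ^ (?n - k)) = w ^ k + w ^ ?n" by (simp only: distrib_left mult_1_right)
    moreover have "[w ^ k + w ^ ?n = w ^ k + 1] (mod int p)" by (intro cong_add cong_refl w1)
    ultimately have "L (w ^ k * (1 + w ^ (?n - k))) = L (1 + w ^ k)" using L_cong by (metis add.commute)
    hence "(-1) ^ k * e (?n - k) = e k" by (simp add: L_mult Lwk e_def)
    moreover have "(-1) ^ k * ((-1) ^ k * e (?n - k)) = e (?n - k)" by (simp add: mult.assoc[symmetric] flip: power_mult_distrib)
    ultimately show ?thesis by simp
  qed
  have wM: "[w ^ M = - 1] (mod int p)" using L_euler[of w] Lw by (simp add: cong_sym)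
  have e0: "e k = 0 \<longleftrightarrow> k = M" if k: "k < ?n" for k
  proof -
    have "e k = 0 \<longleftrightarrow> int p dvd w ^ M * (1 + w ^ k)"
      using wk[of M] pint by (simp add: e_def L_0_iff prime_dvd_mult_iff)
    also have "\<dots> \<longleftrightarrow> [w ^ M + w ^ (M + k) = 0] (mod int p)" by (simp add: cong_0_iff distrib_left power_add)
    also have "\<dots> \<longleftrightarrow> [- 1 + w ^ (M + k) = 0] (mod int p)"
      using cong_add[OF wM cong_refl[of "w ^ (M + k)"]] cong_trans cong_sym by blast
    also have "\<dots> \<longleftrightarrow> [w ^ (M + k) = 1] (mod int p)" by (simp add: cong_0_iff cong_iff_dvd_diff)
    also have "\<dots> \<longleftrightarrow> ?n dvd M + k" by (rule w(2))
    also have "\<dots> \<longleftrightarrow> k = M" 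
    proof
      assume "?n dvd M + k"
      then obtain r where r: "M + k = 2 * M * r" unfolding nM by (elim dvdE)
      have "r < 2"
      proof (rule ccontr)
        assume "\<not> r < 2"
        hence "2 * M * 2 \<le> 2 * M * r" by simp
        thus False using r k nM by linarith
      qed
      moreover have "r \<noteq> 0" using r M_pos by (cases r) auto
      ultimately have "r = 1" by simp
      thus "k = M" using r by simp
    next
      assume "k = M"
      thus "?n dvd M + k" unfolding nM by (simp flip: mult_2)
    qed
    finally show ?thesis .
  qed
  have corr: "(\<Sum>k<?n. e k * e (k + j)) = (if j = 0 then int p else 0) - 1 * (1 + (-1) ^ j)" if j: "j < ?n" for j
  proof (cases "j = 0")
    case True
    have "(\<Sum>k<?n. e k * e (k + j)) = (\<Sum>k<?n. if k = M then 0 else 1)"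
    proof (intro sum.cong refl)
      fix k assume "k \<in> {..<?n}"
      hence "e k = 0 \<longleftrightarrow> k = M" using e0 by simp
      thus "e k * e (k + j) = (if k = M then 0 else 1)" using True L_sq[of "1 + w ^ k"] by (auto simp: e_def)
    qed
    also have "\<dots> = (\<Sum>k\<in>{..<?n} - {M}. 1)" by (rule sum.mono_neutral_cong_right) auto
    also have "\<dots> = int p - 2" using nM M_pos p_gt by (simp add: of_nat_diff)
    finally show ?thesis using True by simp
  next
    case False
    \<comment> \<open>The points \<open>(1 + w^(k + j) : 1 + w^k)\<close> miss the two limits in
      which \<open>w^k\<close> is replaced by 0 and by infinity. Adding \<open>(1 : 1)\<close> and
      \<open>(w^j : 1)\<close> completes the projective line; their symbols 1 and
      \<open>(-1)^j\<close> are the correction with \<open>t = 1\<close>.\<close>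
    define a b where "a k = (if k < ?n then 1 + w ^ (k + j) else if k = ?n then 1 else w ^ j)"
      and "b k = (if k < ?n then 1 + w ^ k else 1)" for k
    have v: "a k = 1 + w ^ k * w ^ j" "b k = 1 + w ^ k" if "k < ?n" for k using that by (simp_all add: a_def b_def power_add)
    have v': "a ?n = 1" "b ?n = 1" "a p = w ^ j" "b p = 1" using p_gt by (auto simp: a_def b_def)
    have nj: "\<not> ?n dvd j" using False j by (auto dest: dvd_imp_le)
    have "\<not> int p dvd a k * b l - a l * b k" if kl: "k < l" "l < p + 1" for k l
    proof -
      consider "l < ?n" | "k < ?n" "l = ?n" | "k < ?n" "l = p" | "k = ?n" "l = p" using kl p_gt by linarith
      thus ?thesis
      proof cases
        case 1
        have "w ^ l = w ^ k * w ^ (l - k)" using kl by (simp flip: power_add)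
        hence "a k * b l - a l * b k = - (w ^ k * (w ^ (l - k) - 1) * (w ^ j - 1))"
          using 1 kl by (simp add: v algebra_simps)
        moreover have "\<not> ?n dvd l - k" using 1 kl by (auto dest: dvd_imp_le)
        ultimately show ?thesis using wj nj wk pint by (simp add: prime_dvd_mult_iff)
      next
        case 2
        have "a k * b l - a l * b k = w ^ k * (w ^ j - 1)"
          unfolding 2(2) v[OF 2(1)] v' by (simp add: algebra_simps)
        thus ?thesis using wj nj wk pint by (simp add: prime_dvd_mult_iff)
      next
        case 3
        have "a k * b l - a l * b k = - (w ^ j - 1)"
          unfolding 3(2) v[OF 3(1)] v' by (simp add: algebra_simps)
        thus ?thesis using wj nj by (simp only: dvd_minus_iff not_False_eq_True)
      next
        case 4
        have "a k * b l - a l * b k = - (w ^ j - 1)"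
          unfolding 4 v' by (simp add: algebra_simps)
        thus ?thesis using wj nj by (simp only: dvd_minus_iff not_False_eq_True)
      qed
    qed
    hence npr: "\<not> int p dvd a k * b l - a l * b k" if "k \<in> {..<p + 1}" "l \<in> {..<p + 1}" "k \<noteq> l" for k l
      using that dvd_minus_iff[of "int p" "a k * b l - a l * b k"]
      by (cases k l rule: linorder_cases) (auto simp: minus_diff_eq)
    have "(\<Sum>k<p + 1. L (a k * b k)) = 0"
      by (rule sum_L_projective[OF _ _ Lw npr]) auto
    moreover have s: "{..<p + 1} = insert ?n (insert p {..<?n})" using p_gt by auto
    have "sum f (insert ?n (insert p {..<?n})) = f ?n + (f p + sum f {..<?n})" for f :: "nat \<Rightarrow> int"
      using p_gt by (subst sum.insert; simp)+
    note this[of "\<lambda>k. L (a k * b k)", folded s]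
    ultimately have "L (a ?n * b ?n) + L (a p * b p) + (\<Sum>k<?n. L (a k * b k)) = 0" by linarith
    moreover have "(\<Sum>k<?n. L (a k * b k)) = (\<Sum>k<?n. e k * e (k + j))"
      by (intro sum.cong refl) (simp add: v e_def L_mult mult.commute power_add)
    moreover have "L (a ?n * b ?n) = 1" "L (a p * b p) = (-1) ^ j" unfolding v' by (simp_all add: L_1 Lwk)
    ultimately show ?thesis using False by simp
  qed
  \<comment> \<open>With \<open>m q = p - 1\<close> the element \<open>g\<close> has order
    \<open>m\<close>, and its inverse \<open>h\<close> contributes the exponent
    \<open>p - 1 - q\<close>, which makes the evaluation select \<open>i0 = q\<close>.\<close>
  define g h where "g = W ^ q" and "h = W ^ (?n - q)"
  have g: "g \<in> range of_int" "h \<in> range of_int" unfolding g_def h_def using W by (auto intro: Z.Or_power)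
  have gm: "Z.cg 2 (g ^ m) 1" using Wn q by (simp add: g_def mult.commute flip: power_mult)
  have ung: "Z.un 2 (g ^ j - 1)" if "\<not> m dvd j" for j
  proof -
    have "\<not> ?n dvd q * j" unfolding q using that q0 by (simp add: mult.commute)
    thus ?thesis using unW by (simp add: g_def flip: power_mult)
  qed
  have qn: "q \<le> ?n" using q m0 by simp
  have gh: "Z.cg 2 (g * h) 1" using Wn power_add[of W q "?n - q"] qn by (simp only: g_def h_def le_add_diff_inverse)
  have qM: "q \<le> M" using q nM md by auto
  have E: "Z.cg 2 (\<Sum>k<?n. of_int (e k) * h ^ k) (of_int (X_split q))"
  proof -
    have "Z.cg 2 (\<Sum>k<?n. of_int (e k) * h ^ k) (\<Sum>k<?n. W ^ (k * (p - 1 - q)) * ((1 + W ^ k) ^ M + of_nat p * (of_nat M * (1 + W ^ k) ^ (M - 1)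
        * (\<Sum>r=1..<p. of_int (phi r) * W ^ (k * r)))))"
    proof (rule Z.cg_sum)
      fix k
      have Wk: "W ^ k \<in> range of_int" using W by (rule Z.Or_power)
      have p1: "p = Suc ?n" using p_gt by simp
      have "Z.cg 2 ((W ^ k) * (W ^ ?n) ^ k) (W ^ k * 1 ^ k)" by (intro Z.cg_left Z.cg_power Wn Wk)
      moreover have "(W ^ k) ^ p = (W ^ k) * (W ^ ?n) ^ k" by (subst p1) (simp add: mult.commute flip: power_mult)
      ultimately have Wp: "Z.cg 2 ((W ^ k) ^ p) (W ^ k)" by simp
      have one: "Z.cg 2 (1 ^ p) 1" using Z.cg_refl[OF Z.Or_1] by simp
      have "Z.cg 2 (of_int (e k)) ((W ^ k + 1) ^ (p * M))"
        using Z.L_lift[of "1 + w ^ k"] by (simp add: e_def W_def add.commute)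
      also have "Z.cg 2 \<dots> ((W ^ k + 1) ^ M
          + of_nat p * (of_nat M * (W ^ k + 1) ^ (M - 1) * (\<Sum>r=1..<p. of_int (phi r) * (W ^ k) ^ r * 1 ^ (p - r))))"
        by (rule Z.cg_pow_pM[OF Wk Z.Or_1 Wp one])
      finally have "Z.cg 2 (h ^ k * of_int (e k)) (h ^ k * ((W ^ k + 1) ^ M
          + of_nat p * (of_nat M * (W ^ k + 1) ^ (M - 1) * (\<Sum>r=1..<p. of_int (phi r) * (W ^ k) ^ r * 1 ^ (p - r)))))"
        by (rule Z.cg_left[OF _ Z.Or_power[OF g(2)]])
      thus "Z.cg 2 (of_int (e k) * h ^ k) (W ^ (k * (p - 1 - q)) * ((1 + W ^ k) ^ M + of_nat p * (of_nat M * (1 + W ^ k) ^ (M - 1)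
        * (\<Sum>r=1..<p. of_int (phi r) * W ^ (k * r)))))"
        by (simp add: h_def mult.commute add.commute flip: power_mult)
    qed
    also have "Z.cg 2 \<dots> (of_int (X_split q))"
      by (rule Z.eval_X_split[OF W Z.orthogonality[OF W Wn unW] qM])
    finally show ?thesis .
  qed
  have nm: "?n = (m div 2) * (2 * q)" "1 = (- 1 :: int) ^ (2 * q)" using q m0 by auto
  note T = Z.trace_identity[where e = e and c = 1 and t = 1, OF md _ _ _ per rfl corr _ nm g(1) gm ung g(2) gh E]
  have en: "even ?n" "?n > 0" using nM M_pos by auto
  have qd: "(p - 1) div m = q" using q m0 by simp
  have odd: "odd (e k)" if "k < ?n" "k \<noteq> M" for k using e0[OF that(1)] that(2) L_values[of "1 + w ^ k"] by (auto simp: e_def)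
  show ?thesis
  proof (rule that)
    show "(\<Sum>k<?n. fst (lucas d k) * e k)\<^sup>2 + d * (\<Sum>k<?n. snd (lucas d k) * e k)\<^sup>2 = 4 * int p"
      by (rule T(1)) (use en in auto)
    show "[(X_split ((p - 1) div m))\<^sup>2 + int p = (\<Sum>k<?n. fst (lucas d k) * e k) * X_split ((p - 1) div m)] (mod int p ^ 2)"
      unfolding qd by (rule T(2)) (use en in auto)
  next
    assume "d = 3"
    hence "m = 6" using md by auto
    hence "?n = 6 * q" "M = 3 * q" using q nM by auto
    thus "even (\<Sum>k<?n. fst (lucas d k) * e k)" using even_trace_3[of q e] odd \<open>d = 3\<close> by simp
  next
    assume "d = 1"
    hence "m = 12" using md by auto
    hence j: "?n = 6 * (2 * q)" "M = 3 * (2 * q)" using q nM by auto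
    have "[(\<Sum>k<6 * (2 * q). fst (lucas 1 k) * e k) = (if even (2 * q) then 2 else 0)] (mod 4)"
    proof (rule trace_1_mod_4)
      show "e (6 * (2 * q) - k) = (- 1) ^ (2 * q) * (- 1) ^ k * e k" if "k \<le> 6 * (2 * q)" for k
        using rfl[of k] that unfolding j(1) by simp
      show "odd (e k)" if "k < 6 * (2 * q)" "k \<noteq> 3 * (2 * q)" for k using odd[of k] that j by simp
      show "e (3 * (2 * q)) = 0" using e0[of M] j q0 by simp
    qed (use q0 in simp)
    thus "[(\<Sum>k<?n. fst (lucas d k) * e k) = 2] (mod 4)" using \<open>d = 1\<close> j by simp
  qed
qed

end

section \<open>The inert case\<close>

text \<open>The pair \<open>(a, b)\<close> stands for \<open>a + b sqrt N\<close> modulo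
  \<open>q\<close>. For a prime \<open>q\<close> and a non-residue \<open>N\<close> this is the
  field with \<open>q^2\<close> elements; its multiplicative group is cyclic, which provides the
  generator.\<close>

definition quad_ring :: "int \<Rightarrow> int \<Rightarrow> (int \<times> int) ring" where
  "quad_ring q N = \<lparr>carrier = {0..<q} \<times> {0..<q},
     monoid.mult = (\<lambda>x y. ((fst x * fst y + N * snd x * snd y) mod q, (fst x * snd y + snd x * fst y) mod q)),
     one = (1, 0), zero = (0, 0), add = (\<lambda>x y. ((fst x + fst y) mod q, (snd x + snd y) mod q))\<rparr>"

lemma mod_linear:
  fixes q :: int
  shows "((x mod q) * u + N * (y mod q) * v) mod q = (x * u + N * y * v) mod q"
    "(u * (x mod q) + N * v * (y mod q)) mod q = (u * x + N * v * y) mod q"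
    "((x mod q) * u + (y mod q) * v) mod q = (x * u + y * v) mod q"
    "(u * (x mod q) + v * (y mod q)) mod q = (u * x + v * y) mod q"
  by (rule mod_add_cong; simp add: mod_mult_left_eq mod_mult_right_eq mult.assoc;
      metis mod_mult_left_eq mod_mult_right_eq mult.assoc mult.commute)+

lemma quad_ring_cring: assumes "q > 1" shows "cring (quad_ring q N)"
proof (rule cringI)
  show "abelian_group (quad_ring q N)"
  proof (rule abelian_groupI)
    fix x assume x: "x \<in> carrier (quad_ring q N)"
    show "\<exists>y\<in>carrier (quad_ring q N). y \<oplus>\<^bsub>quad_ring q N\<^esub> x = \<zero>\<^bsub>quad_ring q N\<^esub>"
      by (rule bexI[of _ "((- fst x) mod q, (- snd x) mod q)"]) (use assms in \<open>auto simp: quad_ring_def mod_simps\<close>)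
  qed (use assms in \<open>auto simp: quad_ring_def mod_simps algebra_simps\<close>)
  show "comm_monoid (quad_ring q N)"
  proof (rule comm_monoidI)
    fix x y z
    show "(x \<otimes>\<^bsub>quad_ring q N\<^esub> y) \<otimes>\<^bsub>quad_ring q N\<^esub> z = x \<otimes>\<^bsub>quad_ring q N\<^esub> (y \<otimes>\<^bsub>quad_ring q N\<^esub> z)"
      by (simp add: quad_ring_def mod_linear) (simp add: algebra_simps)
  qed (use assms in \<open>auto simp: quad_ring_def algebra_simps\<close>)
  fix x y z
  show "(x \<oplus>\<^bsub>quad_ring q N\<^esub> y) \<otimes>\<^bsub>quad_ring q N\<^esub> z
      = x \<otimes>\<^bsub>quad_ring q N\<^esub> z \<oplus>\<^bsub>quad_ring q N\<^esub> y \<otimes>\<^bsub>quad_ring q N\<^esub> z"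
    by (simp add: quad_ring_def mod_linear mod_simps) (simp add: algebra_simps)
qed

text \<open>The inverse of \<open>a + b sqrt N\<close> is its conjugate divided by the norm
  \<open>a^2 - N b^2\<close>, which the hypothesis on \<open>N\<close> keeps prime to
  \<open>q\<close>.\<close>

lemma quad_ring_field:
  assumes q: "prime q" and N: "\<And>x y. q dvd x\<^sup>2 - N * y\<^sup>2 \<Longrightarrow> q dvd x \<and> q dvd y"
  shows "field (quad_ring q N)"
proof -
  have q1: "q > 1" using q by (rule prime_gt_1_int)
  interpret R: cring "quad_ring q N" by (rule quad_ring_cring[OF q1])
  show ?thesis
  proof (rule R.cring_fieldI2)
    show "\<zero>\<^bsub>quad_ring q N\<^esub> \<noteq> \<one>\<^bsub>quad_ring q N\<^esub>" by (simp add: quad_ring_def)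
    fix x assume x: "x \<in> carrier (quad_ring q N)" "x \<noteq> \<zero>\<^bsub>quad_ring q N\<^esub>"
    obtain a b where ab: "x = (a, b)" by (cases x)
    have "\<not> (q dvd a \<and> q dvd b)" using x ab by (auto simp: quad_ring_def dest!: zdvd_imp_le)
    hence "\<not> q dvd a\<^sup>2 - N * b\<^sup>2" using N by blast
    hence "coprime (a\<^sup>2 - N * b\<^sup>2) q" using q by (metis coprime_commute prime_imp_coprime)
    then obtain c where c: "[(a\<^sup>2 - N * b\<^sup>2) * c = 1] (mod q)" using cong_solve_coprime_int by blast
    show "\<exists>y\<in>carrier (quad_ring q N). x \<otimes>\<^bsub>quad_ring q N\<^esub> y = \<one>\<^bsub>quad_ring q N\<^esub>"
    proof (rule bexI[of _ "((a * c) mod q, (- b * c) mod q)"])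
      have "(a * (a * c) + N * b * (- b * c)) mod q = 1"
        using c q1 by (simp add: cong_def power2_eq_square algebra_simps)
      thus "x \<otimes>\<^bsub>quad_ring q N\<^esub> ((a * c) mod q, (- b * c) mod q) = \<one>\<^bsub>quad_ring q N\<^esub>"
        unfolding ab by (simp add: quad_ring_def mod_linear)
    qed (use q1 in \<open>simp add: quad_ring_def\<close>)
  qed
qed

lemma quad_ring_generator:
  assumes q: "prime q" and N: "\<And>x y. q dvd x\<^sup>2 - N * y\<^sup>2 \<Longrightarrow> q dvd x \<and> q dvd y"
  obtains x where "x \<in> carrier (quad_ring q N)"
    "\<And>j. x [^]\<^bsub>quad_ring q N\<^esub> j = \<one>\<^bsub>quad_ring q N\<^esub> \<longleftrightarrow> (nat q ^ 2 - 1) dvd (j :: nat)"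
proof -
  let ?R = "quad_ring q N"
  interpret R: field ?R by (rule quad_ring_field[OF assms])
  have c: "carrier ?R = {0..<q} \<times> {0..<q}" "\<zero>\<^bsub>?R\<^esub> = (0, 0)" by (simp_all add: quad_ring_def)
  have fin: "finite (carrier ?R)" by (simp add: c)
  have q1: "q > 1" using q by (rule prime_gt_1_int)
  obtain x where x: "x \<in> carrier (mult_of ?R)" "carrier (mult_of ?R) = {x [^]\<^bsub>?R\<^esub> i | i::nat. i \<in> UNIV}"
    using R.finite_field_mult_group_has_gen[OF fin] by blast
  have G: "group (mult_of ?R)" by (rule R.field_mult_group)
  have fin': "finite (carrier (mult_of ?R))" using fin by simp
  have "card (carrier (mult_of ?R)) = nat q ^ 2 - 1"
    using q1 by (simp add: c card_cartesian_product power2_eq_square)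
  moreover have "card (carrier (mult_of ?R)) = group.ord (mult_of ?R) x"
  proof -
    have "carrier (mult_of ?R) = {x [^]\<^bsub>mult_of ?R\<^esub> i | i::nat. i \<in> {0..group.ord (mult_of ?R) x - 1}}"
      using x(2) group.ord_elems[OF G fin' x(1)] by (simp add: nat_pow_mult_of)
    also have "\<dots> = (\<lambda>i. x [^]\<^bsub>mult_of ?R\<^esub> i) ` {0..group.ord (mult_of ?R) x - 1}" by auto
    finally have "card (carrier (mult_of ?R)) = card {0..group.ord (mult_of ?R) x - 1}"
      using card_image[OF group.ord_inj[OF G x(1)]] by simp
    thus ?thesis using group.ord_ge_1[OF G fin' x(1)] by simp
  qed
  ultimately have "x [^]\<^bsub>?R\<^esub> j = \<one>\<^bsub>?R\<^esub> \<longleftrightarrow> (nat q ^ 2 - 1) dvd j" for j :: nat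
    using group.pow_eq_id[OF G x(1), of j] by (simp add: nat_pow_mult_of)
  moreover have "x \<in> carrier ?R" using x(1) by simp
  ultimately show ?thesis using that by blast
qed

section \<open>The order of all a + b sqrt N\<close>

definition quad_int :: "int \<Rightarrow> int \<times> int \<Rightarrow> complex" where
  "quad_int N x = of_int (fst x) + of_int (snd x) * csqrt (of_int N)"

lemma quad_int_mult:
  "quad_int N (a, b) * quad_int N (c, d) = quad_int N (a * c + N * b * d, a * d + b * c)"
proof -
  have "csqrt (of_int N) * csqrt (of_int N) = of_int N"
    using power2_csqrt[of "of_int N"] by (simp only: power2_eq_square)
  hence "of_int b * of_int d * (csqrt (of_int N) * csqrt (of_int N)) = (of_int (N * b * d) :: complex)" by simp
  thus ?thesis by (simp add: quad_int_def algebra_simps)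
qed

context odd_prime
begin

text \<open>If \<open>p\<close> did not divide \<open>y\<close>, then \<open>N\<close> would be the
  square of \<open>x / y\<close> modulo \<open>p\<close>.\<close>

lemma nonresidue_norm:
  assumes N: "L N = - 1" and "int p dvd x\<^sup>2 - N * y\<^sup>2" shows "int p dvd x \<and> int p dvd y"
proof -
  have c: "[x\<^sup>2 = N * y\<^sup>2] (mod int p)" using assms(2) by (simp add: cong_iff_dvd_diff)
  have y: "int p dvd y"
  proof (rule ccontr)
    assume "\<not> int p dvd y"
    hence "L y * L y = 1" using L_sq L_0_iff by blast
    hence "L x * L x = - 1" using L_cong[OF c] N by (simp add: power2_eq_square L_mult)
    thus False using L_values[of x] by auto
  qed
  hence "int p dvd N * y\<^sup>2" by (simp add: power2_eq_square)
  hence "int p dvd x\<^sup>2" using c cong_dvd_iff by blast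
  thus ?thesis using y pint prime_dvd_power by blast
qed

lemma prime_order_quad: "prime_order p M (range (quad_int N))"
proof (unfold_locales)
  show "1 \<in> range (quad_int N)" by (rule range_eqI[of _ _ "(1, 0)"]) (simp add: quad_int_def)
next
  fix x y assume "x \<in> range (quad_int N)" "y \<in> range (quad_int N)"
  then obtain a b c d where xy: "x = quad_int N (a, b)" "y = quad_int N (c, d)" by auto
  have "x + y = quad_int N (a + c, b + d)" by (simp add: xy quad_int_def algebra_simps)
  thus "x + y \<in> range (quad_int N)" by blast
  show "x * y \<in> range (quad_int N)" unfolding xy quad_int_mult by blast
next
  fix x assume "x \<in> range (quad_int N)"
  then obtain a b where x: "x = quad_int N (a, b)" by auto
  have "- x = quad_int N (- a, - b)" by (simp add: x quad_int_def)
  thus "- x \<in> range (quad_int N)" by blast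
next
  fix x m k assume x: "x \<in> range (quad_int N)" "of_int m = of_nat p ^ k * x"
  then obtain a b where ab: "x = quad_int N (a, b)" by auto
  have "(of_int (m - int p ^ k * a) :: complex) = of_int (int p ^ k * b) * csqrt (of_int N)"
    using x(2) by (simp add: ab quad_int_def algebra_simps)
  \<comment> \<open>Squaring removes the square root, and \<open>p^(2 k)\<close> dividing a square
    of an integer gives \<open>p^k\<close> dividing the integer.\<close>
  hence "(of_int (m - int p ^ k * a) :: complex)\<^sup>2 = (of_int (int p ^ k * b))\<^sup>2 * of_int N"
    by (simp only: power_mult_distrib power2_csqrt)
  hence "(of_int ((m - int p ^ k * a)\<^sup>2) :: complex) = of_int ((int p ^ k * b)\<^sup>2 * N)" by (simp only: of_int_power of_int_mult)
  hence "(m - int p ^ k * a)\<^sup>2 = (int p ^ k * b)\<^sup>2 * N" by (simp only: of_int_eq_iff)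
  hence "(int p ^ k)\<^sup>2 dvd (m - int p ^ k * a)\<^sup>2" by (simp add: power_mult_distrib)
  hence "int p ^ k dvd m - int p ^ k * a" by (simp only: pow_divides_pow_iff zero_less_numeral)
  thus "int p ^ k dvd m" by (simp add: dvd_diff_left_iff)
qed

text \<open>Powers in the finite field and in the order agree modulo \<open>p\<close>. The
  difference \<open>x^j - 1\<close> is a unit because its norm is prime to \<open>p\<close>.\<close>

lemma quad_generator_exists:
  assumes N: "L N = - 1"
  obtains a b where "prime_order.cg p (range (quad_int N)) 1 (quad_int N (a, b) ^ (p\<^sup>2 - 1)) 1"
    "\<And>j. \<not> (p\<^sup>2 - 1) dvd j \<Longrightarrow> prime_order.un p (range (quad_int N)) 1 (quad_int N (a, b) ^ j - 1)"
proof -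
  interpret Z: prime_order p M "range (quad_int N)" by (rule prime_order_quad)
  let ?R = "quad_ring (int p) N" and ?i = "quad_int N"
  obtain x where x: "x \<in> carrier ?R" "\<And>j. x [^]\<^bsub>?R\<^esub> j = \<one>\<^bsub>?R\<^esub> \<longleftrightarrow> (p\<^sup>2 - 1) dvd (j :: nat)"
    using quad_ring_generator[OF pint nonresidue_norm[OF N]] by (metis nat_int)
  interpret R: field ?R by (rule quad_ring_field[OF pint nonresidue_norm[OF N]])
  have im: "?i y \<in> range ?i" for y by blast
  have sq: "csqrt (of_int N) \<in> range ?i" by (rule range_eqI[of _ _ "(0, 1)"]) (simp add: quad_int_def)
  have md: "Z.cg 1 (?i (a mod int p, b mod int p)) (?i (a, b))" for a b
  proof -
    have "Z.cg 1 (of_int (a mod int p)) (of_int a)" for a unfolding Z.cg_of_int by simp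
    hence "Z.cg 1 (of_int (a mod int p) + of_int (b mod int p) * csqrt (of_int N)) (of_int a + of_int b * csqrt (of_int N))"
      by (intro Z.cg_add Z.cg_right sq)
    thus ?thesis by (simp add: quad_int_def[of N "(_, _)"])
  qed
  have mult: "Z.cg 1 (?i (y \<otimes>\<^bsub>?R\<^esub> z)) (?i y * ?i z)" for y z
    using md[of "fst y * fst z + N * snd y * snd z" "fst y * snd z + snd y * fst z"]
      quad_int_mult[of N "fst y" "snd y" "fst z" "snd z"] by (simp add: quad_ring_def)
  have pow: "Z.cg 1 (?i (x [^]\<^bsub>?R\<^esub> j)) (?i x ^ j)" for j :: nat
  proof (induction j)
    case 0
    have "?i \<one>\<^bsub>?R\<^esub> = 1" by (simp add: quad_ring_def quad_int_def)
    thus ?case using Z.cg_refl[OF Z.Or_1] by simp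
  next
    case (Suc j)
    have "Z.cg 1 (?i (x [^]\<^bsub>?R\<^esub> Suc j)) (?i (x [^]\<^bsub>?R\<^esub> j) * ?i x)" using mult by simp
    also have "Z.cg 1 \<dots> (?i x ^ j * ?i x)" by (rule Z.cg_right[OF Suc im])
    finally show ?case by (simp add: mult.commute)
  qed
  have "Z.cg 1 (?i x ^ (p\<^sup>2 - 1)) (?i (x [^]\<^bsub>?R\<^esub> (p\<^sup>2 - 1)))" by (rule Z.cg_sym[OF pow])
  moreover have "x [^]\<^bsub>?R\<^esub> (p\<^sup>2 - 1) = \<one>\<^bsub>?R\<^esub>" using x(2) by simp
  moreover have "?i \<one>\<^bsub>?R\<^esub> = 1" by (simp add: quad_ring_def quad_int_def)
  ultimately have 1: "Z.cg 1 (?i x ^ (p\<^sup>2 - 1)) 1" by simp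
  have 2: "Z.un 1 (?i x ^ j - 1)" if "\<not> (p\<^sup>2 - 1) dvd j" for j
  proof -
    obtain c d where cd: "x [^]\<^bsub>?R\<^esub> j = (c, d)" by (cases "x [^]\<^bsub>?R\<^esub> j")
    have "(c, d) \<in> carrier ?R" using R.nat_pow_closed[OF x(1), of j] cd by simp
    hence car: "0 \<le> c" "c < int p" "0 \<le> d" "d < int p" by (auto simp: quad_ring_def)
    have "(c, d) \<noteq> (1, 0)" using x(2)[of j] that cd by (simp add: quad_ring_def)
    have "\<not> (int p dvd c - 1 \<and> int p dvd d)"
    proof
      assume a: "int p dvd c - 1 \<and> int p dvd d"
      have "\<bar>c - 1\<bar> < int p" "\<bar>d\<bar> < int p" using car p_gt by auto
      hence "c - 1 = 0" "d = 0" using a dvd_imp_le_int[of "c - 1" "int p"] dvd_imp_le_int[of d "int p"] by linarith+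
      thus False using \<open>(c, d) \<noteq> (1, 0)\<close> by simp
    qed
    hence "\<not> int p dvd (c - 1)\<^sup>2 - N * d\<^sup>2" using nonresidue_norm[OF N] by blast
    hence "coprime ((c - 1)\<^sup>2 - N * d\<^sup>2) (int p)" using pint by (metis coprime_commute prime_imp_coprime)
    then obtain f where f: "[((c - 1)\<^sup>2 - N * d\<^sup>2) * f = 1] (mod int p)" using cong_solve_coprime_int by blast
    have "?i (c - 1, d) * (?i (c - 1, - d) * of_int f) = of_int (((c - 1)\<^sup>2 - N * d\<^sup>2) * f)"
      unfolding mult.assoc[symmetric] quad_int_mult by (simp add: quad_int_def power2_eq_square)
    moreover have "Z.cg 1 (of_int (((c - 1)\<^sup>2 - N * d\<^sup>2) * f)) (of_int 1)" unfolding Z.cg_of_int using f by simp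
    ultimately have "Z.cg 1 (?i (c - 1, d) * (?i (c - 1, - d) * of_int f)) 1" by (simp only: of_int_1)
    hence u: "Z.un 1 (?i (c - 1, d))" unfolding Z.un_def using im Z.Or_mult[OF im Z.Or_int] by blast
    have "?i (c - 1, d) = ?i (c, d) - 1" by (simp add: quad_int_def)
    moreover have "Z.cg 1 (?i x ^ j - 1) (?i (c, d) - 1)"
      using Z.cg_diff[OF Z.cg_sym[OF pow[of j]] Z.cg_refl[OF Z.Or_1]] cd by simp
    ultimately show ?thesis using Z.un_cong[OF u] by simp
  qed
  obtain a b where "x = (a, b)" by (cases x)
  thus ?thesis using that[of a b] 1 2 by simp
qed

end

lemma quad_int_power:
  "\<exists>x y. quad_int N (a, b) ^ j = quad_int N (x, y) \<and> quad_int N (a, - b) ^ j = quad_int N (x, - y)"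
proof (induction j)
  case 0
  have "1 = quad_int N (1, 0)" "1 = quad_int N (1, - 0)" by (simp_all add: quad_int_def)
  thus ?case by (metis power_0)
next
  case (Suc j)
  then obtain x y where xy: "quad_int N (a, b) ^ j = quad_int N (x, y)" "quad_int N (a, - b) ^ j = quad_int N (x, - y)" by blast
  have "quad_int N (a, b) ^ Suc j = quad_int N (a * x + N * b * y, a * y + b * x)"
    "quad_int N (a, - b) ^ Suc j = quad_int N (a * x + N * b * y, - (a * y + b * x))"
    unfolding power_Suc xy quad_int_mult by simp_all
  thus ?case by blast
qed

section \<open>The trace attached to the field with p^2 elements\<close>

context odd_prime
begin

lemma trace_inert:
  assumes md: "(m, d) \<in> {(6, 3), (8, 2), (12, 1)}" and N: "L N = - 1"
    and r: "p + 1 = (m div 2) * r" "odd r" and i0: "2 * i0 + r = p"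
  obtains A B where "A\<^sup>2 + d * B\<^sup>2 = 4 * int p" "[(X_inert i0)\<^sup>2 + int p = A * X_inert i0] (mod int p ^ 2)"
    "d = 1 \<Longrightarrow> [A = 0] (mod 4)"
proof -
  interpret Z: prime_order p M "range (quad_int N)" by (rule prime_order_quad)
  obtain a b where g: "Z.cg 1 (quad_int N (a, b) ^ (p\<^sup>2 - 1)) 1"
    "\<And>j. \<not> (p\<^sup>2 - 1) dvd j \<Longrightarrow> Z.un 1 (quad_int N (a, b) ^ j - 1)"
    by (rule quad_generator_exists[OF N]) blast
  define gp gm where "gp = quad_int N (a, b)" and "gm = quad_int N (a, - b)"
  \<comment> \<open>Raising to the power \<open>p\<close> turns the generator and its conjugate into
    roots of unity modulo \<open>p^2\<close>.\<close>
  define w wc where "w = gp ^ p" and "wc = gm ^ p"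
  let ?n = "p + 1" and ?Q = "p\<^sup>2 - 1"
  have Q: "?Q = (p - 1) * ?n" "?Q = 2 * (M * ?n)" "?Q = m * (M * r)" "p * p = Suc ?Q"
  proof -
    have p: "p = 2 * M + 1" by (rule p_eq)
    show "?Q = (p - 1) * ?n" "?Q = 2 * (M * ?n)" unfolding p by (simp_all add: power2_eq_square algebra_simps)
    moreover have "2 * (m div 2) = m" using md by auto
    ultimately show "?Q = m * (M * r)" unfolding r(1) by (metis mult.assoc mult.left_commute)
    show "p * p = Suc ?Q" using p_gt by (simp add: power2_eq_square)
  qed
  have r0: "r > 0" using r(2) by (cases r) auto
  have Or: "gp \<in> range (quad_int N)" "gm \<in> range (quad_int N)" "w \<in> range (quad_int N)" "wc \<in> range (quad_int N)"
    unfolding gp_def gm_def w_def wc_def by (auto intro!: Z.Or_power)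
  have wQ: "Z.cg 2 (w ^ ?Q) 1"
    using Z.cg_pow_p[OF g(1)] by (simp add: w_def gp_def mult.commute flip: power_mult)
  have cop: "coprime ?Q p"
    using coprime_Suc_left_nat[of ?Q] coprime_mult_right_iff[of ?Q p p] Q(4) by (metis coprime_commute)
  have unw: "Z.un 2 (w ^ j - 1)" if "\<not> ?Q dvd j" for j
  proof -
    have "\<not> ?Q dvd p * j" using that cop by (simp add: coprime_dvd_mult_right_iff)
    from Z.un_lift[OF g(2)[OF this]] show ?thesis by (simp add: w_def gp_def flip: power_mult)
  qed
  \<comment> \<open>Frobenius is conjugation: \<open>sqrt N ^ p = N^M * sqrt N\<close>, and
    \<open>N^M = -1\<close> modulo \<open>p\<close> for a non-residue.\<close>
  have gmp: "Z.cg 1 gm (gp ^ p)"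
  proof -
    let ?s = "csqrt (of_int N)"
    have s: "?s \<in> range (quad_int N)" by (rule range_eqI[of _ _ "(0, 1)"]) (simp add: quad_int_def)
    have fermat: "Z.cg 1 (of_int c ^ p) (of_int c)" for c
    proof -
      have "c ^ p = c * (c ^ M * c ^ M)" by (subst p_eq) (simp add: mult_2 power_add)
      moreover have "[c * (c ^ M * c ^ M) = c * (L c * L c)] (mod int p)" by (intro cong_mult cong_refl cong_sym[OF L_euler])
      moreover have "[c * (L c * L c) = c] (mod int p)" using L_sq[of c] L_0_iff[of c] by (cases "L c = 0") (auto simp: cong_0_iff cong_def)
      ultimately have "[c ^ p = c] (mod int p ^ 1)" by (metis cong_trans power_one_right)
      thus ?thesis using Z.cg_of_int[of 1 "c ^ p" c] by simp
    qed
    have sp: "Z.cg 1 (?s ^ p) (- ?s)"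
    proof -
      have "?s ^ p = of_int (N ^ M) * ?s" by (subst p_eq) (simp add: power_mult)
      moreover have "[N ^ M = - 1] (mod int p ^ 1)" using cong_sym[OF L_euler[of N]] N by simp
      hence "Z.cg 1 (of_int (N ^ M) * ?s) (of_int (- 1) * ?s)" by (intro Z.cg_right s) (simp only: Z.cg_of_int)
      ultimately show ?thesis by simp
    qed
    have S: "(\<Sum>r=1..<p. of_int (phi r) * of_int a ^ r * (of_int b * ?s) ^ (p - r)) \<in> range (quad_int N)"
      by (intro Z.Or_intros s)
    have "gp ^ p = of_int a ^ p + of_int b ^ p * ?s ^ p + of_nat p ^ 1 * (\<Sum>r=1..<p. of_int (phi r) * of_int a ^ r * (of_int b * ?s) ^ (p - r))"
      unfolding gp_def by (simp add: quad_int_def Z.freshman power_mult_distrib)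
    moreover have "Z.cg 1 (of_int a ^ p + of_int b ^ p * ?s ^ p + of_nat p ^ 1 * (\<Sum>r=1..<p. of_int (phi r) * of_int a ^ r * (of_int b * ?s) ^ (p - r)))
        (of_int a ^ p + of_int b ^ p * ?s ^ p)"
      by (rule Z.cgI[OF _ S refl]) (intro Z.Or_intros s)
    moreover have "Z.cg 1 (of_int a ^ p + of_int b ^ p * ?s ^ p) (of_int a + of_int b * (- ?s))"
      by (intro Z.cg_add Z.cg_mult fermat sp)
    moreover have "gm = of_int a + of_int b * (- ?s)" by (simp add: gm_def quad_int_def)
    ultimately show ?thesis using Z.cg_sym Z.cg_trans by metis
  qed
  have wp: "Z.cg 2 (w ^ p) wc" using Z.cg_sym[OF Z.cg_pow_p[OF gmp]] by (simp add: w_def wc_def)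
  have wcp: "Z.cg 2 (wc ^ p) w"
  proof -
    have "Z.cg 2 (wc ^ p) ((w ^ p) ^ p)" by (rule Z.cg_power[OF Z.cg_sym[OF wp]])
    also have "(w ^ p) ^ p = w * w ^ ?Q" using Q(4) by (simp flip: power_mult power_Suc)
    also have "Z.cg 2 \<dots> (w * 1)" by (rule Z.cg_left[OF wQ Or(3)])
    finally show ?thesis by simp
  qed
  obtain x y where xy: "\<And>j. gp ^ j = quad_int N (x j, y j) \<and> gm ^ j = quad_int N (x j, - y j)"
    unfolding gp_def gm_def using quad_int_power[of N a b] by metis
  \<comment> \<open>An integer equal to the trace \<open>w^k + wc^k\<close>, since conjugate powers
    have opposite second coordinates.\<close>
  define v where "v k = 2 * x (p * k)" for k
  have v: "of_int (v k) = w ^ k + wc ^ k" for k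
    using xy[of "p * k"] by (simp add: v_def w_def wc_def quad_int_def flip: power_mult)
  define nu where "nu = (a * a - N * b * b) ^ p"
  have nu: "of_int nu = w * wc"
  proof -
    have "gp * gm = of_int (a * a - N * b * b)" unfolding gp_def gm_def quad_int_mult by (simp add: quad_int_def)
    thus ?thesis by (simp add: nu_def w_def wc_def flip: power_mult_distrib)
  qed
  have wn: "Z.cg 2 (w ^ ?n) (of_int nu)"
    unfolding nu using Z.cg_left[OF wp Or(3)] by simp
  have wcn: "Z.cg 2 (wc ^ ?n) (of_int nu)"
    unfolding nu using Z.cg_left[OF wcp Or(4)] by (simp add: mult.commute)
  have un1: "Z.un 1 z" if "Z.un 2 z" for z
    using that Z.cg_weaken unfolding Z.un_def by blast
  have unpow: "Z.un 2 (w ^ k)" for k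
  proof (rule Z.un_power)
    have "0 < ?Q" unfolding Q(2) using M_pos by simp
    hence "w * w ^ (?Q - 1) = w ^ ?Q" using power_minus_mult[of ?Q w] by (simp only: mult.commute)
    thus "Z.un 2 w" unfolding Z.un_def using Or(3) wQ Z.Or_power[OF Or(3)] by metis
  qed
  have unwc: "Z.un 2 wc" by (rule Z.un_cong[OF unpow Z.cg_sym[OF wp]])
  define e where "e k = L (v k)" for k
  have half: "Z.cg 2 (w ^ (M * ?n)) (- 1)"
  proof -
    have nd: "\<not> ?Q dvd M * ?n" unfolding Q(2) using M_pos by (auto dest: dvd_imp_le)
    have "(w ^ (M * ?n) - 1) * (w ^ (M * ?n) + 1) = w ^ ?Q - 1"
    proof -
      have "(z - 1) * (z + 1) = z * z - 1" for z :: complex by (simp add: algebra_simps)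
      thus ?thesis unfolding Q(2) mult_2 power_add[of w "M * ?n" "M * ?n"] .
    qed
    hence "Z.cg 2 ((w ^ (M * ?n) - 1) * (w ^ (M * ?n) + 1)) ((w ^ (M * ?n) - 1) * 0)"
      using Z.cg_diff[OF wQ Z.cg_refl[OF Z.Or_1]] by simp
    from Z.un_cancel[OF unw[OF nd] this] have "Z.cg 2 (w ^ (M * ?n) + 1) 0" using Or(3) by (auto intro!: Z.Or_intros)
    from Z.cg_diff[OF this Z.cg_refl[OF Z.Or_1]] show ?thesis by simp
  qed
  \<comment> \<open>The norm of a generator is a non-residue: \<open>nu^M\<close> is
    \<open>w\<close> to half of its order. This produces the sign \<open>c = -1\<close>.\<close>
  have Lnu: "L nu = - 1"
  proof -
    have "Z.cg 2 (of_int (nu ^ M)) ((w ^ ?n) ^ M)" using Z.cg_power[OF Z.cg_sym[OF wn], of M] by simp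
    also have "(w ^ ?n) ^ M = w ^ (M * ?n)" by (simp only: power_mult[symmetric] mult.commute)
    also note half
    finally have "Z.cg 1 (of_int (nu ^ M)) (of_int (- 1))" using Z.cg_weaken by simp
    hence "[nu ^ M = - 1] (mod int p)" unfolding Z.cg_of_int by simp
    thus ?thesis using L_euler[of nu] cong_trans by (intro L_eqI) blast+
  qed
  have icong: "[s = t] (mod int p)" if "Z.cg 2 (of_int s) (of_int t)" for s t
    using Z.cg_weaken[OF that] unfolding Z.cg_of_int by simp
  have per: "e (k + ?n) = - 1 * e k" for k
  proof -
    have "Z.cg 2 (w ^ k * w ^ ?n + wc ^ k * wc ^ ?n) (w ^ k * of_int nu + wc ^ k * of_int nu)"
      by (intro Z.cg_add Z.cg_left wn wcn Z.Or_power Or)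
    hence "Z.cg 2 (of_int (v (k + ?n))) (of_int (nu * v k))" by (simp only: v of_int_mult power_add) (simp add: algebra_simps)
    from L_cong[OF icong[OF this]] show ?thesis by (simp add: e_def L_mult Lnu)
  qed
  have rfl: "e (?n - k) = - 1 * (-1) ^ k * e k" if k: "k \<le> ?n" for k
  proof -
    have "w ^ k * w ^ (?n - k) = w ^ ?n" "wc ^ k * wc ^ (?n - k) = wc ^ ?n"
      using power_add[of w k "?n - k"] power_add[of wc k "?n - k"] k by (simp_all only: le_add_diff_inverse)
    hence "of_int (nu ^ k * v (?n - k)) = wc ^ k * w ^ ?n + w ^ k * wc ^ ?n"
      by (simp only: of_int_mult of_int_power nu v power_mult_distrib distrib_left) (simp add: mult_ac)
    also have "Z.cg 2 \<dots> (wc ^ k * of_int nu + w ^ k * of_int nu)"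
      by (intro Z.cg_add Z.cg_left wn wcn Z.Or_power Or)
    also have "wc ^ k * of_int nu + w ^ k * of_int nu = of_int (nu * v k)" by (simp only: of_int_mult v) (simp add: algebra_simps)
    finally have "(-1) ^ k * e (?n - k) = - e k" using L_cong[OF icong] by (fastforce simp: e_def L_mult L_power Lnu)
    moreover have "(-1) ^ k * ((-1) ^ k * e (?n - k)) = e (?n - k)" by (simp add: mult.assoc[symmetric] flip: power_mult_distrib)
    ultimately show ?thesis by simp
  qed
  have pn: "(p - 1) * k + k = p * k" for k using p_gt by (simp add: diff_mult_distrib)
  have wpk: "Z.cg 2 (wc ^ k) (w ^ (p * k))" for k
    using Z.cg_power[OF Z.cg_sym[OF wp], of k] by (simp flip: power_mult)
  have nQ: "\<not> ?Q dvd (p - 1) * k" if "\<not> ?n dvd k" for k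
    unfolding Q(1) nat_mult_dvd_cancel_disj using that p_gt by auto
  \<comment> \<open>Up to a unit \<open>v k\<close> is \<open>w^((p - 1) k + M (p + 1)) - 1\<close>,
    and the exponent is a multiple of \<open>p^2 - 1\<close> only for
    \<open>k = M + 1\<close>.\<close>
  have unv: "\<not> int p dvd v k" if k: "k < ?n" "k \<noteq> Suc M" for k
  proof -
    have "\<not> ?n dvd k + Suc M"
    proof
      assume "?n dvd k + Suc M"
      then obtain c where c: "k + Suc M = ?n * c" by (elim dvdE)
      have "c < 2"
      proof (rule ccontr)
        assume "\<not> c < 2"
        hence "?n * 2 \<le> ?n * c" by (intro mult_le_mono2) simp
        hence "?n * 2 \<le> k + Suc M" unfolding c .
        thus False using k(1) p_eq by simp
      qed
      moreover have "c \<noteq> 0" using c by (cases c) auto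
      ultimately have "c = 1" by simp
      thus False using c k p_eq by simp
    qed
    hence "\<not> ?Q dvd (p - 1) * (k + Suc M)" by (rule nQ)
    moreover have "(p - 1) * (k + Suc M) = (p - 1) * k + M * ?n" using p_eq by (simp add: distrib_left)
    ultimately have "\<not> ?Q dvd (p - 1) * k + M * ?n" by metis
    hence u: "Z.un 2 (w ^ ((p - 1) * k + M * ?n) - 1)" by (rule unw)
    have "Z.cg 2 (of_int (v k)) (w ^ k + w ^ ((p - 1) * k + k))"
      unfolding v pn by (intro Z.cg_add wpk Z.cg_refl Z.Or_power Or)
    also have "w ^ k + w ^ ((p - 1) * k + k) = - (w ^ k * (w ^ ((p - 1) * k) * (- 1) - 1))" by (simp add: power_add algebra_simps)
    also have "Z.cg 2 \<dots> (- (w ^ k * (w ^ ((p - 1) * k) * w ^ (M * ?n) - 1)))"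
      by (intro Z.cg_uminus Z.cg_left Z.cg_diff Z.cg_sym[OF half] Z.cg_refl Z.Or_intros Or)
    finally have "Z.cg 1 (of_int (v k)) (- (w ^ k * (w ^ ((p - 1) * k + M * ?n) - 1)))"
      unfolding power_add[of w "(p - 1) * k"] by (rule Z.cg_weaken)
    thus ?thesis by (rule Z.un_int[OF un1[OF Z.un_uminus[OF Z.un_mult[OF unpow u]]]])
  qed
  have v0: "int p dvd v (Suc M)"
  proof -
    have "Z.cg 2 (of_int (v (Suc M))) (w ^ Suc M + w ^ ((p - 1) * Suc M + Suc M))"
      unfolding v pn by (intro Z.cg_add wpk Z.cg_refl Z.Or_power Or)
    also have "(p - 1) * Suc M = M * ?n" using p_eq by simp
    also have "w ^ Suc M + w ^ (M * ?n + Suc M) = w ^ Suc M + w ^ Suc M * w ^ (M * ?n)" by (simp add: power_add)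
    also have "Z.cg 2 \<dots> (w ^ Suc M + w ^ Suc M * (- 1))"
      by (intro Z.cg_add Z.cg_left half Z.cg_refl Z.Or_power Or)
    also have "w ^ Suc M + w ^ Suc M * (- 1) = of_int 0" by simp
    finally have "[v (Suc M) = 0] (mod int p)" by (rule icong)
    thus ?thesis by (simp add: cong_0_iff)
  qed
  have e0: "e k = 0 \<longleftrightarrow> k = Suc M" if "k < ?n" for k
    using unv[OF that] v0 by (auto simp: e_def L_0_iff)
  have corr: "(\<Sum>k<?n. e k * e (k + j)) = (if j = 0 then int p else 0) - 0 * (1 + (-1) ^ j)" if j: "j < ?n" for j
  proof (cases "j = 0")
    case True
    have "(\<Sum>k<?n. e k * e (k + j)) = (\<Sum>k<?n. if k = Suc M then 0 else 1)"
    proof (intro sum.cong refl)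
      fix k assume "k \<in> {..<?n}"
      hence "e k = 0 \<longleftrightarrow> k = Suc M" using e0 by simp
      thus "e k * e (k + j) = (if k = Suc M then 0 else 1)" using True L_sq[of "v k"] by (auto simp: e_def)
    qed
    also have "\<dots> = (\<Sum>k\<in>{..<?n} - {Suc M}. 1)" by (rule sum.mono_neutral_cong_right) auto
    also have "\<dots> = int p" using p_eq by simp
    finally show ?thesis using True by simp
  next
    case False
    have nj: "\<not> ?n dvd j" using False j by (auto dest: dvd_imp_le)
    \<comment> \<open>The determinant factors as \<open>(w^j - wc^j) (w^k wc^l - wc^k w^l)\<close>.
      The \<open>p + 1\<close> points are thus distinct and fill the projective line without
      additions, so \<open>t = 0\<close>.\<close>
    have lt: "\<not> int p dvd v (k + j) * v l - v (l + j) * v k" if kl: "k < l" "l < ?n" for k l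
    proof -
      have "of_int (v (k + j) * v l - v (l + j) * v k) = (w ^ j - wc ^ j) * (w ^ k * wc ^ l - wc ^ k * w ^ l)"
        by (simp add: v power_add algebra_simps)
      also have "Z.cg 2 \<dots> ((w ^ j - w ^ (p * j)) * (w ^ k * w ^ (p * l) - w ^ (p * k) * w ^ l))"
        by (intro Z.cg_mult Z.cg_diff wpk Z.cg_refl Z.Or_power Or)
      also have "(w ^ j - w ^ (p * j)) * (w ^ k * w ^ (p * l) - w ^ (p * k) * w ^ l)
         = - (w ^ j * (w ^ ((p - 1) * j) - 1) * (w ^ (k + l) * w ^ ((p - 1) * k) * (w ^ ((p - 1) * (l - k)) - 1)))"
      proof -
        have "(p - 1) * l = (p - 1) * k + (p - 1) * (l - k)" using kl by (simp flip: distrib_left)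
        thus ?thesis unfolding pn[symmetric] by (simp add: power_add algebra_simps)
      qed
      finally have "Z.cg 1 (of_int (v (k + j) * v l - v (l + j) * v k))
        (- (w ^ j * (w ^ ((p - 1) * j) - 1) * (w ^ (k + l) * w ^ ((p - 1) * k) * (w ^ ((p - 1) * (l - k)) - 1))))"
        by (rule Z.cg_weaken)
      moreover have "\<not> ?n dvd l - k" using kl by (auto dest: dvd_imp_le)
      hence "Z.un 2 (- (w ^ j * (w ^ ((p - 1) * j) - 1) * (w ^ (k + l) * w ^ ((p - 1) * k) * (w ^ ((p - 1) * (l - k)) - 1))))"
        by (intro Z.un_uminus Z.un_mult unpow unw nQ nj)
      ultimately show ?thesis using Z.un_int un1 by blast
    qed
    have npr: "\<not> int p dvd v (k + j) * v l - v (l + j) * v k" if "k \<in> {..<?n}" "l \<in> {..<?n}" "k \<noteq> l" for k l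
      using that lt[of k l] lt[of l k] dvd_minus_iff[of "int p" "v (k + j) * v l - v (l + j) * v k"]
      by (cases k l rule: linorder_cases) auto
    have "(\<Sum>k<?n. L (v (k + j) * v k)) = 0"
      by (rule sum_L_projective[where a = "\<lambda>k. v (k + j)" and b = v, OF _ _ N npr]) auto
    thus ?thesis using False by (simp add: e_def L_mult mult.commute)
  qed
  \<comment> \<open>Modulo \<open>p^2\<close> this is \<open>w / wc\<close>, of order
    \<open>p + 1\<close>, so that \<open>w^k + wc^k = wc^k (1 + u^k)\<close>.\<close>
  define u where "u = w ^ (p * (p - 1))"
  have u: "u \<in> range (quad_int N)" unfolding u_def by (intro Z.Or_power Or)
  have un_: "Z.cg 2 (u ^ ?n) 1"
  proof -
    have "p * (p - 1) * ?n = ?Q * p" unfolding Q(1) by (simp add: mult_ac)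
    hence "u ^ ?n = (w ^ ?Q) ^ p" unfolding u_def by (simp only: power_mult[symmetric])
    thus ?thesis using Z.cg_power[OF wQ, of p] by simp
  qed
  have unu: "Z.un 2 (u ^ k - 1)" if "\<not> ?n dvd k" for k
  proof -
    have "coprime ?n p" by simp
    hence "\<not> ?n dvd p * k" using that by (simp only: coprime_dvd_mult_right_iff not_False_eq_True)
    hence "\<not> ?Q dvd (p - 1) * (p * k)" by (rule nQ)
    from unw[OF this] show ?thesis by (simp add: u_def mult_ac flip: power_mult)
  qed
  have wcu: "Z.cg 2 (wc * u) w"
  proof -
    have "Z.cg 2 (wc * u) (w ^ p * u)" by (rule Z.cg_right[OF Z.cg_sym[OF wp] u])
    also have "w ^ p * u = w * w ^ ?Q"
    proof -
      have "p + p * (p - 1) = p * p" using p_gt by (simp add: diff_mult_distrib2)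
      hence "w ^ p * u = w ^ (p * p)" by (simp only: u_def power_add[symmetric])
      thus ?thesis unfolding Q(4) by simp
    qed
    also have "Z.cg 2 \<dots> (w * 1)" by (rule Z.cg_left[OF wQ Or(3)])
    finally show ?thesis by simp
  qed
  define q where "q = M * r"
  define g h where "g = w ^ q" and "h = w ^ (?Q - q)"
  have gh_in: "g \<in> range (quad_int N)" "h \<in> range (quad_int N)" unfolding g_def h_def by (auto intro!: Z.Or_power Or)
  have m0: "m > 0" using md by auto
  have q0: "q > 0" using M_pos r0 by (simp add: q_def)
  have qQ: "?Q = m * q" using Q(3) by (simp add: q_def)
  have gm: "Z.cg 2 (g ^ m) 1" using wQ qQ by (simp add: g_def mult.commute flip: power_mult)
  have ung: "Z.un 2 (g ^ j - 1)" if "\<not> m dvd j" for j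
  proof -
    have "\<not> ?Q dvd q * j" unfolding qQ using that q0 by (simp add: mult.commute)
    thus ?thesis using unw by (simp add: g_def flip: power_mult)
  qed
  have "q \<le> ?Q" using qQ m0 by simp
  hence gh: "Z.cg 2 (g * h) 1" using wQ power_add[of w q "?Q - q"] by (simp only: g_def h_def le_add_diff_inverse)
  have i0M: "i0 \<le> M" using i0 p_eq r0 by simp
  \<comment> \<open>The choice \<open>2 i0 + r = p\<close> gives
    \<open>p M - q = (p - 1) i0\<close>, and \<open>w^(p - 1)\<close> is the inverse of
    \<open>u\<close>; hence the left side is \<open>u^(- i0)\<close>.\<close>
  have hu: "Z.cg 2 (h * wc ^ M) (u ^ (?n - i0))"
  proof -
    have "p * M = (p - 1) * i0 + q"
    proof -
      have "(p - 1) * i0 + q = M * (2 * i0 + r)" using p_eq by (simp add: q_def algebra_simps)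
      thus ?thesis unfolding i0 by (simp add: mult.commute)
    qed
    hence ex: "(?Q - q) + p * M = ?Q + (p - 1) * i0" using \<open>q \<le> ?Q\<close> by simp
    have "Z.cg 2 (h * wc ^ M) (h * w ^ (p * M))" by (intro Z.cg_left wpk gh_in)
    also have "h * w ^ (p * M) = w ^ ?Q * w ^ ((p - 1) * i0)" unfolding h_def by (simp only: power_add[symmetric] ex)
    also have "Z.cg 2 \<dots> (1 * w ^ ((p - 1) * i0))" by (intro Z.cg_right wQ Z.Or_power Or)
    also have "1 * w ^ ((p - 1) * i0) = w ^ ((p - 1) * i0) * 1" by simp
    also have "Z.cg 2 \<dots> (w ^ ((p - 1) * i0) * u ^ ?n)" by (intro Z.cg_left Z.cg_sym[OF un_] Z.Or_power Or)
    also have "w ^ ((p - 1) * i0) * u ^ ?n = (w ^ ?Q) ^ i0 * (w ^ 0 * u ^ (?n - i0)) "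
    proof -
      have s: "u ^ ?n = u ^ i0 * u ^ (?n - i0)" using power_add[of u i0 "?n - i0"] i0M p_eq by simp
      have "t * i0 + p * t * i0 = t * (p + 1) * i0" for t by (simp add: algebra_simps)
      hence "(p - 1) * i0 + p * (p - 1) * i0 = ?Q * i0" unfolding Q(1) .
      hence "w ^ ((p - 1) * i0) * u ^ i0 = (w ^ ?Q) ^ i0" unfolding u_def by (simp only: power_mult[symmetric] power_add[symmetric])
      thus ?thesis unfolding s by (simp add: mult.assoc[symmetric])
    qed
    also have "Z.cg 2 \<dots> (1 ^ i0 * (w ^ 0 * u ^ (?n - i0)))" by (intro Z.cg_right Z.cg_power wQ Z.Or_mult Z.Or_power Or u)
    finally show ?thesis by simp
  qed
  have E: "Z.cg 2 (\<Sum>k<?n. of_int (e k) * h ^ k) (of_int (X_inert i0))"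
  proof -
    have "Z.cg 2 (\<Sum>k<?n. of_int (e k) * h ^ k) (\<Sum>k<?n. u ^ (k * (?n - i0)) * ((1 + u ^ k) ^ M + of_nat p * (of_nat M * (1 + u ^ k) ^ (M - 1)
        * (u ^ k * (\<Sum>r=1..<p. of_int (phi r) * u ^ (k * r))))))"
    proof (rule Z.cg_sum)
      fix k
      let ?P = "\<Sum>r=1..<p. of_int (phi r) * u ^ (k * r)"
      have I: "w ^ k \<in> range (quad_int N)" "wc ^ k \<in> range (quad_int N)" "u ^ k \<in> range (quad_int N)" by (auto intro!: Z.Or_power Or u)
      have P: "?P \<in> range (quad_int N)" by (intro Z.Or_intros u)
      have x1: "Z.cg 2 ((w ^ k) ^ p) (wc ^ k)" using Z.cg_power[OF wp, of k] by (simp add: mult.commute flip: power_mult)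
      have x2: "Z.cg 2 ((wc ^ k) ^ p) (w ^ k)" using Z.cg_power[OF wcp, of k] by (simp add: mult.commute flip: power_mult)
      have x3: "Z.cg 2 (w ^ k) (wc ^ k * u ^ k)" using Z.cg_sym[OF Z.cg_power[OF wcu, of k]] by (simp add: power_mult_distrib)
      have s: "Z.cg 2 (wc ^ k + w ^ k) (wc ^ k * (1 + u ^ k))"
        using Z.cg_add[OF Z.cg_refl[OF I(2)] x3] by (simp add: distrib_left)
      \<comment> \<open>Extracting \<open>(wc^k)^p\<close>, which is \<open>w^k = wc^k u^k\<close>
        modulo \<open>p^2\<close>, leaves the additional \<open>u^k\<close> that shifts
        \<open>i + r\<close> by one.\<close>
      have S: "Z.cg 2 (\<Sum>r=1..<p. of_int (phi r) * (w ^ k) ^ r * (wc ^ k) ^ (p - r)) (wc ^ k * (u ^ k * ?P))"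
      proof -
        have "Z.cg 2 (\<Sum>r=1..<p. of_int (phi r) * (w ^ k) ^ r * (wc ^ k) ^ (p - r))
          (\<Sum>r=1..<p. of_int (phi r) * (wc ^ k * u ^ k) ^ r * (wc ^ k) ^ (p - r))"
          by (intro Z.cg_sum Z.cg_right Z.cg_left Z.cg_power x3 Z.Or_power Z.Or_int Or)
        also have "(\<Sum>r=1..<p. of_int (phi r) * (wc ^ k * u ^ k) ^ r * (wc ^ k) ^ (p - r)) = (wc ^ k) ^ p * ?P"
          unfolding sum_distrib_left
        proof (intro sum.cong refl)
          fix r assume "r \<in> {1..<p}"
          hence A: "(wc ^ k) ^ p = (wc ^ k) ^ r * (wc ^ k) ^ (p - r)" using power_add[of "wc ^ k" r "p - r"] by simp
          show "of_int (phi r) * (wc ^ k * u ^ k) ^ r * (wc ^ k) ^ (p - r) = (wc ^ k) ^ p * (of_int (phi r) * u ^ (k * r))"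
            unfolding A power_mult power_mult_distrib by (simp only: mult_ac)
        qed
        also have "Z.cg 2 \<dots> (wc ^ k * u ^ k * ?P)" by (rule Z.cg_right[OF Z.cg_trans[OF x2 x3] P])
        finally show ?thesis by (simp add: mult.assoc)
      qed
      have "Z.cg 2 (of_int (e k)) ((w ^ k + wc ^ k) ^ (p * M))"
        using Z.L_lift[of "v k"] by (simp only: e_def v)
      also have "Z.cg 2 \<dots> ((wc ^ k + w ^ k) ^ M
          + of_nat p * (of_nat M * (wc ^ k + w ^ k) ^ (M - 1) * (\<Sum>r=1..<p. of_int (phi r) * (w ^ k) ^ r * (wc ^ k) ^ (p - r))))"
        by (rule Z.cg_pow_pM[OF I(1,2) x1 x2])
      also have "Z.cg 2 \<dots> ((wc ^ k * (1 + u ^ k)) ^ M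
          + of_nat p * (of_nat M * (wc ^ k * (1 + u ^ k)) ^ (M - 1) * (wc ^ k * (u ^ k * ?P))))"
        by (intro Z.cg_add Z.cg_left[OF _ Z.Or_nat] Z.cg_mult[OF Z.cg_left[OF _ Z.Or_nat] S] Z.cg_power s)
      also have "(wc ^ k * (1 + u ^ k)) ^ M
          + of_nat p * (of_nat M * (wc ^ k * (1 + u ^ k)) ^ (M - 1) * (wc ^ k * (u ^ k * ?P)))
        = (wc ^ k) ^ M * ((1 + u ^ k) ^ M + of_nat p * (of_nat M * (1 + u ^ k) ^ (M - 1) * (u ^ k * ?P)))"
      proof -
        have "(c * y) ^ M + s * (t * (c * y) ^ (M - 1) * (c * R)) = c ^ M * (y ^ M + s * (t * y ^ (M - 1) * R))"
          for c y s t R :: complex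
        proof -
          have "c ^ M = c ^ (M - 1) * c" using M_pos by (metis Suc_pred' power_Suc2)
          thus ?thesis by (simp add: power_mult_distrib distrib_left mult_ac)
        qed
        thus ?thesis .
      qed
      finally have "Z.cg 2 (of_int (e k) * h ^ k) ((wc ^ k) ^ M * ((1 + u ^ k) ^ M + of_nat p * (of_nat M * (1 + u ^ k) ^ (M - 1) * (u ^ k * ?P))) * h ^ k)"
        by (rule Z.cg_right[OF _ Z.Or_power[OF gh_in(2)]])
      also have "\<dots> = (h * wc ^ M) ^ k * ((1 + u ^ k) ^ M + of_nat p * (of_nat M * (1 + u ^ k) ^ (M - 1) * (u ^ k * ?P)))"
        by (simp add: power_mult_distrib mult_ac flip: power_mult)
      also have "Z.cg 2 \<dots> ((u ^ (?n - i0)) ^ k * ((1 + u ^ k) ^ M + of_nat p * (of_nat M * (1 + u ^ k) ^ (M - 1) * (u ^ k * ?P))))"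
        by (intro Z.cg_right Z.cg_power hu) (intro Z.Or_add Z.Or_mult Z.Or_power Z.Or_nat Z.Or_1 P u)
      finally show "Z.cg 2 (of_int (e k) * h ^ k) (u ^ (k * (?n - i0)) * ((1 + u ^ k) ^ M + of_nat p * (of_nat M * (1 + u ^ k) ^ (M - 1) * (u ^ k * ?P))))"
        by (simp add: mult.commute[of k] power_mult)
    qed
    also have "Z.cg 2 \<dots> (of_int (X_inert i0))"
      by (rule Z.eval_X_inert[OF u Z.orthogonality[OF u un_ unu] i0M])
    finally show ?thesis .
  qed
  have c: "- 1 = (- 1 :: int) ^ r" using r(2) by simp
  note T = Z.trace_identity[where e = e and c = "- 1" and t = 0, OF md _ _ _ per rfl corr _ r(1) c gh_in(1) gm ung gh_in(2) gh E]
  have en: "even ?n" using p_odd by simp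
  show ?thesis
  proof (rule that)
    show "(\<Sum>k<?n. fst (lucas d k) * e k)\<^sup>2 + d * (\<Sum>k<?n. snd (lucas d k) * e k)\<^sup>2 = 4 * int p"
      by (rule T(1)) (use en in auto)
    show "[(X_inert i0)\<^sup>2 + int p = (\<Sum>k<?n. fst (lucas d k) * e k) * X_inert i0] (mod int p ^ 2)"
      by (rule T(2)) (use en in auto)
  next
    assume "d = 1"
    hence "m = 12" using md by auto
    hence j: "?n = 6 * r" "Suc M = 3 * r" using r(1) p_eq by auto
    have "[(\<Sum>k<6 * r. fst (lucas 1 k) * e k) = (if even r then 2 else 0)] (mod 4)"
    proof (rule trace_1_mod_4)
      show "e (6 * r - k) = (- 1) ^ r * (- 1) ^ k * e k" if "k \<le> 6 * r" for k
        using rfl[of k] that r(2) unfolding j(1) by simp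
      show "odd (e k)" if "k < 6 * r" "k \<noteq> 3 * r" for k
        using e0[of k] that L_values[of "v k"] unfolding j by (auto simp: e_def)
      show "e (3 * r) = 0" using e0[of "Suc M"] r0 unfolding j by simp
    qed (use r0 in simp)
    thus "[(\<Sum>k<?n. fst (lucas d k) * e k) = 0] (mod 4)" using \<open>d = 1\<close> r(2) unfolding j(1) by simp
  qed
qed

end

section \<open>The three special values\<close>

lemma mod_12_cases:
  fixes p :: nat
  assumes "\<not> 3 dvd p"
  shows "p mod 4 = 1 \<Longrightarrow> p mod 12 = 1 \<or> p mod 12 = 5" and "p mod 4 = 3 \<Longrightarrow> p mod 12 = 7 \<or> p mod 12 = 11"
proof -
  have 1: "(p mod 12) mod 3 \<noteq> 0" "(p mod 12) mod 4 = p mod 4"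
    using assms by (simp_all add: mod_mod_cancel dvd_eq_mod_eq_0)
  have "r < 12 \<Longrightarrow> r mod 3 \<noteq> 0 \<Longrightarrow> (r mod 4 = 1 \<longrightarrow> r = 1 \<or> r = 5) \<and> (r mod 4 = 3 \<longrightarrow> r = 7 \<or> r = 11)" for r :: nat
    by presburger
  from this[of "p mod 12"] show "p mod 4 = 1 \<Longrightarrow> p mod 12 = 1 \<or> p mod 12 = 5" "p mod 4 = 3 \<Longrightarrow> p mod 12 = 7 \<or> p mod 12 = 11"
    using 1 by auto
qed

lemma even_of_mult_square:
  fixes d B c :: int
  assumes "d * B\<^sup>2 = 4 * c" "\<not> 4 dvd d" shows "even B"
proof (rule ccontr)
  assume "odd B"
  hence "coprime 2 B" by (simp add: coprime_left_2_iff_odd)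
  hence "coprime (2\<^sup>2) (B\<^sup>2)" by (intro coprime_power_left_iff[THEN iffD2] coprime_power_right_iff[THEN iffD2] disjI1)
  moreover have "2\<^sup>2 dvd d * B\<^sup>2" using assms(1) by simp
  ultimately have "2\<^sup>2 dvd d" by (simp only: coprime_dvd_mult_left_iff)
  thus False using assms(2) by simp
qed

text \<open>Brahmagupta's identity with \<open>a v - b u = p k\<close>, after a possible change of
  sign of \<open>u\<close>, forces \<open>d k^2 <= 1\<close>. The case \<open>k = 0\<close> gives
  \<open>a^2 = u^2\<close>; otherwise \<open>d = 1\<close> and the two squares are
  interchanged.\<close>

lemma square_representation_unique:
  fixes a b u v d :: int
  assumes p: "prime p" "a\<^sup>2 + d * b\<^sup>2 = p" "u\<^sup>2 + d * v\<^sup>2 = p" and d: "d > 0"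
  shows "a\<^sup>2 = u\<^sup>2 \<or> d = 1 \<and> a\<^sup>2 = v\<^sup>2"
proof -
  have main: "a\<^sup>2 = u\<^sup>2 \<or> d = 1 \<and> a\<^sup>2 = v\<^sup>2" if t: "p dvd a * v - b * u" and uv: "u\<^sup>2 + d * v\<^sup>2 = p" for u v
  proof -
    obtain k where k: "a * v - b * u = p * k" using t by auto
    have p0: "p > 0" using p(1) by (rule prime_gt_0_int)
    have "p\<^sup>2 = (a\<^sup>2 + d * b\<^sup>2) * (u\<^sup>2 + d * v\<^sup>2)" using p(2) uv by (simp add: power2_eq_square)
    also have "\<dots> = (a * u + d * b * v)\<^sup>2 + d * (a * v - b * u)\<^sup>2" by (simp add: power2_eq_square algebra_simps)
    finally have e: "p\<^sup>2 = (a * u + d * b * v)\<^sup>2 + d * k\<^sup>2 * p\<^sup>2" unfolding k by (simp add: power_mult_distrib algebra_simps)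
    hence "d * k\<^sup>2 * p\<^sup>2 \<le> 1 * p\<^sup>2" using zero_le_power2[of "a * u + d * b * v"] by linarith
    hence dk: "d * k\<^sup>2 \<le> 1" using p0 by (subst (asm) mult_le_cancel_right) auto
    show ?thesis
    proof (cases "k = 0")
      case True
      hence "(a * v)\<^sup>2 = (b * u)\<^sup>2" using k by simp
      hence "a\<^sup>2 * (d * v\<^sup>2) = (d * b\<^sup>2) * u\<^sup>2" by (simp add: power_mult_distrib algebra_simps)
      moreover have "d * v\<^sup>2 = p - u\<^sup>2" "d * b\<^sup>2 = p - a\<^sup>2" using p(2) uv by simp_all
      ultimately have "p * a\<^sup>2 = p * u\<^sup>2" by (simp add: algebra_simps)
      thus ?thesis using p0 by simp
    next
      case False
      hence "k\<^sup>2 > 0" by simp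
      hence k2: "k\<^sup>2 \<ge> 1" by linarith
      have "d * 1 \<le> d * k\<^sup>2" using k2 d by (intro mult_left_mono) auto
      hence d1: "d = 1" using dk d by linarith
      hence "k\<^sup>2 = 1" using dk k2 by simp
      hence "(a * u + b * v)\<^sup>2 = 0" using e d1 by simp
      hence "(a * u)\<^sup>2 = (b * v)\<^sup>2" by (simp add: eq_neg_iff_add_eq_0[symmetric] add_eq_0_iff2)
      hence "a\<^sup>2 * u\<^sup>2 = b\<^sup>2 * v\<^sup>2" by (simp add: power_mult_distrib)
      moreover have "u\<^sup>2 = p - v\<^sup>2" "b\<^sup>2 = p - a\<^sup>2" using p(2) uv d1 by simp_all
      ultimately have "p * a\<^sup>2 = p * v\<^sup>2" by (simp add: algebra_simps)
      thus ?thesis using p0 d1 by simp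
    qed
  qed
  have "(a * v - b * u) * (a * v + b * u) = v\<^sup>2 * (a\<^sup>2 + d * b\<^sup>2) - b\<^sup>2 * (u\<^sup>2 + d * v\<^sup>2)"
    by (simp add: power2_eq_square algebra_simps)
  also have "\<dots> = p * (v\<^sup>2 - b\<^sup>2)" unfolding p(2,3) by (simp add: algebra_simps)
  finally have "p dvd (a * v - b * u) * (a * v + b * u)" by simp
  hence "p dvd a * v - b * u \<or> p dvd a * v - b * (- u)" using p(1) by (simp add: prime_dvd_mult_iff)
  thus ?thesis using main[of v u] main[of v "- u"] p(3) by auto
qed

context odd_prime
begin

section \<open>The value of Y at -2/m\<close>

lemma nonresidue_exists: obtains N where "L N = - 1"
proof -
  obtain w :: int where w: "\<And>j. [w ^ j = 1] (mod int p) \<longleftrightarrow> (p - 1) dvd j" "\<not> int p dvd w"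
    by (rule primitive_root_exists) blast
  have "\<not> [w ^ M = 1] (mod int p)" using w(1)[of M] p_eq M_pos by (auto dest: dvd_imp_le)
  hence "L w \<noteq> 1" using L_euler[of w] by (metis cong_sym)
  hence "L w = - 1" using L_values[of w] L_0_iff[of w] w(2) by auto
  thus ?thesis by (rule that)
qed

text \<open>Squaring the relation produces \<open>X^4 + 2 p X^2\<close> modulo \<open>p^2\<close>,
  and the unit \<open>X^2\<close> cancels.\<close>

lemma unit_root_square:
  assumes X: "[X\<^sup>2 + int p = A * X] (mod int p ^ 2)" "\<not> int p dvd X" and S: "zp_cong p 2 S ((of_int X)\<^sup>2)"
  shows "zp_cong p 2 S (of_int (A\<^sup>2 - 2 * int p))"
proof -
  have "[(X\<^sup>2 + int p)\<^sup>2 = (A * X)\<^sup>2] (mod int p ^ 2)" by (rule cong_pow[OF X(1)])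
  hence "int p ^ 2 dvd (A * X)\<^sup>2 - (X\<^sup>2 + int p)\<^sup>2" by (simp add: cong_iff_dvd_diff dvd_diff_commute)
  also have "(A * X)\<^sup>2 - (X\<^sup>2 + int p)\<^sup>2 = X\<^sup>2 * (A\<^sup>2 - 2 * int p - X\<^sup>2) - int p ^ 2"
    by (simp add: power2_eq_square algebra_simps)
  finally have "int p ^ 2 dvd X\<^sup>2 * (A\<^sup>2 - 2 * int p - X\<^sup>2)" by (simp add: dvd_diff_left_iff)
  moreover have "coprime (int p ^ 2) (X\<^sup>2)" using X(2) pint by (simp add: prime_imp_coprime)
  ultimately have "int p ^ 2 dvd A\<^sup>2 - 2 * int p - X\<^sup>2" by (simp only: coprime_dvd_mult_right_iff)
  hence "[X\<^sup>2 = A\<^sup>2 - 2 * int p] (mod int p ^ 2)" by (simp add: cong_iff_dvd_diff dvd_diff_commute)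
  hence "zp_cong p 2 (of_int (X\<^sup>2)) (of_int (A\<^sup>2 - 2 * int p))" unfolding zp_cong_of_int .
  thus ?thesis using S zp_cong_trans by (simp only: of_int_power)
qed

text \<open>Since \<open>p - 1 = m i0\<close>, one has \<open>x = p x + 2 i0\<close>, so the point
  lies on the chain with \<open>t = x\<close>. As \<open>A\<close> and then \<open>B\<close> are
  even, \<open>4 p\<close> descends to \<open>p\<close>.\<close>

lemma Y_split:
  assumes md: "(m, d) \<in> {(6, 3), (8, 2), (12, 1)}" and mp: "m dvd p - 1" and p3: "p > 3"
    and x: "x = - (2 / of_nat m)" "x \<in> Zp p"
  obtains a b where "a\<^sup>2 + d * b\<^sup>2 = int p" "zp_cong p 2 (Y coeffW x) (of_int (4 * a\<^sup>2 - 2 * int p))" "d = 1 \<Longrightarrow> odd a"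
proof -
  obtain A B where AB: "A\<^sup>2 + d * B\<^sup>2 = 4 * int p" "[(X_split ((p - 1) div m))\<^sup>2 + int p = A * X_split ((p - 1) div m)] (mod int p ^ 2)"
    "d = 3 \<Longrightarrow> even A" "d = 1 \<Longrightarrow> [A = 2] (mod 4)" using trace_split[OF md mp] by blast
  define i0 where "i0 = (p - 1) div m"
  have m: "m > 0" "m \<ge> 6" using md by auto
  have i0: "p - 1 = m * i0" using mp by (simp add: i0_def)
  have "6 * i0 \<le> m * i0" using m by simp
  hence i0M: "i0 \<le> M" using i0 p_eq by linarith
  have "(of_nat p :: rat) = of_nat (m * i0) + 1" using i0 p_gt by (simp flip: i0)
  hence xe: "x = of_nat p * x + 2 * of_nat i0" using m by (simp add: x field_simps)
  have "zp_cong p 1 (2 * of_nat i0 + of_nat p * x) (2 * of_nat i0)" using x by (intro zp_cong_add_p) auto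
  hence s: "zp_cong p 1 x (2 * of_nat i0)" using xe by (metis add.commute)
  have "zp_cong p 2 (Y coeffW (of_nat p * x + 2 * of_nat i0)) ((of_int (X_split i0))\<^sup>2)"
    by (rule Y_eq_X[OF i0M admissible_coeffW x(2) first_order_X_split[OF i0M] s])
  hence "zp_cong p 2 (Y coeffW x) ((of_int (X_split i0))\<^sup>2)" using xe by simp
  from unit_root_square[OF AB(2)[folded i0_def] X_split_unit[OF i0M] this]
  have S: "zp_cong p 2 (Y coeffW x) (of_int (A\<^sup>2 - 2 * int p))" .
  have "even A"
  proof -
    consider "d = 3" | "d = 2" | "d = 1" using md by auto
    thus ?thesis
    proof cases
      case 2
      hence "A\<^sup>2 = 2 * (2 * int p - B\<^sup>2)" using AB(1) by simp
      hence "even (A\<^sup>2)" by simp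
      thus ?thesis by simp
    next
      case 3
      hence "A mod 4 = 2" using AB(4) by (simp add: cong_def)
      thus ?thesis by presburger
    qed (use AB(3) in auto)
  qed
  then obtain a where a: "A = 2 * a" by auto
  have dB: "d * B\<^sup>2 = 4 * (int p - a\<^sup>2)" using AB(1) a by (simp add: power2_eq_square)
  have "even B" using even_of_mult_square[OF dB] md by auto
  then obtain b where b: "B = 2 * b" by auto
  show ?thesis
  proof (rule that)
    show "a\<^sup>2 + d * b\<^sup>2 = int p" using dB b by (simp add: power_mult_distrib)
    show "zp_cong p 2 (Y coeffW x) (of_int (4 * a\<^sup>2 - 2 * int p))" using S a by (simp add: power_mult_distrib)
    assume "d = 1"
    hence "(2 * a) mod 4 = 2" using AB(4) a by (simp add: cong_def)
    thus "odd a" by presburger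
  qed
qed

text \<open>From \<open>2 (p + 1) = m r\<close> and \<open>2 i0 = p - r\<close> one gets
  \<open>x = p (-1 - x) + 2 i0\<close>, so here \<open>t = -1 - x\<close>.\<close>

lemma Y_inert:
  assumes md: "(m, d) \<in> {(8, 2), (12, 1)}" and r: "p + 1 = (m div 2) * r" "odd r" and p3: "p > 3"
    and x: "x = - (2 / of_nat m)" "x \<in> Zp p"
  obtains a b where "a\<^sup>2 + d * b\<^sup>2 = int p" "zp_cong p 2 (Y coeffW x) (of_int (4 * a\<^sup>2 - 2 * int p))" "d = 1 \<Longrightarrow> even a"
proof -
  obtain N where N: "L N = - 1" by (rule nonresidue_exists)
  define i0 where "i0 = (p - r) div 2"
  have m: "m div 2 \<ge> 4" "m = 2 * (m div 2)" using md by auto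
  have "4 * r \<le> (m div 2) * r" using m by simp
  hence rp: "r \<le> p" using r p_gt by linarith
  have i0: "2 * i0 + r = p" unfolding i0_def using rp r(2) p_odd by simp
  have md': "(m, d) \<in> {(6, 3), (8, 2), (12, 1)}" using md by auto
  obtain A B where AB: "A\<^sup>2 + d * B\<^sup>2 = 4 * int p" "[(X_inert i0)\<^sup>2 + int p = A * X_inert i0] (mod int p ^ 2)"
    "d = 1 \<Longrightarrow> [A = 0] (mod 4)" using trace_inert[OF md' N r i0] by blast
  have r0: "r > 0" using r(2) by (cases r) auto
  have i0M: "i0 \<le> M" using i0 p_eq r0 by linarith
  define t where "t = - 1 - x"
  have tZ: "t \<in> Zp p" unfolding t_def using x by (intro Zp_diff Zp_minus) auto
  have "(of_nat (m div 2) :: rat) * of_nat r = of_nat p + 1" using r(1) by (metis of_nat_1 of_nat_add of_nat_mult)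
  moreover have "(of_nat m :: rat) = 2 * of_nat (m div 2)" using m(2) by (metis of_nat_mult of_nat_numeral)
  moreover have "(of_nat (m div 2) :: rat) \<noteq> 0" using m(1) by simp
  moreover have "(of_nat p :: rat) = 2 * of_nat i0 + of_nat r" using i0 by (metis of_nat_add of_nat_mult of_nat_numeral)
  moreover have "- (2 / (2 * h)) = P * (- 1 - (- (2 / (2 * h)))) + 2 * I" if "h * R = P + 1" "h \<noteq> 0" "P = 2 * I + R" for h R P I :: rat
  proof -
    have "R = (P + 1) / h" using that by (simp add: field_simps)
    hence "2 * I = P - (P + 1) / h" using that(3) by simp
    thus ?thesis using that(2) by (simp add: field_simps)
  qed
  ultimately have xe: "x = of_nat p * t + 2 * of_nat i0" unfolding t_def x(1) by metis
  have mZ: "- (2 * of_nat i0 + 1) \<in> Zp p" by (intro Zp_minus Zp_add Zp_mult) auto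
  have "t = - (2 * of_nat i0 + 1) + of_nat p * (- t)" using xe t_def by linarith
  moreover have "zp_cong p 1 (- (2 * of_nat i0 + 1) + of_nat p * (- t)) (- (2 * of_nat i0 + 1))"
    by (rule zp_cong_add_p[OF mZ Zp_minus[OF tZ]])
  ultimately have s: "zp_cong p 1 t (- (2 * of_nat i0 + 1))" by simp
  have "zp_cong p 2 (Y coeffW (of_nat p * t + 2 * of_nat i0)) ((of_int (X_inert i0))\<^sup>2)"
    by (rule Y_eq_X[OF i0M admissible_coeffW tZ first_order_X_inert[OF i0M] s])
  hence "zp_cong p 2 (Y coeffW x) ((of_int (X_inert i0))\<^sup>2)" using xe by simp
  from unit_root_square[OF AB(2) X_inert_unit[OF i0M] this]
  have S: "zp_cong p 2 (Y coeffW x) (of_int (A\<^sup>2 - 2 * int p))" .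
  have "even A"
  proof -
    consider "d = 2" | "d = 1" using md by auto
    thus ?thesis
    proof cases
      case 1
      hence "A\<^sup>2 = 2 * (2 * int p - B\<^sup>2)" using AB(1) by simp
      hence "even (A\<^sup>2)" by simp
      thus ?thesis by simp
    next
      case 2
      hence "A mod 4 = 0" using AB(3) by (simp add: cong_def)
      thus ?thesis by presburger
    qed
  qed
  then obtain a where a: "A = 2 * a" by auto
  have dB: "d * B\<^sup>2 = 4 * (int p - a\<^sup>2)" using AB(1) a by (simp add: power2_eq_square)
  have "even B" using even_of_mult_square[OF dB] md by auto
  then obtain b where b: "B = 2 * b" by auto
  show ?thesis
  proof (rule that)
    show "a\<^sup>2 + d * b\<^sup>2 = int p" using dB b by (simp add: power_mult_distrib)
    show "zp_cong p 2 (Y coeffW x) (of_int (4 * a\<^sup>2 - 2 * int p))" using S a by (simp add: power_mult_distrib)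
    assume "d = 1"
    hence "(2 * a) mod 4 = 0" using AB(3) a by (simp add: cong_def)
    thus "even a" by presburger
  qed
qed

section \<open>The congruences for general x\<close>

lemma residue_decomposition: assumes "x \<in> Zp p"
  obtains t where "t \<in> Zp p" "x = of_nat p * t + of_nat (zp_residue p x)"
  using zp_residue(2)[OF assms] unfolding zp_cong_iff by (metis add.commute power_one_right)

lemma V_sum_even: assumes x: "x \<in> Zp p" and even: "even (zp_residue p x)"
  shows "zp_cong p 2 (Y coeffW x) (Y coeffS x)"
proof -
  obtain t where t: "t \<in> Zp p" "x = of_nat p * t + of_nat (zp_residue p x)" by (rule residue_decomposition[OF x])
  obtain i where i: "zp_residue p x = 2 * i" using even by auto
  have xe: "x = of_nat p * t + 2 * of_nat i" using t(2) i by simp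
  have "2 * i < p" using zp_residue(1)[OF x] i by simp
  note D = evens_unit[OF t(1) this]
  have "zp_cong p 2 ((evens i (of_nat p * t))\<^sup>2 * Y coeffW x) ((evens i (of_nat p * t))\<^sup>2 * Y coeffS x)"
    unfolding xe by (rule zp_cong_trans[OF Y_even[OF admissible_coeffW t(1)] zp_cong_sym[OF Y_even[OF admissible_coeffS t(1)]]])
  thus ?thesis
  proof (rule zp_cong_cancel)
    show "inverse ((evens i (of_nat p * t))\<^sup>2) \<in> Zp p" using Zp_power[OF D(1), of 2] by (simp only: power_inverse)
    show "(evens i (of_nat p * t))\<^sup>2 \<noteq> 0" using D by simp
  qed
qed

lemma V_sum_odd: assumes "t \<in> Zp p" "x = of_nat p * t + of_nat (2 * i + 1)" "2 * i + 1 < p"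
  shows "zp_cong p 1 (Y coeffW x) 0"
proof -
  have "x = of_nat p * t + 2 * of_nat i + 1" using assms(2) by simp
  thus ?thesis using zp_cong_weaken[OF Y_odd[OF admissible_coeffW assms(1,3)]] by simp
qed

lemma V_sum_odd_residue: assumes x: "x \<in> Zp p" and odd: "odd (zp_residue p x)"
  shows "zp_cong p 1 (Y coeffW x) 0"
proof -
  obtain t where t: "t \<in> Zp p" "x = of_nat p * t + of_nat (zp_residue p x)" by (rule residue_decomposition[OF x])
  obtain i where i: "zp_residue p x = 2 * i + 1" using odd by (elim oddE)
  show ?thesis using V_sum_odd[OF t(1) t(2)[unfolded i]] zp_residue(1)[OF x] i by simp
qed

section \<open>The values at -1/3, -1/4 and -1/6\<close>

lemma Zp_thirds: assumes "p > 3" shows "inverse 3 \<in> Zp p" "inverse 4 \<in> Zp p" "inverse 6 \<in> Zp p"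
proof -
  show 3: "inverse 3 \<in> Zp p" using nat_unit[of 3] assms by simp
  have "inverse 2 * inverse 2 \<in> Zp p" by (intro Zp_mult two_unit)
  thus "inverse 4 \<in> Zp p" by simp
  have "inverse 2 * inverse 3 \<in> Zp p" by (intro Zp_mult two_unit 3)
  thus "inverse 6 \<in> Zp p" by simp
qed

lemma V_scaled_sum: assumes "c \<noteq> 0"
  shows "(\<Sum>n=0..p-1. c ^ n * V n x / (- c) ^ n) = Y coeffW x"
proof -
  have "c ^ n * y / (- c) ^ n = (-1) ^ n * y" for n and y :: rat
  proof -
    have "(-1) ^ n * (-1) ^ n = (1 :: rat)" by (simp flip: power_mult_distrib)
    moreover have "(- c) ^ n = (-1) ^ n * c ^ n" by (simp add: power_minus')
    ultimately show ?thesis using assms by (simp add: field_simps)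
  qed
  thus ?thesis by (simp add: Y_coeffW)
qed

lemma V3_sum: "(\<Sum>n=0..p-1. V3 n / (-27) ^ n) = Y coeffW (- (1/3))"
  and V4_sum: "(\<Sum>n=0..p-1. V4 n / (-64) ^ n) = Y coeffW (- (1/4))"
  and V6_sum: "(\<Sum>n=0..p-1. V6 n / (-432) ^ n) = Y coeffW (- (1/6))"
  using V_scaled_sum[of 27] V_scaled_sum[of 64] V_scaled_sum[of 432] by (simp_all add: V3_def V4_def V6_def)

text \<open>The first equation says that \<open>-1/c\<close> has the odd residue
  \<open>2 i + 1\<close>; the quotient is \<open>t = - s / c\<close>.\<close>

lemma V_sum_odd_case:
  assumes a: "c * (2 * i + 1) + 1 = s * p" "2 * i + 1 < p" and c: "inverse (of_nat c) \<in> Zp p" "c > 0"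
  shows "zp_cong p 1 (Y coeffW (- inverse (of_nat c))) 0"
proof (rule V_sum_odd[OF _ _ a(2)])
  show "- of_nat s * inverse (of_nat c) \<in> Zp p" using c by (intro Zp_mult Zp_minus Zp_nat)
  have "of_nat c * of_nat (2 * i + 1) + 1 = (of_nat s * of_nat p :: rat)"
    using a(1) by (metis of_nat_1 of_nat_add of_nat_mult)
  moreover have "- inverse z = P * (- S * inverse z) + I" if "z * I + 1 = S * P" "z \<noteq> 0" for z I S P :: rat
    using that by (simp add: field_simps)
  moreover have "of_nat c \<noteq> (0 :: rat)" using c(2) by simp
  ultimately show "- inverse (of_nat c :: rat) = of_nat p * (- of_nat s * inverse (of_nat c)) + of_nat (2 * i + 1 :: nat)"
    by blast
qed

text \<open>An odd \<open>p\<close> congruent to 1 modulo 3 is 1 modulo 6, so only the split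
  evaluation with \<open>m = 6\<close> occurs.\<close>

lemma V3_split:
  assumes p3: "p > 3" and uv: "int p = u\<^sup>2 + 3 * v\<^sup>2" and p: "[p = 1] (mod 3)"
  shows "zp_cong p 2 (Y coeffW (- (1/3))) (4 * of_int u ^ 2 - 2 * of_nat p)"
proof -
  have "p mod 3 = 1" using p by (simp add: cong_def)
  hence "6 dvd p - 1" using p_odd by presburger
  moreover have "- (1/3) \<in> Zp p" using Zp_minus[OF Zp_thirds(1)[OF p3]] by simp
  ultimately obtain a b where ab: "a\<^sup>2 + 3 * b\<^sup>2 = int p" "zp_cong p 2 (Y coeffW (- (1/3))) (of_int (4 * a\<^sup>2 - 2 * int p))"
    using Y_split[of 6 3 "- (1/3)"] p3 by auto
  have "a\<^sup>2 = u\<^sup>2" using square_representation_unique[OF pint ab(1) uv[symmetric]] by auto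
  thus ?thesis using ab(2) by simp
qed

text \<open>Here \<open>m = 8\<close>: residue 1 modulo 8 is the split case, and for residue 3 the
  number \<open>(p + 1)/4\<close> is odd, which is the inert case.\<close>

lemma V4_split:
  assumes p3: "p > 3" and uv: "int p = u\<^sup>2 + 2 * v\<^sup>2" and p: "[p = 1] (mod 8) \<or> [p = 3] (mod 8)"
  shows "zp_cong p 2 (Y coeffW (- (1/4))) (4 * of_int u ^ 2 - 2 * of_nat p)"
proof -
  have Z: "- (1/4) \<in> Zp p" using Zp_minus[OF Zp_thirds(2)[OF p3]] by simp
  obtain a b where ab: "a\<^sup>2 + 2 * b\<^sup>2 = int p" "zp_cong p 2 (Y coeffW (- (1/4))) (of_int (4 * a\<^sup>2 - 2 * int p))"
  proof (cases "[p = 1] (mod 8)")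
    case True
    hence "p mod 8 = 1" by (simp add: cong_def)
    hence "8 dvd p - 1" by presburger
    thus ?thesis using Y_split[of 8 2 "- (1/4)"] Z p3 that by auto
  next
    case False
    hence "p mod 8 = 3" using p by (simp add: cong_def)
    hence "p + 1 = 4 * (2 * (p div 8) + 1)" by presburger
    thus ?thesis using Y_inert[of 8 2 "2 * (p div 8) + 1" "- (1/4)"] Z p3 that by auto
  qed
  have "a\<^sup>2 = u\<^sup>2" using square_representation_unique[OF pint ab(1) uv[symmetric]] by auto
  thus ?thesis using ab(2) by simp
qed

text \<open>With \<open>m = 12\<close>, for \<open>p = 1\<close> modulo 12 the evaluation is split,
  \<open>a\<close> is odd and matches \<open>u\<close>, and \<open>p div 3\<close> is even. For
  \<open>p = 5\<close> modulo 12 it is inert, \<open>a\<close> is even and matches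
  \<open>2 v\<close>, and \<open>p div 3\<close> is odd.\<close>

lemma V6_split:
  assumes p3: "p > 3" and uv: "int p = u\<^sup>2 + 4 * v\<^sup>2" and p: "[p = 1] (mod 4)"
  shows "zp_cong p 2 (Y coeffW (- (1/6))) ((-1) ^ (p div 3) * (4 * of_int u ^ 2 - 2 * of_nat p))"
proof -
  have Z: "- (1/6) \<in> Zp p" using Zp_minus[OF Zp_thirds(3)[OF p3]] by simp
  have uv': "u\<^sup>2 + 1 * (2 * v)\<^sup>2 = int p" using uv by (simp add: power_mult_distrib)
  have ou: "odd u"
  proof
    assume "even u"
    hence "even (int p)" unfolding uv by simp
    thus False using p_odd by simp
  qed
  have "\<not> 3 dvd p" using p_prime p3 by (auto simp: prime_nat_iff)
  moreover have "p mod 4 = 1" using p by (simp add: cong_def)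
  ultimately have p12: "p mod 12 = 1 \<or> p mod 12 = 5" by (rule mod_12_cases(1))
  show ?thesis
  proof (cases "p mod 12 = 1")
    case True
    hence "12 dvd p - 1" "even (p div 3)" by presburger+
    moreover obtain a b where ab: "a\<^sup>2 + 1 * b\<^sup>2 = int p" "zp_cong p 2 (Y coeffW (- (1/6))) (of_int (4 * a\<^sup>2 - 2 * int p))" "odd a"
      using Y_split[of 12 1 "- (1/6)"] \<open>12 dvd p - 1\<close> Z p3 by auto
    have "a\<^sup>2 = u\<^sup>2 \<or> a\<^sup>2 = (2 * v)\<^sup>2" using square_representation_unique[OF pint ab(1) uv'] by auto
    moreover have "odd (a\<^sup>2)" "even ((2 * v)\<^sup>2)" using ab(3) by auto
    ultimately have "a\<^sup>2 = u\<^sup>2" by metis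
    thus ?thesis using ab(2) \<open>even (p div 3)\<close> by simp
  next
    case False
    hence m: "p mod 12 = 5" using p12 by simp
    hence r: "p + 1 = 6 * (2 * (p div 12) + 1)" and o: "odd (p div 3)" by presburger+
    obtain a b where ab: "a\<^sup>2 + 1 * b\<^sup>2 = int p" "zp_cong p 2 (Y coeffW (- (1/6))) (of_int (4 * a\<^sup>2 - 2 * int p))" "even a"
      using Y_inert[of 12 1 "2 * (p div 12) + 1" "- (1/6)"] r Z p3 by auto
    have "a\<^sup>2 = u\<^sup>2 \<or> a\<^sup>2 = (2 * v)\<^sup>2" using square_representation_unique[OF pint ab(1) uv'] by auto
    moreover have "even (a\<^sup>2)" "odd (u\<^sup>2)" using ab(3) ou by auto
    ultimately have "a\<^sup>2 = int p - u\<^sup>2" using uv' by (metis add_diff_cancel_left' mult_1)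
    hence "4 * a\<^sup>2 - 2 * int p = - (4 * u\<^sup>2 - 2 * int p)" by simp
    hence "zp_cong p 2 (Y coeffW (- (1/6))) (of_int (- (4 * u\<^sup>2 - 2 * int p)))" using ab(2) by metis
    thus ?thesis using o by simp
  qed
qed

lemma V3_inert: assumes p3: "p > 3" and p: "[p = 2] (mod 3)" shows "zp_cong p 1 (Y coeffW (- (1/3))) 0"
proof -
  have "p mod 3 = 2" using p by (simp add: cong_def)
  hence "p = 6 * (p div 6) + 5" using p_odd by presburger
  then obtain j where j: "p = 6 * j + 5" by blast
    \<comment> \<open>The residue of \<open>-1/3\<close> is
      \<open>(2 p - 1)/3 = 4 j + 3\<close>.\<close>
    have "3 * (2 * (2 * j + 1) + 1) + 1 = 2 * p" "2 * (2 * j + 1) + 1 < p" using j by auto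
    from V_sum_odd_case[OF this] show ?thesis using Zp_thirds[OF p3] by (simp add: inverse_eq_divide)
qed

lemma V4_inert: assumes p3: "p > 3" and p: "[p = 5] (mod 8) \<or> [p = 7] (mod 8)" shows "zp_cong p 1 (Y coeffW (- (1/4))) 0"
proof -
  have "p mod 8 = 5 \<or> p mod 8 = 7" using p by (simp add: cong_def)
  hence "p = 8 * (p div 8) + 5 \<or> p = 8 * (p div 8) + 7" by presburger
  then obtain j where "p = 8 * j + 5 \<or> p = 8 * j + 7" by blast
  thus ?thesis
  proof
    assume j: "p = 8 * j + 5"
    have "4 * (2 * (j) + 1) + 1 = 1 * p" "2 * (j) + 1 < p" using j by auto
    from V_sum_odd_case[OF this] show ?thesis using Zp_thirds[OF p3] by (simp add: inverse_eq_divide)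
  next
    assume j: "p = 8 * j + 7"
    \<comment> \<open>The residue of \<open>-1/4\<close> is
      \<open>(3 p - 1)/4 = 6 j + 5\<close>.\<close>
    have "4 * (2 * (3 * j + 2) + 1) + 1 = 3 * p" "2 * (3 * j + 2) + 1 < p" using j by auto
    from V_sum_odd_case[OF this] show ?thesis using Zp_thirds[OF p3] by (simp add: inverse_eq_divide)
  qed
qed

lemma V6_inert: assumes p3: "p > 3" and p: "[p = 3] (mod 4)" shows "zp_cong p 1 (Y coeffW (- (1/6))) 0"
proof -
  have "\<not> 3 dvd p" using p_prime p3 by (auto simp: prime_nat_iff)
  moreover have "p mod 4 = 3" using p by (simp add: cong_def)
  ultimately have "p mod 12 = 7 \<or> p mod 12 = 11" by (rule mod_12_cases(2))
  hence "p = 12 * (p div 12) + 7 \<or> p = 12 * (p div 12) + 11" by presburger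
  then obtain j where "p = 12 * j + 7 \<or> p = 12 * j + 11" by blast
  thus ?thesis
  proof
    assume j: "p = 12 * j + 7"
    have "6 * (2 * (j) + 1) + 1 = 1 * p" "2 * (j) + 1 < p" using j by auto
    from V_sum_odd_case[OF this] show ?thesis using Zp_thirds[OF p3] by (simp add: inverse_eq_divide)
  next
    assume j: "p = 12 * j + 11"
    \<comment> \<open>The residue of \<open>-1/6\<close> is
      \<open>(5 p - 1)/6 = 10 j + 9\<close>.\<close>
    have "6 * (2 * (5 * j + 4) + 1) + 1 = 5 * p" "2 * (5 * j + 4) + 1 < p" using j by auto
    from V_sum_odd_case[OF this] show ?thesis using Zp_thirds[OF p3] by (simp add: inverse_eq_divide)
  qed
qed

end

theorem theorem4p7:
  fixes p :: nat
  assumes "prime p" and "odd p"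
  shows
    "(\<forall>x \<in> Zp p. \<not> zp_cong p 1 x 0 \<longrightarrow>
        (even (zp_residue p x) \<longrightarrow>
           zp_cong p 2 (\<Sum>n=0..p-1. (-1) ^ n * V n x)
             (\<Sum>k=0..(p-1) div 2. of_nat ((2*k) choose k) * (x gchoose k) * ((-1 - x) gchoose k)
                                  * (1 / 4 ^ k))) \<and>
        (odd (zp_residue p x) \<longrightarrow>
           zp_cong p 1 (\<Sum>n=0..p-1. (-1) ^ n * V n x) 0))
     \<and>
     (p > 3 \<longrightarrow>
        (\<forall>u v :: int. int p = u^2 + 3 * v^2 \<and> [p = 1] (mod 3) \<longrightarrow>
           zp_cong p 2 (\<Sum>n=0..p-1. V3 n / (-27) ^ n) (4 * of_int u ^ 2 - 2 * of_nat p)) \<and>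
        ([p = 2] (mod 3) \<longrightarrow>
           zp_cong p 1 (\<Sum>n=0..p-1. V3 n / (-27) ^ n) 0) \<and>
        (\<forall>u v :: int. int p = u^2 + 2 * v^2 \<and> ([p = 1] (mod 8) \<or> [p = 3] (mod 8)) \<longrightarrow>
           zp_cong p 2 (\<Sum>n=0..p-1. V4 n / (-64) ^ n) (4 * of_int u ^ 2 - 2 * of_nat p)) \<and>
        ([p = 5] (mod 8) \<or> [p = 7] (mod 8) \<longrightarrow>
           zp_cong p 1 (\<Sum>n=0..p-1. V4 n / (-64) ^ n) 0) \<and>
        (\<forall>u v :: int. int p = u^2 + 4 * v^2 \<and> [p = 1] (mod 4) \<longrightarrow>
           zp_cong p 2 (\<Sum>n=0..p-1. V6 n / (-432) ^ n)
             ((-1) ^ (p div 3) * (4 * of_int u ^ 2 - 2 * of_nat p))) \<and>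
        ([p = 3] (mod 4) \<longrightarrow>
           zp_cong p 1 (\<Sum>n=0..p-1. V6 n / (-432) ^ n) 0))"
  proof -
  have "p = 2 * ((p - 1) div 2) + 1" using assms(2) by presburger
  then interpret odd_prime p "(p - 1) div 2"
    using assms(1) by unfold_locales
  show ?thesis
    unfolding V3_sum V4_sum V6_sum Y_coeffW[symmetric] Y_coeffS[symmetric]
    using V_sum_even V_sum_odd_residue V3_split V3_inert V4_split V4_inert V6_split V6_inert
    by blast
qed

end
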